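(* For any non-kissing finite gentle quiver $\bar Q$, the non-kissing fan $\mathcal{F}(\bar Q)$ has the unique exchange relation property.
   Context: Gentle quivers. A bound quiver $\bar Q=(Q,I)$ is a finite quiver $Q=(Q_0,Q_1,s,t)$ with an ideal $I$ of its path algebra generated by linear combinations of paths of length at least two and containing all sufficiently long paths (paths are written $\alpha\beta$ with $t(\alpha)=s(\beta)$). It is gentle if each vertex has at most two incoming and two outgoing arrows, $I$ is generated by paths of length exactly two, and for each arrow $\beta$ there is at most one arrow $\alpha$ with $t(\alpha)=s(\beta)$ and $\alpha\beta\notin I$ (resp. $\alpha\beta\in I$), and at most one arrow $\gamma$ with $t(\beta)=s(\gamma)$ and $\beta\gamma\notin I$ (resp. $\beta\gamma\in I$). The blossoming quiver $\bar Q^*$ is the gentle quiver obtained by attaching to the vertices of $Q$ additional incoming and outgoing arrows to new univalent vertices (blossoms), so that each vertex of $Q$ has exactly two incoming and two outgoing arrows (with relations extended so as to be gentle). Walks. A string is a word $\alpha_1^{\varepsilon_1}\cdots\alpha_\ell^{\varepsilon_\ell}$ with arrows $\alpha_i$, $\varepsilon_i=\pm1$, $t(\alpha_i^{\varepsilon_i})=s(\alpha_{i+1}^{\varepsilon_{i+1}})$, containing no factor $\pi$ or $\pi^{-1}$ with $\pi$ a path in $I$ and no factor $\alpha\alpha^{-1}$ or $\alpha^{-1}\alpha$; for each vertex $a$ there is also a length-zero string $\varepsilon_a$. A string is identified with its inverse. A walk is a maximal string of $\bar Q^*$ (both endpoints are blossoms). A substring of a walk $\omega=\alpha_1^{\varepsilon_1}\cdots\alpha_\ell^{\varepsilon_\ell}$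 is a factor $\alpha_{i+1}^{\varepsilon_{i+1}}\cdots\alpha_{j-1}^{\varepsilon_{j-1}}$, $1\le i<j\le\ell$ (with its position; for $j=i+1$ it is a length-zero string). It is on top of $\omega$ if $\varepsilon_i=-1,\varepsilon_j=1$ and at the bottom if $\varepsilon_i=1,\varepsilon_j=-1$. $\Sigma_{top}(\omega)$, $\Sigma_{bot}(\omega)$ are the sets of (undirected) strings occurring as top, bottom substrings. Peaks (deeps) of $\omega$ are its length-zero top (bottom) substrings. $\omega$ is straight if it has no peak or deep. $\omega$ kisses $\omega'$ if $\Sigma_{top}(\omega)\cap\Sigma_{bot}(\omega')\ne\varnothing$; two walks are kissing if one kisses the other; $\omega$ is self-kissing if it kisses itself. A walk is proper if neither straight nor self-kissing. Fan. The non-kissing complex has as faces the collections of pairwise non-kissing proper walks; $\bar Q$ is non-kissing finite if this complex is finite. The $g$-vector of $\omega$ is $g(\omega)=\sum_{v\text{ peak}}e_v-\sum_{v\text{ deep}}e_v\in\mathbb{R}^{Q_0}$ (with multiplicity). When the complex is finite, the cones $\mathbb{R}_{\ge0}\{g(\omega)\mid\omega\in F\}$, $F$ a face, form an essential complete simplicial fan $\mathcal{F}(\bar Q)$ in $\mathbb{R}^{Q_0}$, the non-kissing fan, whose rays correspond to proper walks and are represented by their $g$-vectors. Unique exchange relation property. Let $\mathcal{F}$ be an essential complete simplicial fan with chosen ray representatives. Two rays $r,r'$ are exchangeable if there are adjacent maximal cones $\mathbb{R}_{\ge0}\mathbf{R}$, $\mathbb{R}_{\ge0}\mathbf{R}'$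 of $\mathcal{F}$ with $\mathbf{R}\smallsetminus\{r\}=\mathbf{R}'\smallsetminus\{r'\}$. For such cones let $\sum_{s\in\mathbf{R}\cup\mathbf{R}'}\alpha_{\mathbf{R},\mathbf{R}'}(s)\,s=0$ be the unique linear dependence with $\alpha_{\mathbf{R},\mathbf{R}'}(r),\alpha_{\mathbf{R},\mathbf{R}'}(r')>0$ and $\alpha_{\mathbf{R},\mathbf{R}'}(r)+\alpha_{\mathbf{R},\mathbf{R}'}(r')=2$. $\mathcal{F}$ has the unique exchange relation property if for any exchangeable rays $r,r'$ this linear dependence depends only on $\{r,r'\}$ and not on the choice of the pair $\{\mathbf{R},\mathbf{R}'\}$. *)

theory Defs
  imports
    "HOL-Analysis.Analysis"
    "HOL-Algebra.Ideal"
    "Graph_Theory.Arc_Walk"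
begin

section \<open>Path algebras and gentle quivers\<close>

text \<open>
  Quivers are \<open>pre_digraph\<close>s with \<open>s = tail\<close> and \<open>t = head\<close>; \<open>fin_digraph\<close> allows loops and multiple
  arrows.  A path is a pair of a start vertex and a list of arrows, so that \<open>(v, [])\<close> is the
  path of length zero at \<open>v\<close>.  The path \<open>\<alpha>\<beta>\<close> with \<open>t(\<alpha>) = s(\<beta>)\<close> has arrow list \<open>[\<alpha>, \<beta>]\<close>.
\<close>

definition paths :: "('v, 'e) pre_digraph \<Rightarrow> ('v \<times> 'e list) set" where
  "paths Q = {(u, p). \<exists>v. pre_digraph.awalk Q u p v}"

definition path_end :: "('v, 'e) pre_digraph \<Rightarrow> 'v \<Rightarrow> 'e list \<Rightarrow> 'v" where
  "path_end Q u p = last (pre_digraph.awalk_verts Q u p)"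

text \<open>
  An element of the path algebra is the function giving its coefficient at each path; the product
  is convolution over all ways of cutting a path in two.
\<close>

definition path_algebra :: "('v, 'e) pre_digraph \<Rightarrow> ('v \<times> 'e list \<Rightarrow> 'k::field) ring" where
  "path_algebra Q =
    \<lparr> carrier = {f. finite {x. f x \<noteq> 0} \<and> {x. f x \<noteq> 0} \<subseteq> paths Q},
      monoid.mult = (\<lambda>f g (u, p). \<Sum>i\<le>length p. f (u, take i p) * g (path_end Q u (take i p), drop i p)),
      one = (\<lambda>(u, p). if u \<in> verts Q \<and> p = [] then 1 else 0),
      zero = (\<lambda>x. 0),
      add = (\<lambda>f g x. f x + g x) \<rparr>"

text \<open>\<open>ideal\<close> and \<open>Idl\<close> below presuppose that the path algebra is a ring.\<close>

lemma path_end_Nil [simp]: "path_end Q u [] = u"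
  by (simp add: path_end_def pre_digraph.awalk_verts.simps)

lemma path_end_Cons [simp]: "path_end Q u (e # p) = path_end Q (head Q e) p"
  by (cases p) (simp_all add: path_end_def pre_digraph.awalk_verts.simps)

lemma path_end_append: "path_end Q u (p @ q) = path_end Q (path_end Q u p) q"
  by (induction p arbitrary: u) simp_all

lemma paths_iff:
  "(u, p) \<in> paths Q \<longleftrightarrow> u \<in> verts Q \<and> set p \<subseteq> arcs Q \<and> pre_digraph.cas Q u p (path_end Q u p)"
proof -
  have "pre_digraph.cas Q u p v \<Longrightarrow> v = path_end Q u p" for v
    by (induction p arbitrary: u) (simp_all add: pre_digraph.cas.simps)
  then show ?thesis by (auto simp: paths_def pre_digraph.awalk_def)
qed

lemma cas_path_append:
  "pre_digraph.cas Q u (p @ q) v \<longleftrightarrow> pre_digraph.cas Q u p (path_end Q u p) \<and> pre_digraph.cas Q (path_end Q u p) q v"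
  by (induction p arbitrary: u) (simp_all add: pre_digraph.cas.simps)

lemma paths_append:
  assumes "(u, p) \<in> paths Q" "(path_end Q u p, q) \<in> paths Q"
  shows "(u, p @ q) \<in> paths Q"
  using assms by (auto simp: paths_iff cas_path_append path_end_append)

abbreviation path_mult where "path_mult Q \<equiv> monoid.mult (path_algebra Q)"

lemma path_mult_eq: "path_mult Q f g (u,p) = (\<Sum>i\<le>length p. f (u, take i p) * g (path_end Q u (take i p), drop i p))"
  by (simp add: path_algebra_def)

lemma path_mult_assoc:
  fixes Q :: "('v,'e) pre_digraph" and f g h :: "'v \<times> 'e list \<Rightarrow> 'k::field"
  shows "path_mult Q (path_mult Q f g) h = path_mult Q f (path_mult Q g h)"
proof (rule ext, clarify)
  fix u :: 'v and p :: "'e list"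
  let ?n = "length p"
  let ?F = "\<lambda>i j. f (u, take j p) * g (path_end Q u (take j p), take (i-j) (drop j p)) * h (path_end Q u (take i p), drop i p)"
  have "path_mult Q (path_mult Q f g) h (u,p) = (\<Sum>i\<le>?n. \<Sum>j\<le>i. ?F i j)"
    by (auto simp: path_mult_eq sum_distrib_right drop_take intro!: sum.cong)
  also have "\<dots> = (\<Sum>j\<le>?n. \<Sum>k\<le>?n-j. ?F (j+k) j)"
    unfolding sum.Sigma[OF finite_atMost ballI[OF finite_atMost]]
    by (rule sum.reindex_bij_witness[where i="\<lambda>(j,k). (j+k,j)" and j="\<lambda>(i,j). (j,i-j)"]) auto
  also have "\<dots> = path_mult Q f (path_mult Q g h) (u,p)"
    by (auto simp: path_mult_eq sum_distrib_left take_add path_end_append mult.assoc add.commute intro!: sum.cong)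
  finally show "path_mult Q (path_mult Q f g) h (u,p) = path_mult Q f (path_mult Q g h) (u,p)" .
qed

lemma path_mult_closed:
  assumes "f \<in> carrier (path_algebra Q)" "g \<in> carrier (path_algebra Q)"
  shows "path_mult Q f g \<in> carrier (path_algebra Q)"
proof -
  let ?X = "{x. f x \<noteq> 0} \<times> {x. g x \<noteq> 0}"
  have 1: "\<exists>i\<le>length p. f (u, take i p) \<noteq> 0 \<and> g (path_end Q u (take i p), drop i p) \<noteq> 0"
    if "path_mult Q f g (u,p) \<noteq> 0" for u p
    using that unfolding path_mult_eq by (metis (no_types, lifting) atMost_iff mult_zero_left mult_zero_right sum.neutral)
  have "{x. path_mult Q f g x \<noteq> 0} \<subseteq> (\<lambda>((u,p),(v,q)). (u, p@q)) ` ?X"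
  proof clarify
    fix u p assume "path_mult Q f g (u,p) \<noteq> 0"
    from 1[OF this] obtain i where i: "f (u, take i p) \<noteq> 0" "g (path_end Q u (take i p), drop i p) \<noteq> 0" by blast
    show "(u,p) \<in> (\<lambda>((u,p),(v,q)). (u, p@q)) ` ?X"
      by (rule image_eqI[of _ _ "((u, take i p), (path_end Q u (take i p), drop i p))"]) (use i in auto)
  qed
  moreover have "finite ?X" using assms by (simp add: path_algebra_def)
  ultimately have "finite {x. path_mult Q f g x \<noteq> 0}" by (meson finite_imageI finite_subset)
  moreover have "{x. path_mult Q f g x \<noteq> 0} \<subseteq> paths Q"
  proof clarify
    fix u p assume "path_mult Q f g (u,p) \<noteq> 0"
    from 1[OF this] obtain i where i: "f (u, take i p) \<noteq> 0" "g (path_end Q u (take i p), drop i p) \<noteq> 0" by blast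
    then have "(u, take i p) \<in> paths Q" "(path_end Q u (take i p), drop i p) \<in> paths Q"
      using assms by (auto simp: path_algebra_def)
    from paths_append[OF this] show "(u,p) \<in> paths Q" by simp
  qed
  ultimately show ?thesis by (simp add: path_algebra_def)
qed

lemma ring_path_algebra:
  assumes "fin_digraph Q"
  shows "ring (path_algebra Q :: ('v \<times> 'e list \<Rightarrow> 'k::field) ring)"
proof -
  interpret fin_digraph Q by fact
  let ?R = "path_algebra Q :: ('v \<times> 'e list \<Rightarrow> 'k) ring"
  have c: "carrier ?R = {f. finite {x. f x \<noteq> 0} \<and> {x. f x \<noteq> 0} \<subseteq> paths Q}"
    and a: "add ?R = (\<lambda>f g x. f x + g x)" and z: "zero ?R = (\<lambda>x. 0)"
    and o: "one ?R = (\<lambda>(u, p). if u \<in> verts Q \<and> p = [] then 1 else 0)"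
    by (simp_all add: path_algebra_def)
  have plus: "(\<lambda>x. f x + g x) \<in> carrier ?R" if "f \<in> carrier ?R" "g \<in> carrier ?R" for f g
  proof -
    have "{x. f x + g x \<noteq> 0} \<subseteq> {x. f x \<noteq> 0} \<union> {x. g x \<noteq> 0}" by auto
    with that show ?thesis unfolding c by (auto intro: finite_subset)
  qed
  have one: "one ?R \<in> carrier ?R"
  proof -
    have "{x. one ?R x \<noteq> 0} \<subseteq> (\<lambda>u. (u,[])) ` verts Q" unfolding o by (auto split: if_splits)
    moreover have "(\<lambda>u. (u,[])) ` verts Q \<subseteq> paths Q" by (auto simp: paths_iff cas.simps)
    ultimately show ?thesis unfolding c by (auto intro: finite_subset)
  qed
  have dom: "f (u,p) = 0" if "f \<in> carrier ?R" "u \<notin> verts Q \<or> path_end Q u p \<notin> verts Q" for f u p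
  proof -
    have "path_end Q u p \<in> verts Q" if "(u,p) \<in> paths Q"
    proof -
      from that obtain v where "awalk u p v" by (auto simp: paths_def)
      then have "path_end Q u p = v" "v \<in> verts Q" by (auto simp: path_end_def)
      then show ?thesis by simp
    qed
    with that show ?thesis unfolding c by (auto simp: paths_iff)
  qed
  show ?thesis
  proof (intro ringI)
    show "abelian_group ?R"
    proof (rule abelian_groupI)
      fix f assume f: "f \<in> carrier ?R"
      then have "(\<lambda>x. - f x) \<in> carrier ?R" unfolding c by simp
      moreover have "add ?R (\<lambda>x. - f x) f = zero ?R" unfolding a z by simp
      ultimately show "\<exists>y\<in>carrier ?R. add ?R y f = zero ?R" by blast
    qed (use plus in \<open>auto simp: a z add_ac\<close>, simp add: c)
    show "monoid ?R"
    proof (rule monoidI)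
      fix f assume f: "f \<in> carrier ?R"
      show "path_mult Q (one ?R) f = f"
      proof (rule ext, clarify)
        fix u p
        have "path_mult Q (one ?R) f (u,p) = (\<Sum>i\<le>length p. if i = 0 then (if u \<in> verts Q then f (u,p) else 0) else 0)"
          unfolding path_mult_eq o by (intro sum.cong) auto
        also have "\<dots> = f (u,p)" using dom[OF f, of u p] by simp
        finally show "path_mult Q (one ?R) f (u,p) = f (u,p)" .
      qed
      show "path_mult Q f (one ?R) = f"
      proof (rule ext, clarify)
        fix u p
        have "path_mult Q f (one ?R) (u,p) = (\<Sum>i\<le>length p. if i = length p then (if path_end Q u p \<in> verts Q then f (u,p) else 0) else 0)"
          unfolding path_mult_eq o by (intro sum.cong) auto
        also have "\<dots> = f (u,p)" using dom[OF f, of u p] by simp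
        finally show "path_mult Q f (one ?R) (u,p) = f (u,p)" .
      qed
    qed (auto simp: path_mult_closed one path_mult_assoc)
  qed (auto simp: fun_eq_iff path_mult_eq a algebra_simps sum.distrib)
qed

definition basis_path :: "'v \<times> 'e list \<Rightarrow> ('v \<times> 'e list \<Rightarrow> 'k::field)" where
  "basis_path x = (\<lambda>y. if y = x then 1 else 0)"

text \<open>The path with a given nonempty list of (composable) arrows, as element of the algebra.\<close>

definition arrows_elem :: "('v, 'e) pre_digraph \<Rightarrow> 'e list \<Rightarrow> ('v \<times> 'e list \<Rightarrow> 'k::field)" where
  "arrows_elem Q p = basis_path (tail Q (hd p), p)"

definition bound_quiver :: "('v, 'e) pre_digraph \<Rightarrow> ('v \<times> 'e list \<Rightarrow> 'k::field) set \<Rightarrow> bool" where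
  "bound_quiver Q I \<longleftrightarrow>
     fin_digraph Q \<and>
     ideal I (path_algebra Q) \<and>
     (\<exists>S \<subseteq> carrier (path_algebra Q).
        (\<forall>f\<in>S. \<forall>u p. f (u, p) \<noteq> 0 \<longrightarrow> 2 \<le> length p) \<and> I = Idl\<^bsub>path_algebra Q\<^esub> S) \<and>
     (\<exists>N. \<forall>(u, p)\<in>paths Q. N \<le> length p \<longrightarrow> basis_path (u, p) \<in> I)"

definition gentle_quiver :: "('v, 'e) pre_digraph \<Rightarrow> ('v \<times> 'e list \<Rightarrow> 'k::field) set \<Rightarrow> bool" where
  "gentle_quiver Q I \<longleftrightarrow>
     bound_quiver Q I \<and>
     (\<forall>v\<in>verts Q. in_degree Q v \<le> 2 \<and> out_degree Q v \<le> 2) \<and>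
     (\<exists>S \<subseteq> {(u, p) \<in> paths Q. length p = 2}. I = Idl\<^bsub>path_algebra Q\<^esub> (basis_path ` S)) \<and>
     (\<forall>\<beta>\<in>arcs Q.
        card {\<alpha>\<in>arcs Q. head Q \<alpha> = tail Q \<beta> \<and> arrows_elem Q [\<alpha>, \<beta>] \<notin> I} \<le> 1 \<and>
        card {\<alpha>\<in>arcs Q. head Q \<alpha> = tail Q \<beta> \<and> arrows_elem Q [\<alpha>, \<beta>] \<in> I} \<le> 1 \<and>
        card {\<gamma>\<in>arcs Q. head Q \<beta> = tail Q \<gamma> \<and> arrows_elem Q [\<beta>, \<gamma>] \<notin> I} \<le> 1 \<and>
        card {\<gamma>\<in>arcs Q. head Q \<beta> = tail Q \<gamma> \<and> arrows_elem Q [\<beta>, \<gamma>] \<in> I} \<le> 1)"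

section \<open>The blossoming quiver\<close>

text \<open>
  The same names serve for the new univalent vertices and for the new arrows: \<open>In_Blossom v n\<close>
  is an arrow from its own blossom vertex to \<open>v\<close>, and \<open>Out_Blossom v n\<close> one from \<open>v\<close> to its own
  blossom vertex.
\<close>

datatype 'v blossom = In_Blossom 'v nat | Out_Blossom 'v nat

definition blossoms :: "('v, 'e) pre_digraph \<Rightarrow> 'v blossom set" where
  "blossoms Q =
     {In_Blossom v n | v n. v \<in> verts Q \<and> n < 2 - in_degree Q v} \<union>
     {Out_Blossom v n | v n. v \<in> verts Q \<and> n < 2 - out_degree Q v}"

fun blossom_tail :: "'v blossom \<Rightarrow> 'v + 'v blossom" where
  "blossom_tail (In_Blossom v n) = Inr (In_Blossom v n)"
| "blossom_tail (Out_Blossom v n) = Inl v"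

fun blossom_head :: "'v blossom \<Rightarrow> 'v + 'v blossom" where
  "blossom_head (In_Blossom v n) = Inl v"
| "blossom_head (Out_Blossom v n) = Inr (Out_Blossom v n)"

definition blossoming_quiver ::
    "('v, 'e) pre_digraph \<Rightarrow> ('v + 'v blossom, 'e + 'v blossom) pre_digraph" where
  "blossoming_quiver Q =
    \<lparr> verts = verts Q <+> blossoms Q,
      arcs = arcs Q <+> blossoms Q,
      tail = case_sum (Inl \<circ> tail Q) blossom_tail,
      head = case_sum (Inl \<circ> head Q) blossom_head \<rparr>"

text \<open>
  The ideal of the blossoming quiver: it is gentle and the relations between arrows of \<open>Q\<close> are
  those of \<open>I\<close>.  It always exists, and is unique up to renaming the blossoms.
\<close>

definition blossoming_ideal ::
    "('v, 'e) pre_digraph \<Rightarrow> ('v \<times> 'e list \<Rightarrow> 'k::field) set \<Rightarrow>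
     (('v + 'v blossom) \<times> ('e + 'v blossom) list \<Rightarrow> 'k) set \<Rightarrow> bool" where
  "blossoming_ideal Q I J \<longleftrightarrow>
     gentle_quiver (blossoming_quiver Q) J \<and>
     (\<forall>\<alpha>\<in>arcs Q. \<forall>\<beta>\<in>arcs Q. head Q \<alpha> = tail Q \<beta> \<longrightarrow>
        (arrows_elem (blossoming_quiver Q) [Inl \<alpha>, Inl \<beta>] \<in> J \<longleftrightarrow> arrows_elem Q [\<alpha>, \<beta>] \<in> I))"

section \<open>Strings and walks\<close>

text \<open>
  The letter \<open>(\<alpha>, True)\<close> stands for \<open>\<alpha>\<close> and \<open>(\<alpha>, False)\<close> for its formal inverse.  A word is a
  start vertex with a list of letters, so that \<open>(a, [])\<close> is the string of length zero at \<open>a\<close>.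
\<close>

type_synonym 'e letter = "'e \<times> bool"
type_synonym ('v, 'e) word = "'v \<times> 'e letter list"

fun letter_source :: "('v, 'e) pre_digraph \<Rightarrow> 'e letter \<Rightarrow> 'v" where
  "letter_source Q (\<alpha>, \<epsilon>) = (if \<epsilon> then tail Q \<alpha> else head Q \<alpha>)"

fun letter_target :: "('v, 'e) pre_digraph \<Rightarrow> 'e letter \<Rightarrow> 'v" where
  "letter_target Q (\<alpha>, \<epsilon>) = (if \<epsilon> then head Q \<alpha> else tail Q \<alpha>)"

fun letter_inverse :: "'e letter \<Rightarrow> 'e letter" where
  "letter_inverse (\<alpha>, \<epsilon>) = (\<alpha>, \<not> \<epsilon>)"

definition inverse_letters :: "'e letter list \<Rightarrow> 'e letter list" where
  "inverse_letters ls = rev (map letter_inverse ls)"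

fun word_end :: "('v, 'e) pre_digraph \<Rightarrow> ('v, 'e) word \<Rightarrow> 'v" where
  "word_end Q (u, ls) = (if ls = [] then u else letter_target Q (last ls))"

fun word_inverse :: "('v, 'e) pre_digraph \<Rightarrow> ('v, 'e) word \<Rightarrow> ('v, 'e) word" where
  "word_inverse Q (u, ls) = (word_end Q (u, ls), inverse_letters ls)"

definition factors :: "'a list \<Rightarrow> 'a list set" where
  "factors ls = {ys. \<exists>xs zs. ls = xs @ ys @ zs}"

text \<open>Any factor of the form \<open>\<pi>\<close> of a word is automatically a path, by composability of the letters.\<close>

fun is_string ::
    "('v, 'e) pre_digraph \<Rightarrow> ('v \<times> 'e list \<Rightarrow> 'k::field) set \<Rightarrow> ('v, 'e) word \<Rightarrow> bool" where
  "is_string Q I (u, ls) \<longleftrightarrow>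
     u \<in> verts Q \<and> fst ` set ls \<subseteq> arcs Q \<and>
     (ls \<noteq> [] \<longrightarrow> letter_source Q (hd ls) = u) \<and>
     (\<forall>i. Suc i < length ls \<longrightarrow> letter_target Q (ls ! i) = letter_source Q (ls ! Suc i)) \<and>
     (\<forall>p. p \<noteq> [] \<and> arrows_elem Q p \<in> I \<longrightarrow>
        map (\<lambda>\<alpha>. (\<alpha>, True)) p \<notin> factors ls \<and>
        inverse_letters (map (\<lambda>\<alpha>. (\<alpha>, True)) p) \<notin> factors ls) \<and>
     (\<forall>\<alpha>. [(\<alpha>, True), (\<alpha>, False)] \<notin> factors ls \<and> [(\<alpha>, False), (\<alpha>, True)] \<notin> factors ls)"

fun factor_word :: "('v, 'e) pre_digraph \<Rightarrow> ('v, 'e) word \<Rightarrow> ('v, 'e) word \<Rightarrow> bool" where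
  "factor_word Q (u, ls) (u', ls') \<longleftrightarrow>
     (\<exists>xs zs. ls' = xs @ ls @ zs \<and> u = word_end Q (u', xs))"

definition maximal_string ::
    "('v, 'e) pre_digraph \<Rightarrow> ('v \<times> 'e list \<Rightarrow> 'k::field) set \<Rightarrow> ('v, 'e) word \<Rightarrow> bool" where
  "maximal_string Q I w \<longleftrightarrow>
     is_string Q I w \<and> (\<forall>w'. is_string Q I w' \<and> factor_word Q w w' \<longrightarrow> w' = w)"

text \<open>A string up to inversion is the set of its (at most two) orientations.\<close>

definition undirected :: "('v, 'e) pre_digraph \<Rightarrow> ('v, 'e) word \<Rightarrow> ('v, 'e) word set" where
  "undirected Q w = {w, word_inverse Q w}"

text \<open>
  From here on \<open>B\<close> is a quiver with ideal \<open>J\<close> in which strings are considered; it is meant to be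
  a blossoming quiver.
\<close>

definition walks ::
    "('v, 'e) pre_digraph \<Rightarrow> ('v \<times> 'e list \<Rightarrow> 'k::field) set \<Rightarrow> ('v, 'e) word set set" where
  "walks B J = undirected B ` {w. maximal_string B J w}"

definition top_strings :: "('v, 'e) pre_digraph \<Rightarrow> ('v, 'e) word set \<Rightarrow> ('v, 'e) word set set" where
  "top_strings B \<omega> =
     {undirected B (letter_target B (\<alpha>, False), ys) | u xs \<alpha> ys \<beta> zs.
        (u, xs @ [(\<alpha>, False)] @ ys @ [(\<beta>, True)] @ zs) \<in> \<omega>}"

definition bottom_strings :: "('v, 'e) pre_digraph \<Rightarrow> ('v, 'e) word set \<Rightarrow> ('v, 'e) word set set" where
  "bottom_strings B \<omega> =
     {undirected B (letter_target B (\<alpha>, True), ys) | u xs \<alpha> ys \<beta> zs.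
        (u, xs @ [(\<alpha>, True)] @ ys @ [(\<beta>, False)] @ zs) \<in> \<omega>}"

text \<open>Positions in a directed word of the peaks (deeps) at a given vertex.\<close>

fun peaks_at :: "('v, 'e) pre_digraph \<Rightarrow> ('v, 'e) word \<Rightarrow> 'v \<Rightarrow> nat set" where
  "peaks_at B (u, ls) v =
     {i. Suc i < length ls \<and> \<not> snd (ls ! i) \<and> snd (ls ! Suc i) \<and> letter_target B (ls ! i) = v}"

fun deeps_at :: "('v, 'e) pre_digraph \<Rightarrow> ('v, 'e) word \<Rightarrow> 'v \<Rightarrow> nat set" where
  "deeps_at B (u, ls) v =
     {i. Suc i < length ls \<and> snd (ls ! i) \<and> \<not> snd (ls ! Suc i) \<and> letter_target B (ls ! i) = v}"

definition straight :: "('v, 'e) pre_digraph \<Rightarrow> ('v, 'e) word set \<Rightarrow> bool" where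
  "straight B \<omega> \<longleftrightarrow> (\<forall>w\<in>\<omega>. \<forall>v. peaks_at B w v = {} \<and> deeps_at B w v = {})"

definition kisses :: "('v, 'e) pre_digraph \<Rightarrow> ('v, 'e) word set \<Rightarrow> ('v, 'e) word set \<Rightarrow> bool" where
  "kisses B \<omega> \<omega>' \<longleftrightarrow> top_strings B \<omega> \<inter> bottom_strings B \<omega>' \<noteq> {}"

definition kissing :: "('v, 'e) pre_digraph \<Rightarrow> ('v, 'e) word set \<Rightarrow> ('v, 'e) word set \<Rightarrow> bool" where
  "kissing B \<omega> \<omega>' \<longleftrightarrow> kisses B \<omega> \<omega>' \<or> kisses B \<omega>' \<omega>"

definition proper_walks ::
    "('v, 'e) pre_digraph \<Rightarrow> ('v \<times> 'e list \<Rightarrow> 'k::field) set \<Rightarrow> ('v, 'e) word set set" where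
  "proper_walks B J = {\<omega> \<in> walks B J. \<not> straight B \<omega> \<and> \<not> kisses B \<omega> \<omega>}"

section \<open>The non-kissing complex and the non-kissing fan\<close>

definition non_kissing_complex ::
    "('v, 'e) pre_digraph \<Rightarrow> ('v \<times> 'e list \<Rightarrow> 'k::field) set \<Rightarrow> ('v, 'e) word set set set" where
  "non_kissing_complex B J =
     {F. F \<subseteq> proper_walks B J \<and> (\<forall>\<omega>\<in>F. \<forall>\<omega>'\<in>F. \<not> kissing B \<omega> \<omega>')}"

definition non_kissing_finite ::
    "('v, 'e) pre_digraph \<Rightarrow>
     (('v + 'v blossom) \<times> ('e + 'v blossom) list \<Rightarrow> 'k::field) set \<Rightarrow> bool" where
  "non_kissing_finite Q J \<longleftrightarrow> finite (non_kissing_complex (blossoming_quiver Q) J)"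

definition word_g_vector ::
    "('v::finite, 'e) pre_digraph \<Rightarrow> ('v + 'v blossom, 'e + 'v blossom) word \<Rightarrow> real ^ 'v" where
  "word_g_vector Q w =
     (\<chi> v. real (card (peaks_at (blossoming_quiver Q) w (Inl v)))
         - real (card (deeps_at (blossoming_quiver Q) w (Inl v))))"

text \<open>Both orientations of a walk have the same \<open>g\<close>-vector.\<close>

definition g_vector ::
    "('v::finite, 'e) pre_digraph \<Rightarrow> ('v + 'v blossom, 'e + 'v blossom) word set \<Rightarrow> real ^ 'v" where
  "g_vector Q \<omega> = the_elem (word_g_vector Q ` \<omega>)"

text \<open>
  A simplicial fan with chosen ray representatives is given by the sets \<open>R\<close> of representatives
  of the rays of its cones; the cones themselves are \<open>convex_cone hull R\<close>.
\<close>

definition non_kissing_fan ::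
    "('v::finite, 'e) pre_digraph \<Rightarrow>
     (('v + 'v blossom) \<times> ('e + 'v blossom) list \<Rightarrow> 'k::field) set \<Rightarrow> (real ^ 'v) set set" where
  "non_kissing_fan Q J = (\<lambda>F. g_vector Q ` F) ` non_kissing_complex (blossoming_quiver Q) J"

section \<open>The unique exchange relation property\<close>

definition spans_maximal_cone :: "'a::real_vector set set \<Rightarrow> 'a set \<Rightarrow> bool" where
  "spans_maximal_cone \<F> R \<longleftrightarrow>
     R \<in> \<F> \<and> (\<forall>S\<in>\<F>. convex_cone hull R \<subseteq> convex_cone hull S \<longrightarrow> convex_cone hull S = convex_cone hull R)"

definition adjacent_cones :: "'a::euclidean_space set \<Rightarrow> 'a set \<Rightarrow> bool" where
  "adjacent_cones C D \<longleftrightarrow> C \<noteq> D \<and> (C \<inter> D) facet_of C \<and> (C \<inter> D) facet_of D"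

definition exchange_pair ::
    "'a::euclidean_space set set \<Rightarrow> 'a \<Rightarrow> 'a \<Rightarrow> 'a set \<Rightarrow> 'a set \<Rightarrow> bool" where
  "exchange_pair \<F> r r' R R' \<longleftrightarrow>
     spans_maximal_cone \<F> R \<and> spans_maximal_cone \<F> R' \<and>
     adjacent_cones (convex_cone hull R) (convex_cone hull R') \<and>
     r \<in> R \<and> r' \<in> R' \<and> R - {r} = R' - {r'}"

definition exchangeable :: "'a::euclidean_space set set \<Rightarrow> 'a \<Rightarrow> 'a \<Rightarrow> bool" where
  "exchangeable \<F> r r' \<longleftrightarrow> (\<exists>R R'. exchange_pair \<F> r r' R R')"

text \<open>Coefficient functions are extended by zero outside \<open>R \<union> R'\<close>.\<close>

definition exchange_dependence ::
    "'a::real_vector \<Rightarrow> 'a \<Rightarrow> 'a set \<Rightarrow> 'a set \<Rightarrow> ('a \<Rightarrow> real) \<Rightarrow> bool" where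
  "exchange_dependence r r' R R' \<alpha> \<longleftrightarrow>
     (\<forall>s. s \<notin> R \<union> R' \<longrightarrow> \<alpha> s = 0) \<and>
     (\<Sum>s\<in>R \<union> R'. \<alpha> s *\<^sub>R s) = 0 \<and>
     \<alpha> r > 0 \<and> \<alpha> r' > 0 \<and> \<alpha> r + \<alpha> r' = 2"

text \<open>
  A single \<open>\<alpha>\<close> has to be the unique linear dependence of every exchange pair for \<open>r\<close> and \<open>r'\<close>.
\<close>

definition unique_exchange_relation_property :: "'a::euclidean_space set set \<Rightarrow> bool" where
  "unique_exchange_relation_property \<F> \<longleftrightarrow>
     (\<forall>r r'. exchangeable \<F> r r' \<longrightarrow>
        (\<exists>\<alpha>. \<forall>R R'. exchange_pair \<F> r r' R R' \<longrightarrow>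
           (\<forall>\<beta>. exchange_dependence r r' R R' \<beta> \<longleftrightarrow> \<beta> = \<alpha>)))"

end

theory Submission imports Defs begin

text \<open>
  Let \<open>c u\<close> be the number of occurrences of a string \<open>u\<close> in a family of pairwise non-kissing walks
  with nonnegative multiplicities.  It is additive under extensions of \<open>u\<close> at either end, and
  \<open>u\<close> cannot occur both on top and at the bottom of walks of the family, so \<open>c\<close> is determined by
  its values on letters.  These are determined by the sum of the
  \<open>g\<close>-vectors, up to straight walks.  Hence the multiplicities can be recovered from the sum.

  For a maximal face, every integer vector is realised by a lamination, whose strands follow the
  walks of the face as soon as a large multiple of their sum has been added; so the
  \<open>g\<close>-vectors of the face generate the lattice.  For adjacent maximal faces \<open>G + \<omega>\<close> and
  \<open>G + \<omega>'\<close> it follows that \<open>g(\<omega>) + g(\<omega>')\<close> is an integer combination of \<open>g(G)\<close>.  Its coefficients are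
  nonnegative: a walk that is not kissed by a family does not become rarer when the family is
  replaced by a non-kissing one with the same sum.  So the exchange relation writes
  \<open>g(\<omega>) + g(\<omega>')\<close> as a point of the cone of a face, and such a representation depends only on the
  point.
\<close>

section \<open>Words in a gentle track\<close>

text \<open>The integer expansions of g(\<omega>') over the first face and of g(\<omega>) over the
  second have mutually inverse coefficients at the exchanged walks. By integrality these are 1 or
  -1, and 1 is impossible, since it would give one vector nonnegative representations over both
  faces that differ. This is why the lattice, and not only the space, has to be generated. For the
  other coefficients, the negative ones are moved to the side of \<omega> and \<omega>'. The family
  on that side may kiss itself, but it does not kiss a walk S of the common face, so an S moved
  there would have to occur on the other side too.

  The obstacle for laminations is a strand that spirals forever and so lies on no walk; maximality
  of the face has to exclude it.

  Words are directed. A family contains both orientations of each walk with equal weights, and no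
  word equals its inverse; hence the factors 2. Because blossoms give every vertex two incoming and
  two outgoing arrows, a letter either ends at a blossom or is followed by exactly one letter of
  each sign.\<close>

text \<open>
  The letters are the arrows of the blossoming quiver and their formal inverses \<open>iv\<close>, with \<open>sg\<close>
  true for arrows.  \<open>R l m\<close> means that \<open>l m\<close> is a string, and \<open>vt l\<close> is the target of \<open>l\<close>, which
  is meaningful only if \<open>l\<close> does not end at a blossom.
\<close>

locale gentle_track =
  fixes E :: "'l set" and iv :: "'l \<Rightarrow> 'l" and sg :: "'l \<Rightarrow> bool"
    and R :: "'l \<Rightarrow> 'l \<Rightarrow> bool" and vt :: "'l \<Rightarrow> 'v"
  assumes finite_letters: "finite E"
    and R_letters: "R l m \<Longrightarrow> l \<in> E \<and> m \<in> E"
    and iv_letters: "l \<in> E \<Longrightarrow> iv l \<in> E"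
    and iv_iv [simp]: "iv (iv l) = l"
    and sg_iv [simp]: "sg (iv l) \<longleftrightarrow> \<not> sg l"
    and R_iv: "R l m \<Longrightarrow> R (iv m) (iv l)"
    and R_no_return: "\<not> R l (iv l)"
    and R_unique: "R l m \<Longrightarrow> R l m' \<Longrightarrow> sg m = sg m' \<Longrightarrow> m = m'"
    and R_other: "R l m \<Longrightarrow> \<exists>m'. R l m' \<and> sg m' = (\<not> sg m)"
    and R_square: "R l m \<Longrightarrow> R l' m \<Longrightarrow> R l m' \<Longrightarrow> R l' m'"
    and vt_R: "R l m \<Longrightarrow> vt (iv m) = vt l"
    and vt_cases: "R l m \<Longrightarrow> R l' m' \<Longrightarrow> vt l = vt l' \<Longrightarrow> R l' m \<or> (\<exists>n. R l n \<and> l' = iv n)"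
    and vt_surj: "\<exists>l m. vt l = a \<and> R l m"
    and positive_bound: "\<exists>N. \<forall>W. successively R W \<longrightarrow> (\<forall>l\<in>set W. sg l) \<longrightarrow> length W < N"
begin

definition terminal :: "'l \<Rightarrow> bool" where "terminal l \<longleftrightarrow> \<not> (\<exists>m. R l m)"

definition chain :: "'l list \<Rightarrow> bool" where
  "chain W \<longleftrightarrow> W \<noteq> [] \<and> set W \<subseteq> E \<and> successively R W"

definition walk :: "'l list \<Rightarrow> bool" where
  "walk W \<longleftrightarrow> chain W \<and> terminal (last W) \<and> terminal (iv (hd W))"

definition inw :: "'l list \<Rightarrow> 'l list" where "inw W = rev (map iv W)"

text \<open>Meaningful only if \<open>l\<close> is not terminal; then \<open>R_other\<close> and
  \<open>R_unique\<close> provide exactly one successor of each sign.\<close>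

definition nxt :: "'l \<Rightarrow> bool \<Rightarrow> 'l" where "nxt l b = (THE m. R l m \<and> sg m = b)"

definition prv :: "'l \<Rightarrow> bool \<Rightarrow> 'l" where "prv l b = iv (nxt (iv l) (\<not> b))"

text \<open>
  For an empty common string the last conjunct selects the orientation in which the peak and the
  deep can be compared.
\<close>

definition kiss :: "'l list \<Rightarrow> 'l list \<Rightarrow> bool" where
  "kiss W W' \<longleftrightarrow> (\<exists>p p' n. p + n + 1 < length W \<and> p' + n + 1 < length W' \<and>
     (\<forall>k<n. W ! (p + 1 + k) = W' ! (p' + 1 + k)) \<and>
     \<not> sg (W ! p) \<and> sg (W ! (p + n + 1)) \<and> sg (W' ! p') \<and> \<not> sg (W' ! (p' + n + 1)) \<and>
     R (W ! p) (W' ! (p' + 1)))"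

section \<open>Neighbours of letters and inversion of words\<close>

lemma R_pred_unique: "R l m \<Longrightarrow> R l' m \<Longrightarrow> sg l = sg l' \<Longrightarrow> l = l'"
  by (metis R_iv R_unique iv_iv sg_iv)

lemma vt_pred: "R l m \<Longrightarrow> R l' m \<Longrightarrow> vt l = vt l'"
  by (metis vt_R)

lemma nxt: assumes "R l m" shows R_nxt: "R l (nxt l b)" and sg_nxt: "sg (nxt l b) = b"
proof -
  obtain m' where m': "R l m'" "sg m' = b" using R_other[OF assms] assms by (cases "sg m = b") auto
  then have "\<exists>!m. R l m \<and> sg m = b" using R_unique by blast
  from theI'[OF this] show "R l (nxt l b)" "sg (nxt l b) = b" by (auto simp: nxt_def)
qed

lemma nxt_eq: "R l m \<Longrightarrow> nxt l (sg m) = m"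
  using R_nxt[of l m "sg m"] sg_nxt[of l m "sg m"] R_unique by blast

lemma nxt_cases: "R l m \<Longrightarrow> m = nxt l True \<or> m = nxt l False"
  using nxt_eq by (metis (full_types))

lemma prv: assumes "R k l" shows R_prv: "R (prv l b) l" and sg_prv: "sg (prv l b) = b"
  using R_nxt[OF R_iv[OF assms], of "\<not> b"] sg_nxt[OF R_iv[OF assms], of "\<not> b"] R_iv
  by (force simp: prv_def)+

text \<open>By \<open>R_square\<close>, letters with one common successor have all successors in
  common.\<close>

lemma nxt_pred: "R l m \<Longrightarrow> R l' m \<Longrightarrow> nxt l b = nxt l' b"
  using R_nxt R_unique sg_nxt R_square by metis

lemma terminal_pred: "\<not> terminal (iv l) \<longleftrightarrow> (\<exists>k. R k l)"
  unfolding terminal_def by (metis R_iv iv_iv)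

lemma inw_inw [simp]: "inw (inw W) = W"
  by (simp add: inw_def rev_map comp_def)

lemma inw_Nil [simp]: "inw W = [] \<longleftrightarrow> W = []" "inw [] = []"
  by (auto simp: inw_def)

lemma length_inw [simp]: "length (inw W) = length W"
  by (simp add: inw_def)

lemma inw_append: "inw (U @ W) = inw W @ inw U"
  by (simp add: inw_def)

lemma inw_Cons: "inw (l # W) = inw W @ [iv l]"
  by (simp add: inw_def)

lemma hd_inw: "W \<noteq> [] \<Longrightarrow> hd (inw W) = iv (last W)"
  by (simp add: inw_def hd_rev last_map)

lemma last_inw: "W \<noteq> [] \<Longrightarrow> last (inw W) = iv (hd W)"
  by (simp add: inw_def last_rev hd_map)

lemma nth_inw: "i < length W \<Longrightarrow> inw W ! i = iv (W ! (length W - 1 - i))"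
  by (simp add: inw_def rev_nth)

lemma set_inw: "set (inw W) = iv ` set W"
  by (simp add: inw_def)

lemma successively_inw: "successively R (inw W) \<longleftrightarrow> successively R W"
proof -
  have 1: "successively R (inw W)" if "successively R W" for W
    using that by (induction W rule: induct_list012) (auto simp: inw_Cons inw_def successively_append_iff R_iv)
  show ?thesis using 1[of W] 1[of "inw W"] by auto
qed

lemma chain_inw [simp]: "chain (inw W) \<longleftrightarrow> chain W"
proof -
  have 1: "chain (inw W)" if "chain W" for W
    using that iv_letters by (auto simp: chain_def set_inw successively_inw)
  show ?thesis using 1[of W] 1[of "inw W"] by auto
qed

lemma walk_inw [simp]: "walk (inw W) \<longleftrightarrow> walk W"
  unfolding walk_def chain_inw by (auto simp: hd_inw last_inw chain_def)

lemma chain_single: "chain [l] \<longleftrightarrow> l \<in> E" by (simp add: chain_def)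

lemma chain_Cons: "W \<noteq> [] \<Longrightarrow> chain (l # W) \<longleftrightarrow> R l (hd W) \<and> chain W"
  using R_letters by (cases W) (auto simp: chain_def)

lemma chain_append: "U \<noteq> [] \<Longrightarrow> W \<noteq> [] \<Longrightarrow> chain (U @ W) \<longleftrightarrow> chain U \<and> chain W \<and> R (last U) (hd W)"
  by (auto simp: chain_def successively_append_iff)

lemma chain_snoc: "U \<noteq> [] \<Longrightarrow> chain (U @ [l]) \<longleftrightarrow> chain U \<and> R (last U) l"
  using R_letters by (auto simp: chain_append chain_single)

lemma chain_nth: "chain W \<Longrightarrow> Suc i < length W \<Longrightarrow> R (W ! i) (W ! Suc i)"
  by (simp add: chain_def successively_conv_nth)

lemma half: "k - k div 2 = k div 2 \<or> k - k div 2 = Suc (k div 2)" for k :: nat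
  by presburger

text \<open>Look at the middle: in odd length a letter would be its own inverse, contradicting the
  signs; in even length a letter would be followed by its inverse. Hence every undirected walk
  consists of exactly two words.\<close>

lemma not_palindrome: assumes "chain W" shows "inw W \<noteq> W"
proof
  assume eq: "inw W = W"
  let ?n = "length W"
  have n: "0 < ?n" using assms by (auto simp: chain_def)
  let ?i = "(?n - 1) div 2"
  have i: "?i < ?n" using n by (meson diff_less div_le_dividend le_less_trans zero_less_one)
  have e: "W ! ?i = iv (W ! (?n - 1 - ?i))" using nth_inw[OF i] unfolding eq .
  have "?n - 1 - ?i = ?i \<or> ?n - 1 - ?i = Suc ?i"
    using half[of "?n - 1"] .
  then have s: "?n - 1 - ?i = Suc ?i"
    using arg_cong[OF e, of sg] unfolding sg_iv by (metis (no_types))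
  with e have s2: "W ! ?i = iv (W ! Suc ?i)" by simp
  have "Suc ?i < ?n" using s n by linarith
  then have "R (W ! ?i) (W ! Suc ?i)" by (rule chain_nth[OF assms])
  with s2 R_no_return[of "W ! ?i"] show False by (metis iv_iv)
qed

text \<open>Inversion exchanges the two ends and flips all signs, so the word on top stays on top.
  The compatibility conjunct of \<open>kiss\<close> has to be moved to the other end of the common
  string; for an empty string this is \<open>R_square\<close>.\<close>

lemma kiss_inw: assumes "chain W" "chain W'" shows "kiss (inw W) (inw W') \<longleftrightarrow> kiss W W'"
proof -
  have 1: "kiss (inw W) (inw W')" if c: "chain W" "chain W'" and k: "kiss W W'" for W W'
  proof -
    from k obtain p p' n where h: "p + n + 1 < length W" "p' + n + 1 < length W'"
      "\<And>k. k < n \<Longrightarrow> W ! (p + 1 + k) = W' ! (p' + 1 + k)"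
      "\<not> sg (W ! p)" "sg (W ! (p + n + 1))" "sg (W' ! p')" "\<not> sg (W' ! (p' + n + 1))"
      "R (W ! p) (W' ! (p' + 1))" unfolding kiss_def by blast
    let ?q = "length W - 1 - (p + n + 1)" and ?q' = "length W' - 1 - (p' + n + 1)"
    have a: "inw W ! (?q + k) = iv (W ! (p + n + 1 - k))" if "k \<le> n + 1" for k
      using that h(1) by (subst nth_inw) (auto intro!: arg_cong[where f="\<lambda>i. iv (W ! i)"])
    have b: "inw W' ! (?q' + k) = iv (W' ! (p' + n + 1 - k))" if "k \<le> n + 1" for k
      using that h(2) by (subst nth_inw) (auto intro!: arg_cong[where f="\<lambda>i. iv (W' ! i)"])
    have mid: "inw W ! (?q + 1 + k) = inw W' ! (?q' + 1 + k)" if "k < n" for k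
    proof -
      have "W ! (p + 1 + (n - 1 - k)) = W' ! (p' + 1 + (n - 1 - k))" using that by (intro h(3)) auto
      moreover have "p + 1 + (n - 1 - k) = p + n + 1 - (k + 1)" "p' + 1 + (n - 1 - k) = p' + n + 1 - (k + 1)"
        using that by auto
      moreover have "?q + 1 + k = ?q + (k + 1)" "?q' + 1 + k = ?q' + (k + 1)" by simp_all
      ultimately show ?thesis using a[of "k+1"] b[of "k+1"] that by (metis add_le_mono1 less_imp_le)
    qed
    have RR: "R (inw W ! ?q) (inw W' ! (?q' + 1))"
    proof -
      have 0: "R (W' ! (p' + n)) (W ! (p + n + 1))"
      proof (cases n)
        case 0
        have r: "R (W ! p) (W ! (p + 1))" using chain_nth[OF c(1), of p] h(1) by simp
        have r': "R (W' ! p') (W' ! (p' + 1))" using chain_nth[OF c(2), of p'] h(2) by simp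
        show ?thesis using R_square[OF h(8) r' r] 0 by simp
      next
        case (Suc n')
        then have "W ! (p + n) = W' ! (p' + n)" using h(3)[of n'] by simp
        moreover have "R (W ! (p + n)) (W ! (p + n + 1))" using chain_nth[OF c(1), of "p+n"] h(1) by simp
        ultimately show ?thesis by simp
      qed
      show ?thesis using a[of 0] b[of 1] R_iv[OF 0] by simp
    qed
    have e: "inw W ! ?q = iv (W ! (p + n + 1))" "inw W ! (?q + n + 1) = iv (W ! p)"
      "inw W' ! ?q' = iv (W' ! (p' + n + 1))" "inw W' ! (?q' + n + 1) = iv (W' ! p')"
      using a[of 0] a[of "n+1"] b[of 0] b[of "n+1"] by (simp_all add: add.assoc)
    have l: "?q + n + 1 < length (inw W)" "?q' + n + 1 < length (inw W')"
      using h(1,2) by simp_all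
    show ?thesis unfolding kiss_def
      using l mid e h(4-7) RR by (intro exI[of _ ?q] exI[of _ ?q'] exI[of _ n] conjI allI impI) simp_all
  qed
  show ?thesis using 1[OF assms] 1[of "inw W" "inw W'"] assms by (metis chain_inw inw_inw)
qed

section \<open>Occurrences of strings in weighted families\<close>

definition occ :: "'l list \<Rightarrow> 'l list \<Rightarrow> nat" where
  "occ u W = card {(xs, zs). W = xs @ u @ zs}"

definition total :: "'l list set \<Rightarrow> ('l list \<Rightarrow> real) \<Rightarrow> 'l list \<Rightarrow> real" where
  "total X x u = (\<Sum>W\<in>X. x W * real (occ u W))"

definition additive :: "('l list \<Rightarrow> real) \<Rightarrow> bool" where
  "additive c \<longleftrightarrow> (\<forall>u. chain u \<longrightarrow> 0 \<le> c u) \<and>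
     (\<forall>u. chain u \<and> \<not> terminal (last u) \<longrightarrow>
        c u = c (u @ [nxt (last u) True]) + c (u @ [nxt (last u) False])) \<and>
     (\<forall>u. chain u \<and> \<not> terminal (iv (hd u)) \<longrightarrow>
        c u = c (prv (hd u) True # u) + c (prv (hd u) False # u))"

text \<open>For nonempty \<open>s\<close> the third chain condition follows from the first two. For
  empty \<open>s\<close> it says that the peak and the deep are oriented so that they can be
  compared, as in \<open>kiss\<close>.\<close>

definition nonkissing :: "('l list \<Rightarrow> real) \<Rightarrow> bool" where
  "nonkissing c \<longleftrightarrow> additive c \<and>
     (\<forall>x s y x' y'. chain (x # s @ [y]) \<and> chain (x' # s @ [y']) \<and> chain (x # s @ [y']) \<and>
        \<not> sg x \<and> sg y \<and> sg x' \<and> \<not> sg y' \<longrightarrow>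
        c (x # s @ [y]) = 0 \<or> c (x' # s @ [y']) = 0)"

definition peaks :: "'l list \<Rightarrow> 'v \<Rightarrow> nat set" where
  "peaks W a = {i. Suc i < length W \<and> \<not> sg (W ! i) \<and> sg (W ! Suc i) \<and> vt (W ! i) = a}"

definition deeps :: "'l list \<Rightarrow> 'v \<Rightarrow> nat set" where
  "deeps W a = {i. Suc i < length W \<and> sg (W ! i) \<and> \<not> sg (W ! Suc i) \<and> vt (W ! i) = a}"

definition gvec :: "'l list \<Rightarrow> 'v \<Rightarrow> int" where
  "gvec W a = int (card (peaks W a)) - int (card (deeps W a))"

definition mixed :: "'l list \<Rightarrow> bool" where
  "mixed W \<longleftrightarrow> (\<exists>l\<in>set W. sg l) \<and> (\<exists>l\<in>set W. \<not> sg l)"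

section \<open>Additivity of occurrence counts\<close>

lemma finite_factorizations: "finite {(xs, zs). W = xs @ u @ zs}"
proof (rule finite_subset)
  show "{(xs, zs). W = xs @ u @ zs} \<subseteq> (\<lambda>n. (take n W, drop (n + length u) W)) ` {..length W}"
  proof
    fix q assume "q \<in> {(xs, zs). W = xs @ u @ zs}"
    then obtain xs zs where "q = (xs, zs)" "W = xs @ u @ zs" by auto
    then show "q \<in> (\<lambda>n. (take n W, drop (n + length u) W)) ` {..length W}"
      by (intro image_eqI[of _ _ "length xs"]) auto
  qed
qed simp

lemma occ_inw: "occ (inw u) (inw W) = occ u W"
  unfolding occ_def
  by (rule bij_betw_same_card[of "\<lambda>(xs, zs). (inw zs, inw xs)"],
      rule bij_betwI[of _ _ _ "\<lambda>(xs, zs). (inw zs, inw xs)"])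
     (auto simp: inw_append dest: arg_cong[where f=inw])

lemma occ_index:
  "occ u W = card {i. i + length u \<le> length W \<and> (\<forall>k<length u. W ! (i + k) = u ! k)}"
proof -
  have 1: "W = take i W @ u @ drop (i + length u) W"
    if h: "i + length u \<le> length W" "\<forall>k<length u. W ! (i + k) = u ! k" for i
  proof (rule nth_equalityI)
    fix j assume j: "j < length W"
    have "W ! j = u ! (j - i)" if "i \<le> j" "j < i + length u"
      using h(2)[rule_format, of "j - i"] that by simp
    then show "W ! j = (take i W @ u @ drop (i + length u) W) ! j"
      using h(1) j by (auto simp: nth_append)
  qed (use h(1) in simp)
  show ?thesis unfolding occ_def
    by (rule bij_betw_same_card[of "\<lambda>(xs, zs). length xs"],
        rule bij_betwI[of _ _ _ "\<lambda>n. (take n W, drop (n + length u) W)"])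
       (use 1 in \<open>auto simp: nth_append\<close>)
qed

text \<open>A walk ends in a terminal letter, so an occurrence of \<open>u\<close> is never at its
  end and continues with exactly one of the two successors.\<close>

lemma occ_right:
  assumes W: "walk W" and u: "chain u" and t: "\<not> terminal (last u)"
  shows "occ u W = occ (u @ [nxt (last u) True]) W + occ (u @ [nxt (last u) False]) W"
proof -
  let ?P = "nxt (last u) True" and ?N = "nxt (last u) False"
  obtain m where m: "R (last u) m" using t by (auto simp: terminal_def)
  have ne: "?P \<noteq> ?N" using sg_nxt[OF m] by metis
  let ?S = "\<lambda>u. {(xs, zs). W = xs @ u @ zs}"
  let ?f = "\<lambda>y (xs, zs). (xs, y # zs)"
  have "?S u = ?f ?P ` ?S (u @ [?P]) \<union> ?f ?N ` ?S (u @ [?N])"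
  proof (intro equalityI subsetI)
    fix q assume "q \<in> ?S u"
    then obtain xs zs where q: "q = (xs, zs)" "W = xs @ u @ zs" by auto
    have une: "u \<noteq> []" using u by (auto simp: chain_def)
    have "zs \<noteq> []" using W t une q by (auto simp: walk_def)
    then obtain y zs' where zs: "zs = y # zs'" by (cases zs) auto
    have "R (last u) y" using W q zs une
      by (auto simp: walk_def chain_def successively_append_iff)
    with nxt_cases have "y = ?P \<or> y = ?N" by auto
    then show "q \<in> ?f ?P ` ?S (u @ [?P]) \<union> ?f ?N ` ?S (u @ [?N])"
    proof
      assume "y = ?P"
      then show ?thesis using q zs by (intro UnI1 image_eqI[of _ _ "(xs, zs')"]) auto
    next
      assume "y = ?N"
      then show ?thesis using q zs by (intro UnI2 image_eqI[of _ _ "(xs, zs')"]) auto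
    qed
  qed auto
  moreover have "card (?f y ` ?S (u @ [y])) = occ (u @ [y]) W" for y
    unfolding occ_def by (rule card_image) (auto simp: inj_on_def)
  moreover have "?f ?P ` ?S (u @ [?P]) \<inter> ?f ?N ` ?S (u @ [?N]) = {}" using ne by auto
  ultimately have "card (?S u) = occ (u @ [?P]) W + occ (u @ [?N]) W"
    by (simp only: card_Un_disjoint finite_imageI finite_factorizations)
  then show ?thesis by (simp only: occ_def)
qed

lemma occ_left:
  assumes W: "walk W" and u: "chain u" and t: "\<not> terminal (iv (hd u))"
  shows "occ u W = occ (prv (hd u) True # u) W + occ (prv (hd u) False # u) W"
proof -
  have une: "u \<noteq> []" using u by (auto simp: chain_def)
  have "occ (inw u @ [nxt (iv (hd u)) b]) (inw W) = occ (prv (hd u) (\<not> b) # u) W" for b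
    by (subst occ_inw[symmetric]) (simp add: inw_append inw_Cons prv_def)
  with occ_right[of "inw W" "inw u"] W u t une show ?thesis
    by (simp add: last_inw occ_inw)
qed

lemma additive_total:
  assumes "\<And>W. W \<in> X \<Longrightarrow> walk W" "\<And>W. W \<in> X \<Longrightarrow> 0 \<le> x W"
  shows "additive (total X x)"
  unfolding additive_def total_def using assms
  by (auto simp: sum_nonneg sum.distrib[symmetric] distrib_left[symmetric] occ_right occ_left
      intro!: sum.cong)

lemma additive_nonneg: "additive c \<Longrightarrow> chain u \<Longrightarrow> 0 \<le> c u"
  by (simp add: additive_def)

lemma additive_right:
  assumes "additive c" "chain u" "R (last u) y" "R (last u) y'" "sg y \<noteq> sg y'"
  shows "c u = c (u @ [y]) + c (u @ [y'])"
proof -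
  have "c u = c (u @ [nxt (last u) True]) + c (u @ [nxt (last u) False])"
    using assms by (auto simp: additive_def terminal_def)
  with nxt_eq[OF assms(3)] nxt_eq[OF assms(4)] assms(5) show ?thesis by (cases "sg y") auto
qed

lemma additive_left:
  assumes "additive c" "chain u" "R y (hd u)" "R y' (hd u)" "sg y \<noteq> sg y'"
  shows "c u = c (y # u) + c (y' # u)"
proof -
  have e: "c u = c (prv (hd u) True # u) + c (prv (hd u) False # u)"
    using assms terminal_pred by (auto simp: additive_def)
  have "prv (hd u) (sg y) = y" "prv (hd u) (sg y') = y'"
    using R_prv sg_prv R_pred_unique assms(3,4) by metis+
  with e assms(5) show ?thesis by (cases "sg y") auto
qed

lemma additive_antimono_right: "additive c \<Longrightarrow> chain (u @ [y]) \<Longrightarrow> u \<noteq> [] \<Longrightarrow> c (u @ [y]) \<le> c u"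
proof -
  assume a: "additive c" "chain (u @ [y])" "u \<noteq> []"
  then have r: "chain u" "R (last u) y" by (auto simp: chain_snoc)
  obtain y' where y': "R (last u) y'" "sg y' = (\<not> sg y)" using R_other[OF r(2)] by auto
  have "c u = c (u @ [y]) + c (u @ [y'])" using additive_right[OF a(1) r y'(1)] y'(2) by auto
  moreover have "0 \<le> c (u @ [y'])" using a r y' by (intro additive_nonneg) (auto simp: chain_snoc)
  ultimately show ?thesis by simp
qed

lemma additive_antimono_left: "additive c \<Longrightarrow> chain (y # u) \<Longrightarrow> u \<noteq> [] \<Longrightarrow> c (y # u) \<le> c u"
proof -
  assume a: "additive c" "chain (y # u)" "u \<noteq> []"
  then have r: "chain u" "R y (hd u)" by (auto simp: chain_Cons)
  let ?y' = "prv (hd u) (\<not> sg y)"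
  have y': "R ?y' (hd u)" "sg ?y' = (\<not> sg y)" using R_prv sg_prv r(2) by metis+
  have "c u = c (y # u) + c (?y' # u)" using additive_left[OF a(1) r y'(1)] y'(2) by auto
  moreover have "0 \<le> c (?y' # u)" using a r y' by (intro additive_nonneg) (auto simp: chain_Cons)
  ultimately show ?thesis by simp
qed

text \<open>The extensions of \<open>s\<close> by \<open>x\<close> or \<open>x2\<close> on the left
  and by \<open>y\<close> or \<open>y2\<close> on the right form a two by two table with known
  marginals. Two opposite corners have different signs at their ends: one has \<open>s\<close> on
  top, the other at the bottom, so one of these two entries is 0.\<close>

lemma nonkissing_square:
  assumes c: "nonkissing c" and ch: "chain (x # s @ [y])"
    and y2: "R (last (x # s)) y2" "sg y2 \<noteq> sg y"
  obtains x2 where "R x2 (hd (s @ [y]))" "sg x2 \<noteq> sg x" "chain (x2 # s @ [y])" "chain (x2 # s @ [y2])"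
    "chain (x # s @ [y2])"
    "c (x # s) = c (x # s @ [y]) + c (x # s @ [y2])"
    "c (s @ [y]) = c (x # s @ [y]) + c (x2 # s @ [y])"
    "sg x = sg y \<Longrightarrow> c (x # s @ [y2]) = 0 \<or> c (x2 # s @ [y]) = 0"
    "sg x \<noteq> sg y \<Longrightarrow> c (x # s @ [y]) = 0 \<or> c (x2 # s @ [y2]) = 0"
proof -
  have add: "additive c" using c by (simp add: nonkissing_def)
  have xs: "chain (x # s)" "R (last (x # s)) y" using ch chain_snoc[of "x # s" y] by auto
  have sy: "chain (s @ [y])" "R x (hd (s @ [y]))" using ch chain_Cons[of "s @ [y]" x] by auto
  let ?x2 = "prv (hd (s @ [y])) (\<not> sg x)"
  have x2: "R ?x2 (hd (s @ [y]))" "sg ?x2 = (\<not> sg x)" using R_prv sg_prv sy(2) by metis+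
  have a: "chain (?x2 # s @ [y])" using sy x2 by (simp add: chain_Cons)
  have b: "chain (x # s @ [y2])" using xs y2 chain_snoc[of "x # s" y2] by simp
  have c': "chain (?x2 # s @ [y2])"
  proof (cases "s = []")
    case True
    have "R ?x2 y2" using R_square[of x y ?x2 y2] xs(2) y2(1) x2(1) True by auto
    then show ?thesis using True b by (simp add: chain_def R_letters)
  next
    case False
    then show ?thesis using a b x2 by (simp add: chain_Cons)
  qed
  have "c (x # s) = c (x # s @ [y]) + c (x # s @ [y2])"
    using additive_right[OF add xs y2(1)] y2(2) by auto
  moreover have "c (s @ [y]) = c (x # s @ [y]) + c (?x2 # s @ [y])"
    using additive_left[OF add sy x2(1)] x2(2) by auto
  moreover have "c (x # s @ [y2]) = 0 \<or> c (?x2 # s @ [y]) = 0" if "sg x = sg y"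
    using c ch a b c' that x2(2) y2(2) unfolding nonkissing_def by (cases "sg x") (metis, metis)
  moreover have "c (x # s @ [y]) = 0 \<or> c (?x2 # s @ [y2]) = 0" if "sg x \<noteq> sg y"
    using c ch a b c' that x2(2) y2(2) unfolding nonkissing_def by (cases "sg x") (metis, metis)
  ultimately show ?thesis using that x2 a b c' by metis
qed

text \<open>The entry at \<open>x\<close>, \<open>y\<close> is completed to its row sum and to its
  column sum by the two opposite corners, one of which is 0.\<close>

lemma nonkissing_mixed:
  assumes c: "nonkissing c" and ch: "chain (x # s @ [y])" and s: "sg x = sg y"
  shows "c (x # s @ [y]) = min (c (x # s)) (c (s @ [y]))"
proof -
  have "R (last (x # s)) y" using ch chain_snoc[of "x # s" y] by auto
  from R_other[OF this] obtain y2 where y2: "R (last (x # s)) y2" "sg y2 \<noteq> sg y" by auto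
  have nn: "chain u \<Longrightarrow> 0 \<le> c u" for u using c by (simp add: nonkissing_def additive_nonneg)
  from nonkissing_square[OF c ch y2] s nn show ?thesis
    by (smt (verit, del_insts))
qed

text \<open>The other entry in the row of \<open>x\<close> has equal signs at its ends and is a
  minimum by \<open>nonkissing_mixed\<close>; subtract it from the row sum.\<close>

lemma nonkissing_unmixed:
  assumes c: "nonkissing c" and ch: "chain (x # s @ [y])" and s: "sg x \<noteq> sg y"
    and y2: "R (last (x # s)) y2" "sg y2 = sg x"
  shows "c (x # s @ [y]) = max 0 (c (x # s) - c (s @ [y2]))"
proof -
  have nn: "chain u \<Longrightarrow> 0 \<le> c u" for u using c by (simp add: nonkissing_def additive_nonneg)
  have xs: "R (last (x # s)) y" using ch chain_snoc[of "x # s" y] by auto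
  have xs': "chain (x # s)" using ch chain_snoc[of "x # s" y] by auto
  have "chain (x # s @ [y2])" using y2 xs' chain_snoc[of "x # s" y2] by simp
  then have "c (x # s @ [y2]) = min (c (x # s)) (c (s @ [y2]))"
    using nonkissing_mixed[OF c] y2 by simp
  moreover have "c (x # s) = c (x # s @ [y]) + c (x # s @ [y2])"
    using additive_right[OF _ xs' xs y2(1)] c s y2(2) by (simp add: nonkissing_def)
  ultimately show ?thesis using nn[OF ch] by auto
qed

text \<open>The two formulas express the value at a word through values at strictly shorter words,
  down to single letters.\<close>

lemma nonkissing_unique:
  assumes c: "nonkissing c" and d: "nonkissing d" and l: "\<And>l. l \<in> E \<Longrightarrow> c [l] = d [l]"
  shows "chain u \<Longrightarrow> c u = d u"
proof (induction "length u" arbitrary: u rule: less_induct)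
  case less
  have ne: "u \<noteq> []" using less.prems by (simp add: chain_def)
  then obtain x v where u: "u = x # v" by (cases u) auto
  show ?case
  proof (cases v rule: rev_cases)
    case Nil
    then show ?thesis using less.prems u l by (simp add: chain_def)
  next
    case (snoc s y)
    then have u: "u = x # s @ [y]" using u by simp
    have ch: "chain (x # s @ [y])" using less.prems u by simp
    have xs: "chain (x # s)" "R (last (x # s)) y" using ch chain_snoc[of "x # s" y] by auto
    have sy: "chain (s @ [y])" using ch chain_Cons[of "s @ [y]" x] by auto
    have e: "c (x # s) = d (x # s)" using xs by (intro less.hyps) (simp_all add: u)
    show ?thesis
    proof (cases "sg x = sg y")
      case True
      have "c (s @ [y]) = d (s @ [y])" using sy by (intro less.hyps) (simp_all add: u)
      then show ?thesis using nonkissing_mixed[OF c ch True] nonkissing_mixed[OF d ch True] e u by simp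
    next
      case False
      obtain y2 where y2: "R (last (x # s)) y2" "sg y2 = sg x"
        using R_other[OF xs(2)] False by blast
      have "chain (x # s @ [y2])" using y2 xs chain_snoc[of "x # s" y2] by simp
      then have "chain (s @ [y2])" using chain_Cons[of "s @ [y2]" x] by simp
      then have "c (s @ [y2]) = d (s @ [y2])" by (intro less.hyps) (simp_all add: u)
      then show ?thesis using nonkissing_unmixed[OF c ch False y2] nonkissing_unmixed[OF d ch False y2] e u by simp
    qed
  qed
qed

lemma walk_chain: "walk W \<Longrightarrow> chain W" by (simp add: walk_def)

text \<open>Both ends of a walk are terminal, so it is not a proper factor of any chain. Thus
  \<open>total\<close> evaluated at a walk returns its weight.\<close>

lemma occ_walk:
  assumes "walk W" "walk W'" shows "occ W W' = (if W = W' then 1 else 0)"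
proof -
  have ne: "W \<noteq> []" using assms by (auto simp: walk_def chain_def)
  have "xs = [] \<and> zs = []" if e: "W' = xs @ W @ zs" for xs zs
  proof (rule ccontr)
    have s: "successively R (xs @ W @ zs)" using assms e by (auto simp: walk_def chain_def)
    assume "\<not> (xs = [] \<and> zs = [])"
    then consider "xs \<noteq> []" | "zs \<noteq> []" by auto
    then show False
    proof cases
      case 1
      then have "R (last xs) (hd W)" using s ne by (auto simp: successively_append_iff)
      then show False using assms terminal_pred by (auto simp: walk_def)
    next
      case 2
      then have "R (last W) (hd zs)" using s ne by (auto simp: successively_append_iff)
      then show False using assms by (auto simp: walk_def terminal_def)
    qed
  qed
  then have "{(xs, zs). W' = xs @ W @ zs} = (if W = W' then {([], [])} else {})"
    by (cases "W = W'") force+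
  then show ?thesis by (simp add: occ_def)
qed

lemma total_walk:
  assumes "finite X" "\<And>W. W \<in> X \<Longrightarrow> walk W" "walk W"
  shows "total X x W = (if W \<in> X then x W else 0)"
proof -
  have "total X x W = (\<Sum>W'\<in>X. if W' = W then x W' else 0)"
    unfolding total_def using assms by (intro sum.cong) (auto simp: occ_walk)
  then show ?thesis using assms by simp
qed

lemma total_inw:
  assumes "\<And>W. W \<in> X \<Longrightarrow> inw W \<in> X" "\<And>W. x (inw W) = x W"
  shows "total X x (inw u) = total X x u"
proof -
  have "total X x (inw u) = (\<Sum>W\<in>X. x (inw W) * real (occ u (inw W)))"
    unfolding total_def assms(2) by (intro sum.cong) (metis occ_inw inw_inw)+
  also have "\<dots> = total X x u"
    unfolding total_def using assms(1)
    by (intro sum.reindex_bij_witness[of _ inw inw]) auto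
  finally show ?thesis .
qed

section \<open>Peaks and deeps as two-letter words\<close>

lemma card_peaks_inw:
  assumes "chain W" shows "card (peaks (inw W) a) = card (peaks W a)"
    and "card (deeps (inw W) a) = card (deeps W a)"
proof -
  have v: "vt (iv (W ! Suc i)) = vt (W ! i)" if "Suc i < length W" for i
    using chain_nth[OF assms that] by (rule vt_R)
  let ?f = "\<lambda>i. length W - Suc (Suc i)"
  have f: "inw W ! ?f i = iv (W ! Suc i)" "inw W ! Suc (?f i) = iv (W ! i)" "Suc (?f i) < length W"
    "?f (?f i) = i" "vt (inw W ! ?f i) = vt (W ! i)" if "Suc i < length W" for i
  proof -
    have e: "length W - 1 - ?f i = Suc i" "length W - 1 - Suc (?f i) = i" using that by auto
    show l: "Suc (?f i) < length W" "?f (?f i) = i" using that by auto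
    show i: "inw W ! ?f i = iv (W ! Suc i)" "inw W ! Suc (?f i) = iv (W ! i)"
      using nth_inw[of "?f i" W] nth_inw[of "Suc (?f i)" W] l(1) unfolding e by simp_all
    show "vt (inw W ! ?f i) = vt (W ! i)" unfolding i using v that by simp
  qed
  have g: "?f (?f i) = i" "Suc (?f i) < length W" "W ! ?f i = iv (inw W ! Suc i)" "W ! Suc (?f i) = iv (inw W ! i)"
    "vt (iv (inw W ! Suc i)) = vt (inw W ! i)" if i: "Suc i < length W" for i
    using f[OF f(3)[OF i]] f(3,4)[OF i] iv_iv by metis+
  show "card (peaks (inw W) a) = card (peaks W a)"
    unfolding peaks_def
    by (rule bij_betw_same_card[of ?f], rule bij_betwI[of _ _ _ ?f])
       (use f g in \<open>auto simp: v\<close>)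
  show "card (deeps (inw W) a) = card (deeps W a)"
    unfolding deeps_def
    by (rule bij_betw_same_card[of ?f], rule bij_betwI[of _ _ _ ?f])
       (use f g in \<open>auto simp: v\<close>)
qed

lemma gvec_inw: "chain W \<Longrightarrow> gvec (inw W) a = gvec W a"
  by (simp add: gvec_def card_peaks_inw)

lemma occ_pair: "occ [l, m] W = card {i. Suc i < length W \<and> W ! i = l \<and> W ! Suc i = m}"
  unfolding occ_index by (rule arg_cong[where f=card]) (auto simp: less_Suc_eq nth_Cons')

lemma occ_pair_inw: "occ [l, m] (inw W) = occ [iv m, iv l] W"
  using occ_inw[of "[iv m, iv l]" W] by (simp add: inw_def)

text \<open>Up to inversion a vertex admits one kind of peak and one kind of deep. A letter arriving
  there either shares its successors with \<open>l\<close> or is the inverse of a successor of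
  \<open>l\<close>; in both cases the sign change leaves a single continuation.\<close>

lemma turn_cases:
  assumes "R l m" "sg l" "R k n" "vt k = vt l" "sg k \<noteq> sg n"
  shows "(sg k \<and> (k = l \<and> n = nxt l False \<or> k = iv (nxt l False) \<and> n = iv l)) \<or>
         (\<not> sg k \<and> (k = prv m False \<and> n = nxt l True \<or> k = iv (nxt l True) \<and> n = iv (prv m False)))"
proof -
  let ?q = "prv m False"
  have q: "R ?q m" "\<not> sg ?q" using R_prv[OF assms(1)] sg_prv[OF assms(1)] by auto
  have nq: "nxt ?q b = nxt l b" for b using nxt_pred[OF q(1) assms(1)] .
  have one: "k' = l \<and> n' = nxt l False \<or> k' = ?q \<and> n' = nxt l True"
    if k': "R k' m" "R k' n'" "sg k' \<noteq> sg n'" for k' n'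
  proof (cases "sg k'")
    case True
    then have "k' = l" using R_pred_unique[OF k'(1) assms(1)] assms(2) by simp
    moreover have "n' = nxt k' False" using nxt_eq[OF k'(2)] True k'(3) by simp
    ultimately show ?thesis by simp
  next
    case False
    then have "k' = ?q" using R_pred_unique[OF k'(1) q(1)] q(2) by simp
    moreover have "n' = nxt k' True" using nxt_eq[OF k'(2)] False k'(3) by simp
    ultimately show ?thesis using nq by simp
  qed
  from vt_cases[OF assms(1,3)] assms(4) consider "R k m" | n' where "R l n'" "k = iv n'" by auto
  then show ?thesis
  proof cases
    case 1
    then show ?thesis using one[OF 1 assms(3,5)] assms(2) q(2) by auto
  next
    case 2
    have r: "R (iv n) n'" using R_iv[OF assms(3)] 2 by simp
    have "R (iv n) m" using R_square[OF 2(1) r assms(1)] .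
    from one[OF this r] have "iv n = l \<and> n' = nxt l False \<or> iv n = ?q \<and> n' = nxt l True"
      using assms(5) 2(2) by simp
    then show ?thesis
    proof (elim disjE conjE)
      assume "iv n = l" "n' = nxt l False"
      then have "n = iv l" "k = iv (nxt l False)" "sg k"
        using 2(2) iv_iv sg_iv assms(2,5) by metis+
      then show ?thesis by blast
    next
      assume "iv n = ?q" "n' = nxt l True"
      then have "n = iv ?q" "k = iv (nxt l True)" "\<not> sg k"
        using 2(2) iv_iv sg_iv q(2) assms(5) by metis+
      then show ?thesis by blast
    qed
  qed
qed

text \<open>The turns listed in \<open>turn_cases\<close> in inverse orientation are counted as
  occurrences in \<open>inw W\<close>. A two-letter turn differs from its inverse by
  \<open>R_no_return\<close>, so nothing is counted twice.\<close>

lemma gvec_occ: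
  assumes W: "chain W" and l: "R l m" "sg l"
  shows "gvec W (vt l) = int (occ [prv m False, nxt l True] W) + int (occ [prv m False, nxt l True] (inw W))
                     - int (occ [l, nxt l False] W) - int (occ [l, nxt l False] (inw W))"
proof -
  let ?q = "prv m False" and ?P = "nxt l True" and ?N = "nxt l False"
  let ?S = "\<lambda>l m. {i. Suc i < length W \<and> W ! i = l \<and> W ! Suc i = m}"
  have q: "R ?q m" "\<not> sg ?q" using R_prv[OF l(1)] sg_prv[OF l(1)] by auto
  have nq: "nxt ?q b = nxt l b" for b using nxt_pred[OF q(1) l(1)] .
  have P: "R l ?P" "sg ?P" "R l ?N" "\<not> sg ?N" using R_nxt[OF l(1)] sg_nxt[OF l(1)] by auto
  have qP: "R ?q ?P" using R_nxt[OF q(1), of True] nq by simp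
  have v: "vt ?q = vt l" "vt (iv ?P) = vt l" "vt (iv ?N) = vt l"
    using vt_pred[OF q(1) l(1)] vt_R P by auto
  have r: "R (W ! i) (W ! Suc i)" if "Suc i < length W" for i using chain_nth[OF W that] .
  have fin: "finite (?S k n)" for k n by (rule finite_subset[of _ "{..<length W}"]) auto
  have "peaks W (vt l) = ?S ?q ?P \<union> ?S (iv ?P) (iv ?q)"
  proof (intro equalityI subsetI)
    fix i assume i: "i \<in> peaks W (vt l)"
    then have h: "Suc i < length W" "\<not> sg (W ! i)" "sg (W ! Suc i)" "vt (W ! i) = vt l"
      unfolding peaks_def by blast+
    have "sg (W ! i) \<noteq> sg (W ! Suc i)" using h(2,3) by blast
    from turn_cases[OF l r[OF h(1)] h(4) this] h(2)
    have "W ! i = ?q \<and> W ! Suc i = ?P \<or> W ! i = iv ?P \<and> W ! Suc i = iv ?q" by blast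
    with h(1) show "i \<in> ?S ?q ?P \<union> ?S (iv ?P) (iv ?q)" by blast
  next
    fix i assume "i \<in> ?S ?q ?P \<union> ?S (iv ?P) (iv ?q)"
    then have i: "Suc i < length W" "W ! i = ?q \<and> W ! Suc i = ?P \<or> W ! i = iv ?P \<and> W ! Suc i = iv ?q"
      by blast+
    from i(2) have "\<not> sg (W ! i) \<and> sg (W ! Suc i) \<and> vt (W ! i) = vt l"
      using P(2) q(2) v sg_iv by metis
    with i(1) show "i \<in> peaks W (vt l)" unfolding peaks_def by blast
  qed
  moreover have "?S ?q ?P \<inter> ?S (iv ?P) (iv ?q) = {}"
  proof -
    have "?q \<noteq> iv ?P" using qP R_no_return[of "iv ?P"] iv_iv by metis
    then show ?thesis by auto
  qed
  moreover have "deeps W (vt l) = ?S l ?N \<union> ?S (iv ?N) (iv l)"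
  proof (intro equalityI subsetI)
    fix i assume i: "i \<in> deeps W (vt l)"
    then have h: "Suc i < length W" "sg (W ! i)" "\<not> sg (W ! Suc i)" "vt (W ! i) = vt l"
      unfolding deeps_def by blast+
    have "sg (W ! i) \<noteq> sg (W ! Suc i)" using h(2,3) by blast
    from turn_cases[OF l r[OF h(1)] h(4) this] h(2)
    have "W ! i = l \<and> W ! Suc i = ?N \<or> W ! i = iv ?N \<and> W ! Suc i = iv l" by blast
    with h(1) show "i \<in> ?S l ?N \<union> ?S (iv ?N) (iv l)" by blast
  next
    fix i assume "i \<in> ?S l ?N \<union> ?S (iv ?N) (iv l)"
    then have i: "Suc i < length W" "W ! i = l \<and> W ! Suc i = ?N \<or> W ! i = iv ?N \<and> W ! Suc i = iv l"
      by blast+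
    from i(2) have "sg (W ! i) \<and> \<not> sg (W ! Suc i) \<and> vt (W ! i) = vt l"
      using P(4) l(2) v sg_iv by metis
    with i(1) show "i \<in> deeps W (vt l)" unfolding deeps_def by blast
  qed
  moreover have "?S l ?N \<inter> ?S (iv ?N) (iv l) = {}"
  proof -
    have "l \<noteq> iv ?N" using P(3) R_no_return[of "iv ?N"] iv_iv by metis
    then show ?thesis by auto
  qed
  ultimately show ?thesis
    unfolding gvec_def occ_pair_inw by (simp add: occ_pair card_Un_disjoint[OF fin fin])
qed

text \<open>Strands on the next positive letter that do not come from \<open>l\<close> come from a
  peak, and strands leaving \<open>l\<close> otherwise enter a deep. The factor 2 appears because
  these turns are counted in one orientation only, whereas \<open>gvec\<close> counts both.\<close>

lemma total_letter_diff:
  assumes X: "finite X" "\<And>W. W \<in> X \<Longrightarrow> walk W" "\<And>W. W \<in> X \<Longrightarrow> 0 \<le> x W"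
    and sym: "\<And>W. W \<in> X \<Longrightarrow> inw W \<in> X" "\<And>W. x (inw W) = x W"
    and l: "R l m" "sg l"
  shows "2 * (total X x [nxt l True] - total X x [l]) = (\<Sum>W\<in>X. x W * real_of_int (gvec W (vt l)))"
proof -
  let ?q = "prv m False" and ?P = "nxt l True" and ?N = "nxt l False"
  have q: "R ?q m" "\<not> sg ?q" using R_prv[OF l(1)] sg_prv[OF l(1)] by auto
  have P: "R l ?P" "sg ?P" "R l ?N" "\<not> sg ?N" using R_nxt[OF l(1)] sg_nxt[OF l(1)] by auto
  have qP: "R ?q ?P" using R_nxt[OF q(1), of True] nxt_pred[OF q(1) l(1)] by simp
  have add: "additive (total X x)" using X by (intro additive_total) auto
  have E: "l \<in> E" "?P \<in> E" using R_letters P by auto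
  have inw: "total X x u = (\<Sum>W\<in>X. x W * real (occ u (inw W)))" for u
  proof -
    have "total X x u = (\<Sum>W\<in>X. x (inw W) * real (occ u (inw W)))"
      unfolding total_def using sym(1) by (intro sum.reindex_bij_witness[of _ inw inw]) auto
    then show ?thesis by (simp add: sym(2))
  qed
  have "total X x [?P] = total X x [l, ?P] + total X x [?q, ?P]"
    using additive_left[OF add, of "[?P]" l ?q] E P qP q l by (simp add: chain_single)
  moreover have "total X x [l] = total X x [l, ?P] + total X x [l, ?N]"
    using additive_right[OF add, of "[l]" ?P ?N] E P by (simp add: chain_single)
  ultimately have "2 * (total X x [?P] - total X x [l]) =
      total X x [?q, ?P] + total X x [?q, ?P] - total X x [l, ?N] - total X x [l, ?N]" by simp
  also have "\<dots> = (\<Sum>W\<in>X. x W * real (occ [?q, ?P] W)) + (\<Sum>W\<in>X. x W * real (occ [?q, ?P] (inw W)))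
      - (\<Sum>W\<in>X. x W * real (occ [l, ?N] W)) - (\<Sum>W\<in>X. x W * real (occ [l, ?N] (inw W)))"
    by (simp only: inw[symmetric]) (simp only: total_def)
  also have "\<dots> = (\<Sum>W\<in>X. x W * real_of_int (gvec W (vt l)))"
    unfolding sum.distrib[symmetric] sum_subtractf[symmetric]
  proof (intro sum.cong refl)
    fix W assume "W \<in> X"
    then have e: "real_of_int (gvec W (vt l)) = real (occ [?q, ?P] W) + real (occ [?q, ?P] (inw W))
        - real (occ [l, ?N] W) - real (occ [l, ?N] (inw W))"
      using gvec_occ[OF _ l, of W] X(2) walk_chain by simp
    then show "x W * real (occ [?q, ?P] W) + x W * real (occ [?q, ?P] (inw W)) - x W * real (occ [l, ?N] W)
        - x W * real (occ [l, ?N] (inw W)) = x W * real_of_int (gvec W (vt l))"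
      unfolding e by (simp add: algebra_simps)
  qed
  finally show ?thesis .
qed

text \<open>The count contributed by straight walks, \<open>d l\<close> of them through the letter
  \<open>l\<close>: they contain no mixed word, and \<open>d\<close> will be constant along them, so
  the first letter of \<open>u\<close> suffices.\<close>

definition pad :: "('l \<Rightarrow> real) \<Rightarrow> 'l list \<Rightarrow> real" where
  "pad d u = (if mixed u then 0 else d (hd u))"

lemma mixed_append: "mixed u \<Longrightarrow> mixed (v @ u @ w)" by (auto simp: mixed_def)

lemma unmixed_last: "\<not> mixed u \<Longrightarrow> u \<noteq> [] \<Longrightarrow> mixed (u @ [y]) \<longleftrightarrow> sg y \<noteq> sg (last u)"
  by (auto simp: mixed_def)

lemma unmixed_hd: "\<not> mixed u \<Longrightarrow> u \<noteq> [] \<Longrightarrow> mixed (y # u) \<longleftrightarrow> sg y \<noteq> sg (hd u)"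
  by (auto simp: mixed_def)

text \<open>Straight walks have no top or bottom substrings: every word in the kissing condition has
  end letters of different signs, where \<open>pad\<close> vanishes.\<close>

lemma nonkissing_pad:
  assumes c: "nonkissing c" and d: "\<And>l. l \<in> E \<Longrightarrow> 0 \<le> d l" "\<And>l m. R l m \<Longrightarrow> sg l = sg m \<Longrightarrow> d m = d l"
  shows "nonkissing (\<lambda>u. c u + pad d u)"
proof -
  have ac: "additive c" using c by (simp add: nonkissing_def)
  have nn: "chain u \<Longrightarrow> 0 \<le> pad d u" for u
    using d(1) by (cases u) (auto simp: pad_def chain_def)
  have r: "pad d u = pad d (u @ [nxt (last u) True]) + pad d (u @ [nxt (last u) False])"
    if h: "chain u" "\<not> terminal (last u)" for u
  proof (cases "mixed u")
    case True
    then have "mixed (u @ [y])" for y using mixed_append[OF True, of "[]" "[y]"] by simp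
    then show ?thesis using True by (simp add: pad_def)
  next
    case False
    obtain m where "R (last u) m" using h by (auto simp: terminal_def)
    then have s: "sg (nxt (last u) b) = b" for b using sg_nxt by blast
    have "u \<noteq> []" using h by (auto simp: chain_def)
    then show ?thesis using False s by (auto simp: pad_def unmixed_last)
  qed
  have l: "pad d u = pad d (prv (hd u) True # u) + pad d (prv (hd u) False # u)"
    if h: "chain u" "\<not> terminal (iv (hd u))" for u
  proof (cases "mixed u")
    case True
    then have "mixed (y # u)" for y using mixed_append[OF True, of "[y]" "[]"] by simp
    then show ?thesis using True by (simp add: pad_def)
  next
    case False
    obtain k where "R k (hd u)" using h terminal_pred by auto
    then have s: "sg (prv (hd u) b) = b" "R (prv (hd u) b) (hd u)" for b using sg_prv R_prv by blast+
    have "u \<noteq> []" using h by (auto simp: chain_def)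
    then show ?thesis using False s d(2)[OF s(2)] by (auto simp: pad_def unmixed_hd)
  qed
  have "additive (\<lambda>u. c u + pad d u)"
    using ac nn r l unfolding additive_def by (auto simp: add_increasing algebra_simps)
  moreover have "pad d (x # s @ [y]) = 0" if "sg x \<noteq> sg y" for x s y
    using that by (auto simp: pad_def mixed_def)
  ultimately show ?thesis using c unfolding nonkissing_def by simp
qed

lemma nonkissing_total:
  assumes X: "finite X" "\<And>W. W \<in> X \<Longrightarrow> walk W" "\<And>W. W \<in> X \<Longrightarrow> 0 \<le> x W"
    and nk: "\<And>W W'. W \<in> X \<Longrightarrow> W' \<in> X \<Longrightarrow> \<not> kiss W W'"
  shows "nonkissing (total X x)"
proof -
  have pos: "\<exists>W\<in>X. \<exists>i. i + length u \<le> length W \<and> (\<forall>k<length u. W ! (i + k) = u ! k)"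
    if "total X x u \<noteq> 0" for u
  proof -
    from that obtain W where W: "W \<in> X" "x W * real (occ u W) \<noteq> 0"
      unfolding total_def by (meson sum.neutral)
    then have "occ u W \<noteq> 0" by auto
    then have "{i. i + length u \<le> length W \<and> (\<forall>k<length u. W ! (i + k) = u ! k)} \<noteq> {}"
      unfolding occ_index by (metis card.empty)
    with W(1) show ?thesis by blast
  qed
  have "total X x (x0 # s @ [y]) = 0 \<or> total X x (x' # s @ [y']) = 0"
    if h: "chain (x0 # s @ [y])" "chain (x' # s @ [y'])" "chain (x0 # s @ [y'])"
      "\<not> sg x0" "sg y" "sg x'" "\<not> sg y'" for x0 s y x' y'
  proof (rule ccontr)
    assume "\<not> ?thesis"
    with pos obtain W i W' i' where
      W: "W \<in> X" "i + length (x0 # s @ [y]) \<le> length W" "\<forall>k<length (x0 # s @ [y]). W ! (i + k) = (x0 # s @ [y]) ! k" and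
      W': "W' \<in> X" "i' + length (x' # s @ [y']) \<le> length W'" "\<forall>k<length (x' # s @ [y']). W' ! (i' + k) = (x' # s @ [y']) ! k"
      by metis
    let ?n = "length s"
    have a: "W ! i = x0" "W ! (i + ?n + 1) = y" "\<And>k. k < ?n \<Longrightarrow> W ! (i + 1 + k) = s ! k"
      using W(3)[rule_format, of 0] W(3)[rule_format, of "?n + 1"] W(3)[rule_format, of "1 + _"]
      by (auto simp: nth_append)
    have b: "W' ! i' = x'" "W' ! (i' + ?n + 1) = y'" "\<And>k. k < ?n \<Longrightarrow> W' ! (i' + 1 + k) = s ! k"
      using W'(3)[rule_format, of 0] W'(3)[rule_format, of "?n + 1"] W'(3)[rule_format, of "1 + _"]
      by (auto simp: nth_append)
    have hd: "W' ! (i' + 1) = hd (s @ [y'])"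
      using b(2) b(3)[of 0] by (cases s) auto
    have "R x0 (hd (s @ [y']))" using h(3) chain_Cons[of "s @ [y']" x0] by simp
    then have "kiss W W'" unfolding kiss_def
      using W(2) W'(2) a b h(4-7) hd by (intro exI[of _ i] exI[of _ i'] exI[of _ ?n]) auto
    with nk W(1) W'(1) show False by blast
  qed
  then show ?thesis unfolding nonkissing_def using additive_total[of X x] X by blast
qed

text \<open>The steps determine letter counts up to a difference that is constant along straight
  walks. Its negative part is added to \<open>c\<close> and its positive part to \<open>d\<close>,
  so that both paddings are nonnegative; \<open>sym\<close> carries the steps over to negative
  letters.\<close>

lemma nonkissing_unique_pad:
  assumes cd: "nonkissing c" "nonkissing d"
    and sym: "\<And>l. c [iv l] = c [l]" "\<And>l. d [iv l] = d [l]"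
    and step: "\<And>l m. R l m \<Longrightarrow> sg l \<Longrightarrow> sg m \<Longrightarrow> c [m] - c [l] = d [m] - d [l]"
  obtains p q where "nonkissing (\<lambda>u. c u + pad p u)" "nonkissing (\<lambda>u. d u + pad q u)"
    "\<And>l. l \<in> E \<Longrightarrow> c [l] + pad p [l] = d [l] + pad q [l]"
proof -
  have step': "c [m] - d [m] = c [l] - d [l]" if "R l m" "sg l = sg m" for l m
  proof (cases "sg l")
    case True
    then show ?thesis using step that by fastforce
  next
    case False
    then show ?thesis using step[OF R_iv[OF that(1)]] that sym by simp
  qed
  let ?p = "\<lambda>l. max 0 (d [l] - c [l])" and ?q = "\<lambda>l. max 0 (c [l] - d [l])"
  have "nonkissing (\<lambda>u. c u + pad ?p u)" "nonkissing (\<lambda>u. d u + pad ?q u)"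
    using step' by (intro nonkissing_pad cd; fastforce)+
  moreover have "c [l] + pad ?p [l] = d [l] + pad ?q [l]" for l
    by (auto simp: pad_def mixed_def)
  ultimately show ?thesis using that by blast
qed

text \<open>The padding needed to equalise the letter counts vanishes at mixed words, so the weights
  of non-straight walks are not affected by it.\<close>

lemma weights_unique:
  assumes X: "finite X" "\<And>W. W \<in> X \<Longrightarrow> walk W" "\<And>W. W \<in> X \<Longrightarrow> 0 \<le> x W"
      "\<And>W. W \<in> X \<Longrightarrow> inw W \<in> X" "\<And>W. x (inw W) = x W"
      "\<And>W W'. W \<in> X \<Longrightarrow> W' \<in> X \<Longrightarrow> \<not> kiss W W'"
    and Y: "finite Y" "\<And>W. W \<in> Y \<Longrightarrow> walk W" "\<And>W. W \<in> Y \<Longrightarrow> 0 \<le> y W"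
      "\<And>W. W \<in> Y \<Longrightarrow> inw W \<in> Y" "\<And>W. y (inw W) = y W"
      "\<And>W W'. W \<in> Y \<Longrightarrow> W' \<in> Y \<Longrightarrow> \<not> kiss W W'"
    and g: "\<And>a. (\<Sum>W\<in>X. x W * real_of_int (gvec W a)) = (\<Sum>W\<in>Y. y W * real_of_int (gvec W a))"
    and W: "walk W" "mixed W"
  shows "(if W \<in> X then x W else 0) = (if W \<in> Y then y W else 0)"
proof -
  have c: "nonkissing (total X x)" "nonkissing (total Y y)" using X Y by (auto intro: nonkissing_total)
  have sy: "total X x [iv l] = total X x [l]" "total Y y [iv l] = total Y y [l]" for l
    using total_inw[of X x "[l]"] total_inw[of Y y "[l]"] X Y by (auto simp: inw_def)
  have st: "total X x [m] - total X x [l] = total Y y [m] - total Y y [l]" if "R l m" "sg l" "sg m" for l m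
  proof -
    have "m = nxt l True" using nxt_eq[OF that(1)] that by simp
    then show ?thesis
      using total_letter_diff[where X=X and x=x, OF X(1-5) that(1,2)] total_letter_diff[where X=Y and x=y, OF Y(1-5) that(1,2)] g[of "vt l"] by simp
  qed
  obtain p q where pq: "nonkissing (\<lambda>u. total X x u + pad p u)" "nonkissing (\<lambda>u. total Y y u + pad q u)"
    "\<And>l. l \<in> E \<Longrightarrow> total X x [l] + pad p [l] = total Y y [l] + pad q [l]"
    using nonkissing_unique_pad[OF c sy st] by blast
  have "total X x W + pad p W = total Y y W + pad q W"
    using nonkissing_unique[OF pq] W(1) by (simp add: walk_chain)
  then show ?thesis using W X Y by (simp add: pad_def total_walk)
qed

end

section \<open>Strands along a word\<close>

text \<open>
  Below, \<open>C i j\<close> counts the strands of a family running along the letters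
  \<open>i, \<dots>, j\<close> of a fixed word, \<open>e i\<close> is the sign of the letter \<open>i\<close>, and \<open>shift C e b i\<close> is the change,
  between the letters \<open>i\<close> and \<open>i + 1\<close>, of the number of strands on side \<open>b\<close> of the word.  The
  assumption \<open>sep\<close> says that no strand changes sides.
\<close>

definition shift :: "(nat \<Rightarrow> nat \<Rightarrow> real) \<Rightarrow> (nat \<Rightarrow> bool) \<Rightarrow> bool \<Rightarrow> nat \<Rightarrow> real" where
  "shift C e b i = (if e i = b then C (Suc i) (Suc i) - C i (Suc i) else 0)
                 - (if e (Suc i) = b then C i i - C i (Suc i) else 0)"

definition side :: "(nat \<Rightarrow> nat \<Rightarrow> real) \<Rightarrow> (nat \<Rightarrow> bool) \<Rightarrow> bool \<Rightarrow> nat \<Rightarrow> real" where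
  "side C e b i = (\<Sum>t<i. shift C e b t)"

text \<open>The right side exceeds \<open>C p q\<close> by two groups of strands: \<open>?Z\<close>
  counts those at \<open>q\<close> that joined on side \<open>b\<close> after \<open>p\<close>, and
  \<open>?D\<close> those running from \<open>p\<close> that left on the other side before
  \<open>q\<close>. A strand that joined on side \<open>b\<close> and left again is cancelled inside
  the change of \<open>side\<close>, because by \<open>sep\<close> it left on side
  \<open>b\<close>.\<close>

lemma strands_le_side:
  fixes C :: "nat \<Rightarrow> nat \<Rightarrow> real" and e :: "nat \<Rightarrow> bool"
  assumes anti_l: "\<And>i j. Suc i \<le> j \<Longrightarrow> j < m \<Longrightarrow> C i j \<le> C (Suc i) j"
    and anti_r: "\<And>i j. i \<le> j \<Longrightarrow> Suc j < m \<Longrightarrow> C i (Suc j) \<le> C i j"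
    and sep: "\<And>i j. Suc i \<le> j \<Longrightarrow> Suc j < m \<Longrightarrow> e i \<noteq> e (Suc j) \<Longrightarrow>
        C (Suc i) j - C i j = C (Suc i) (Suc j) - C i (Suc j)"
    and pq: "p \<le> q" "q < m"
  shows "C p q \<le> C p p + (side C e b q - side C e b p)"
proof -
  let ?Z = "\<lambda>q. \<Sum>k\<in>{p..<q}. if e k = b then C (Suc k) q - C k q else 0"
  let ?D = "\<lambda>q. \<Sum>t\<in>{p..<q}. if e (Suc t) = b then 0 else C p t - C p (Suc t)"
  have "C p p + (side C e b q - side C e b p) = C p q + ?Z q + ?D q"
    using pq
  proof (induction q rule: dec_induct)
    case base
    show ?case by simp
  next
    case (step q)
    then have IH: "C p p + (side C e b q - side C e b p) = C p q + ?Z q + ?D q" by simp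
    have S: "side C e b (Suc q) = side C e b q + shift C e b q" by (simp add: side_def)
    have tele: "(\<Sum>k\<in>{p..<q}. C (Suc k) r - C k r) = C q r - C p r" for r
      using sum_Suc_diff'[of p q "\<lambda>k. C k r"] step(1) by simp
    have Zs: "?Z (Suc q) = (\<Sum>k\<in>{p..<q}. if e k = b then C (Suc k) (Suc q) - C k (Suc q) else 0)
        + (if e q = b then C (Suc q) (Suc q) - C q (Suc q) else 0)"
      using step(1) by simp
    have Ds: "?D (Suc q) = ?D q + (if e (Suc q) = b then 0 else C p q - C p (Suc q))"
      using step(1) by simp
    show ?case
    proof (cases "e (Suc q) = b")
      case True
      \<comment> \<open>For \<open>e k \<noteq> b\<close> the summand on the right is 0 by
        \<open>sep\<close>; adding these terms makes the sum telescope.\<close>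
      have "?Z q - (\<Sum>k\<in>{p..<q}. if e k = b then C (Suc k) (Suc q) - C k (Suc q) else 0)
          = (\<Sum>k\<in>{p..<q}. (C (Suc k) q - C k q) - (C (Suc k) (Suc q) - C k (Suc q)))"
        unfolding sum_subtractf[symmetric]
        using sep[of _ q] step.prems True by (intro sum.cong) auto
      also have "\<dots> = (C q q - C p q) - (C q (Suc q) - C p (Suc q))"
        unfolding sum_subtractf[of _ _ "{p..<q}"] using tele by (simp add: sum_subtractf)
      finally show ?thesis using IH S Zs Ds True by (simp add: shift_def)
    next
      case False
      have "(\<Sum>k\<in>{p..<q}. if e k = b then C (Suc k) (Suc q) - C k (Suc q) else 0) = ?Z q"
        using sep[of _ q] step.prems False by (intro sum.cong) auto
      then show ?thesis using IH S Zs Ds False by (simp add: shift_def)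
    qed
  qed
  moreover have "0 \<le> ?Z q" using anti_l pq by (intro sum_nonneg) auto
  moreover have "0 \<le> ?D q" using anti_r pq by (intro sum_nonneg) auto
  ultimately show ?thesis by linarith
qed

definition lowest :: "(nat \<Rightarrow> real) \<Rightarrow> nat \<Rightarrow> nat \<Rightarrow> real" where
  "lowest X i j = Min (X ` {i..j})"

lemma lowest_self [simp]: "lowest X i i = X i" by (simp add: lowest_def)

lemma lowest_left: "i < j \<Longrightarrow> lowest X i j = min (X i) (lowest X (Suc i) j)"
  unfolding lowest_def by (subst Icc_eq_insert_lb_nat) (auto simp: Icc_eq_insert_lb_nat)

lemma lowest_right: "i < j \<Longrightarrow> lowest X i j = min (lowest X i (j - 1)) (X j)"
proof -
  assume "i < j"
  then have "{i..j} = insert j {i..j - 1}" by auto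
  then show ?thesis unfolding lowest_def using \<open>i < j\<close> by (simp add: min.commute)
qed

lemma lowest_le: "i \<le> k \<Longrightarrow> k \<le> j \<Longrightarrow> lowest X i j \<le> X k"
  by (simp add: lowest_def)

lemma lowest_drop_left: "i < j \<Longrightarrow> X (Suc i) \<le> X i \<Longrightarrow> lowest X i j = lowest X (Suc i) j"
  using lowest_left[of i j X] lowest_le[of "Suc i" "Suc i" j X] by auto

lemma lowest_drop_right: "i < j \<Longrightarrow> X (j - 1) \<le> X j \<Longrightarrow> lowest X i j = lowest X i (j - 1)"
  using lowest_right[of i j X] lowest_le[of i "j - 1" "j - 1" X]
  by (metis Suc_pred' less_Suc_eq_le less_imp_Suc_add min.absorb1 order.trans order_refl zero_less_Suc diff_Suc_1)

lemma lowest_both: "i < j \<Longrightarrow> min (lowest X i (j - 1)) (lowest X (Suc i) j) = lowest X i j"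
proof -
  assume "i < j"
  then have "{i..j} = {i..j - 1} \<union> {Suc i..j}" by auto
  then show ?thesis unfolding lowest_def using \<open>i < j\<close> by (simp add: image_Un Min_Un)
qed

lemma lowest_attained: "i \<le> j \<Longrightarrow> \<exists>k. i \<le> k \<and> k \<le> j \<and> lowest X i j = X k"
proof -
  assume "i \<le> j"
  then have "Min (X ` {i..j}) \<in> X ` {i..j}" by (intro Min_in) auto
  then show ?thesis unfolding lowest_def by auto
qed

text \<open>The recursion for \<open>B\<close> has the closed form \<open>main\<close>: the initial
  number of strands plus the minima of the two side functions over the segment. The counts
  \<open>C\<close> are bounded by the same expression, by \<open>low\<close>.\<close>

lemma unkissed_strands:
  fixes B C :: "nat \<Rightarrow> nat \<Rightarrow> real" and e :: "nat \<Rightarrow> bool"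
  assumes anti_l: "\<And>i j. Suc i \<le> j \<Longrightarrow> j < m \<Longrightarrow> C i j \<le> C (Suc i) j"
    and anti_r: "\<And>i j. i \<le> j \<Longrightarrow> Suc j < m \<Longrightarrow> C i (Suc j) \<le> C i j"
    and nn: "\<And>i j. i \<le> j \<Longrightarrow> j < m \<Longrightarrow> 0 \<le> C i j"
    and sep: "\<And>i j. Suc i \<le> j \<Longrightarrow> Suc j < m \<Longrightarrow> e i \<noteq> e (Suc j) \<Longrightarrow>
        C (Suc i) j - C i j = C (Suc i) (Suc j) - C i (Suc j)"
    and B1: "\<And>i. i < m \<Longrightarrow> B i i = C i i"
    and B2: "\<And>i. Suc i < m \<Longrightarrow> e i \<noteq> e (Suc i) \<Longrightarrow> B i (Suc i) = C i (Suc i)"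
    and Bm: "\<And>i j. i < j \<Longrightarrow> j < m \<Longrightarrow> e i = e j \<Longrightarrow> B i j = min (B i (j - 1)) (B (Suc i) j)"
    and Bu: "\<And>i j. Suc i < j \<Longrightarrow> j < m \<Longrightarrow> e i \<noteq> e j \<Longrightarrow>
        B i j = max 0 (B i (j - 1) - (B (Suc i) (j - 1) - B (Suc i) j))"
    and m: "0 < m"
  shows "C 0 (m - 1) \<le> B 0 (m - 1)"
proof -
  let ?X = "side C e" and ?L = "\<lambda>b. lowest (side C e b)"
  have step: "?X b (Suc i) = ?X b i + shift C e b i" for b i by (simp add: side_def)
  \<comment> \<open>Every strand that joins or leaves does so on one of the two sides.\<close>
  have sum: "?X b i + ?X (\<not> b) i = C i i - C 0 0" for b i
    by (induction i) (auto simp: step shift_def side_def)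
  \<comment> \<open>After a letter with \<open>e i \<noteq> b\<close> no strand joins on side
    \<open>b\<close>, so this side can only shrink; dually for \<open>up\<close>. The minimum over a
    segment is therefore not attained solely at the end letter concerned.\<close>
  have down: "?X b (Suc i) \<le> ?X b i" if "e i \<noteq> b" "Suc i < m" for b i
    using that anti_r[of i i] by (simp add: step shift_def)
  have up: "?X b i \<le> ?X b (Suc i)" if "e (Suc i) \<noteq> b" "Suc i < m" for b i
    using that anti_l[of i "Suc i"] by (simp add: step shift_def)
  have anti: "C i j \<le> C p q" if "i \<le> p" "p \<le> q" "q \<le> j" "j < m" for i j p q
  proof -
    have "C p j \<le> C p q" using that(3,4,2)
      by (induction j rule: dec_induct) (auto intro: order_trans[OF anti_r])
    moreover have "C i j \<le> C p j" using that(1,4,2,3)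
      by (induction p rule: dec_induct) (auto intro: order_trans[OF _ anti_l])
    ultimately show ?thesis by simp
  qed
  \<comment> \<open>Take letters \<open>p\<close> and \<open>q\<close> where the two minima are
    attained and apply \<open>strands_le_side\<close> from the earlier to the later one, for the
    side whose minimum comes later.\<close>
  have low: "C i j \<le> C 0 0 + ?L b i j + ?L (\<not> b) i j" if ij: "i \<le> j" "j < m" for i j b
  proof -
    obtain p where p: "i \<le> p" "p \<le> j" "?L b i j = ?X b p" using lowest_attained[OF ij(1)] by blast
    obtain q where q: "i \<le> q" "q \<le> j" "?L (\<not> b) i j = ?X (\<not> b) q" using lowest_attained[OF ij(1)] by blast
    show ?thesis
    proof (cases "p \<le> q")
      case True
      then have "C p q \<le> C p p + (?X (\<not> b) q - ?X (\<not> b) p)"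
        using strands_le_side[where C=C and e=e and m=m and b="\<not> b", OF anti_l anti_r sep] q ij by simp
      then show ?thesis using anti[of i p q j] p q ij True sum[of b p] by simp
    next
      case False
      then have "C q p \<le> C q q + (?X b p - ?X b q)"
        using strands_le_side[where C=C and e=e and m=m and b=b, OF anti_l anti_r sep] p ij by simp
      then show ?thesis using anti[of i q p j] p q ij False sum[of b q] by simp
    qed
  qed
  have main: "B i j = C 0 0 + ?L (e i) i j + ?L (\<not> e i) i j" if "i \<le> j" "j < m" for i j
    using that
  proof (induction "j - i" arbitrary: i j rule: less_induct)
    case less
    have sw: "C 0 0 + ?L b i j + ?L (\<not> b) i j = C 0 0 + ?L b' i j + ?L (\<not> b') i j" for b b' i j
      by (cases b; cases b') auto
    show ?case
    proof (cases "i = j")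
      case True
      then show ?thesis using B1 less.prems sum[of "e i" i] by simp
    next
      case False
      then have ij: "i < j" using less.prems by simp
      have r: "B i (j - 1) = C 0 0 + ?L (e i) i (j - 1) + ?L (\<not> e i) i (j - 1)"
        using less.hyps[of "j - 1" i] ij less.prems by simp
      have l: "B (Suc i) j = C 0 0 + ?L (e i) (Suc i) j + ?L (\<not> e i) (Suc i) j"
        using less.hyps[of j "Suc i"] ij less.prems sw[of "e (Suc i)" "Suc i" j "e i"] by simp
      have dl: "?L (\<not> e i) i k = ?L (\<not> e i) (Suc i) k" if "i < k" "k < m" for k
        using that by (intro lowest_drop_left down) auto
      show ?thesis
      proof (cases "e i = e j")
        case True
        have "?L (\<not> e i) i j = ?L (\<not> e i) i (j - 1)"
          using ij less.prems True up[of "j - 1" "\<not> e i"] by (intro lowest_drop_right) auto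
        then show ?thesis
          using Bm[OF ij less.prems(2) True] r l dl[OF ij less.prems(2)] lowest_both[OF ij, of "?X (e i)"]
          by (auto simp: min_def split: if_splits)
      next
        case un: False
        have dr: "?L (e i) k j = ?L (e i) k (j - 1)" if "k < j" for k
          using that un less.prems up[of "j - 1" "e i"] by (intro lowest_drop_right) auto
        show ?thesis
        proof (cases "Suc i = j")
          case True
          have "?L (e i) i j = ?X (e i) i" using dr[OF ij] True by auto
          moreover have "?L (\<not> e i) i j = ?X (\<not> e i) j" using dl[OF ij less.prems(2)] True by simp
          moreover have "shift C e (\<not> e i) i = C i j - C i i" using un True by (auto simp: shift_def)
          moreover have "B i j = C i j" using B2[of i] un True less.prems by simp
          ultimately show ?thesis using sum[of "e i" i] step[of "\<not> e i" i] True by simp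
        next
          case False
          then have ij': "Suc i < j" using ij by simp
          have mid: "B (Suc i) (j - 1) = C 0 0 + ?L (e i) (Suc i) (j - 1) + ?L (\<not> e i) (Suc i) (j - 1)"
            using less.hyps[of "j - 1" "Suc i"] ij' less.prems sw[of "e (Suc i)" "Suc i" "j - 1" "e i"] by simp
          have "B i (j - 1) - (B (Suc i) (j - 1) - B (Suc i) j) = C 0 0 + ?L (e i) i j + ?L (\<not> e i) i j"
            using r l mid dr[OF ij] dr[OF ij'] dl[OF ij less.prems(2)] dl[of "j - 1"] ij' less.prems by simp
          moreover have "0 \<le> C 0 0 + ?L (e i) i j + ?L (\<not> e i) i j"
            using low[OF less.prems, of "e i"] nn[OF less.prems] by simp
          ultimately show ?thesis using Bu[OF ij' less.prems(2) un] by simp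
        qed
      qed
    qed
  qed
  show ?thesis using main[of 0 "m - 1"] low[of 0 "m - 1" "e 0"] m by simp
qed

context gentle_track begin

section \<open>Comparing counts along the segments of a word\<close>

definition segment :: "'l list \<Rightarrow> nat \<Rightarrow> nat \<Rightarrow> 'l list" where
  "segment W i j = take (Suc j - i) (drop i W)"

lemma segment_self: "i < length W \<Longrightarrow> segment W i i = [W ! i]"
  by (simp add: segment_def take_Suc_conv_app_nth hd_drop_conv_nth Suc_diff_le)

lemma segment_Cons: "i < j \<Longrightarrow> j < length W \<Longrightarrow> segment W i j = W ! i # segment W (Suc i) j"
  by (simp add: segment_def Cons_nth_drop_Suc[symmetric] Suc_diff_le Suc_diff_Suc[symmetric])

lemma segment_snoc: "i \<le> j \<Longrightarrow> Suc j < length W \<Longrightarrow> segment W i (Suc j) = segment W i j @ [W ! Suc j]"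
  by (simp add: segment_def Suc_diff_le take_Suc_conv_app_nth)

lemma length_segment: "i \<le> j \<Longrightarrow> j < length W \<Longrightarrow> length (segment W i j) = Suc j - i"
  by (simp add: segment_def)

lemma segment_ne: "i \<le> j \<Longrightarrow> j < length W \<Longrightarrow> segment W i j \<noteq> []"
  using length_segment[of i j W] by auto

lemma nth_segment: "i \<le> j \<Longrightarrow> j < length W \<Longrightarrow> k \<le> j - i \<Longrightarrow> segment W i j ! k = W ! (i + k)"
  by (simp add: segment_def)

lemma hd_segment: "i \<le> j \<Longrightarrow> j < length W \<Longrightarrow> hd (segment W i j) = W ! i"
  using segment_ne[of i j W] nth_segment[of i j W 0] by (simp add: hd_conv_nth)

lemma last_segment: "i \<le> j \<Longrightarrow> j < length W \<Longrightarrow> last (segment W i j) = W ! j"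
  using segment_ne[of i j W] nth_segment[of i j W "j - i"] length_segment[of i j W]
  by (simp add: last_conv_nth Suc_diff_le)

lemma segment_all: "W \<noteq> [] \<Longrightarrow> segment W 0 (length W - 1) = W"
  by (simp add: segment_def)

lemma chain_segment: assumes "chain W" "i \<le> j" "j < length W" shows "chain (segment W i j)"
proof -
  have "successively R (segment W i j)"
    using assms chain_nth[OF assms(1)] by (auto simp: successively_conv_nth length_segment nth_segment)
  moreover have "set (segment W i j) \<subseteq> E"
    using assms(1) by (auto simp: chain_def segment_def dest!: in_set_takeD in_set_dropD)
  ultimately show ?thesis using segment_ne assms by (auto simp: chain_def)
qed

text \<open>
  The hypothesis \<open>nk\<close> expresses that the family counted by \<open>c\<close> does not kiss \<open>W\<close>: replacing it
  by a non-kissing family with the same letters only creates more copies of \<open>W\<close>.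
\<close>

lemma count_persists:
  assumes c: "additive c" and d: "nonkissing d" and E: "\<And>l. l \<in> E \<Longrightarrow> c [l] = d [l]" and W: "chain W"
    and nk: "\<And>p n x y. p + n + 1 < length W \<Longrightarrow> sg (W ! p) \<noteq> sg (W ! (p + n + 1)) \<Longrightarrow>
      sg x \<noteq> sg (W ! p) \<Longrightarrow> sg y \<noteq> sg (W ! (p + n + 1)) \<Longrightarrow> R x (W ! (p + 1)) \<Longrightarrow> R (W ! (p + n)) y \<Longrightarrow>
      c (x # take n (drop (p + 1) W) @ [y]) = 0"
  shows "c W \<le> d W"
proof -
  let ?C = "\<lambda>i j. c (segment W i j)" and ?B = "\<lambda>i j. d (segment W i j)" and ?m = "length W"
  have ne: "W \<noteq> []" using W by (auto simp: chain_def)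
  have dd: "additive d" using d by (simp add: nonkissing_def)
  have RW: "R (W ! i) (W ! Suc i)" if "Suc i < ?m" for i using chain_nth[OF W that] .
  have mem: "W ! i \<in> E" if "i < ?m" for i using W that by (auto simp: chain_def)
  have "?C 0 (?m - 1) \<le> ?B 0 (?m - 1)"
  proof (rule unkissed_strands[where e="\<lambda>i. sg (W ! i)"])
    fix i j assume "Suc i \<le> j" "j < ?m"
    then show "?C i j \<le> ?C (Suc i) j"
      using additive_antimono_left[OF c, of "W ! i" "segment W (Suc i) j"] chain_segment[OF W, of i j]
      by (simp add: segment_Cons segment_ne)
  next
    fix i j assume "i \<le> j" "Suc j < ?m"
    then show "?C i (Suc j) \<le> ?C i j"
      using additive_antimono_right[OF c, of "segment W i j" "W ! Suc j"] chain_segment[OF W, of i "Suc j"]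
      by (simp add: segment_snoc segment_ne)
  next
    fix i j assume "i \<le> j" "j < ?m"
    then show "0 \<le> ?C i j" using additive_nonneg[OF c] chain_segment[OF W] by blast
  next
    fix i j assume h: "Suc i \<le> j" "Suc j < ?m" "sg (W ! i) \<noteq> sg (W ! Suc j)"
    let ?u = "segment W (Suc i) j" and ?x = "W ! i" and ?y = "W ! Suc j"
    let ?x' = "prv (W ! Suc i) (\<not> sg ?x)" and ?y' = "nxt (W ! j) (\<not> sg ?y)"
    have r: "R ?x (W ! Suc i)" "R (W ! j) ?y" using RW h by auto
    have x': "R ?x' (W ! Suc i)" "sg ?x' \<noteq> sg ?x" using R_prv[OF r(1)] sg_prv[OF r(1)] by auto
    have y': "R (W ! j) ?y'" "sg ?y' \<noteq> sg ?y" using R_nxt[OF r(2)] sg_nxt[OF r(2)] by auto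
    have ends: "?u \<noteq> []" "hd ?u = W ! Suc i" "last ?u = W ! j" "chain ?u"
      using h segment_ne hd_segment last_segment chain_segment[OF W] by auto
    have u: "?u = take (j - i) (drop (i + 1) W)" by (simp add: segment_def)
    \<comment> \<open>A strand that joins before \<open>?u\<close> and leaves after it on the
      opposite side would kiss \<open>W\<close>. Without such strands, all those that join before
      \<open>?u\<close> continue to \<open>?y\<close>.\<close>
    have "c (?x' # ?u @ [?y']) = 0"
      unfolding u using nk[of i "j - i" ?x' ?y'] h x' y' by simp
    moreover have "c ?u = c (?x # ?u) + c (?x' # ?u)"
      using additive_left[OF c ends(4), of ?x ?x'] r x' ends by auto
    moreover have "c (?x' # ?u) = c (?x' # ?u @ [?y]) + c (?x' # ?u @ [?y'])"
      using additive_right[OF c, of "?x' # ?u" ?y ?y'] r x' y' ends by (auto simp: chain_Cons)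
    moreover have "c (?u @ [?y]) = c (?x # ?u @ [?y]) + c (?x' # ?u @ [?y])"
      using additive_left[OF c, of "?u @ [?y]" ?x ?x'] r x' y' ends by (auto simp: chain_snoc)
    moreover have "segment W i j = ?x # ?u" "segment W (Suc i) (Suc j) = ?u @ [?y]" "segment W i (Suc j) = ?x # ?u @ [?y]"
      using h segment_Cons[of i j W] segment_Cons[of i "Suc j" W] segment_snoc[of "Suc i" j W] by simp_all
    ultimately show "?C (Suc i) j - ?C i j = ?C (Suc i) (Suc j) - ?C i (Suc j)" by simp
  next
    fix i assume "i < ?m"
    then show "?B i i = ?C i i" using E mem by (simp add: segment_self)
  next
    fix i assume h: "Suc i < ?m" "sg (W ! i) \<noteq> sg (W ! Suc i)"
    let ?x = "W ! i" and ?y = "W ! Suc i"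
    let ?x' = "prv ?y (\<not> sg ?x)" and ?y' = "nxt ?x (\<not> sg ?y)"
    have r: "R ?x ?y" using RW h by auto
    have x': "R ?x' ?y" "sg ?x' \<noteq> sg ?x" using R_prv[OF r] sg_prv[OF r] by auto
    have y': "R ?x ?y'" "sg ?y' \<noteq> sg ?y" using R_nxt[OF r] sg_nxt[OF r] by auto
    have x'y': "R ?x' ?y'" using R_square[OF r x'(1) y'(1)] .
    have mm: "?x \<in> E" "?y \<in> E" "?x' \<in> E" "?y' \<in> E" using R_letters r x' y' by blast+
    have s2: "segment W i (Suc i) = [?x, ?y]" using h by (simp add: segment_Cons segment_self)
    \<comment> \<open>The same crossing strand for an empty segment. It forces
      \<open>c [?y'] = c [?x, ?y']\<close>, and then \<open>c [?x, ?y]\<close> obeys the formula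
      that holds for \<open>d\<close>.\<close>
    have "c [?x', ?y'] = 0" using nk[of i 0 ?x' ?y'] h x' y' by simp
    moreover have "c [?x] = c [?x, ?y] + c [?x, ?y']"
      using additive_right[OF c, of "[?x]" ?y ?y'] r y' mm by (auto simp: chain_single)
    moreover have "c [?y'] = c [?x, ?y'] + c [?x', ?y']"
      using additive_left[OF c, of "[?y']" ?x ?x'] y' x' x'y' mm by (auto simp: chain_single)
    moreover have "0 \<le> c [?x, ?y]" using additive_nonneg[OF c] r mm by (auto simp: chain_def)
    moreover have "d [?x, ?y] = max 0 (d [?x] - d [?y'])"
      using nonkissing_unmixed[OF d, of ?x "[]" ?y ?y'] r mm y' h by (auto simp: chain_def)
    ultimately show "?B i (Suc i) = ?C i (Suc i)" using E mm s2 by simp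
  next
    fix i j assume h: "i < j" "j < ?m" "sg (W ! i) = sg (W ! j)"
    then obtain j' where j': "j = Suc j'" by (cases j) auto
    show "?B i j = min (?B i (j - 1)) (?B (Suc i) j)"
    proof (cases "i = j'")
      case True
      have s2: "segment W i j = [W ! i, W ! j]" using h j' True by (simp add: segment_Cons segment_self)
      then have "chain (W ! i # [] @ [W ! j])" using chain_segment[OF W, of i j] h by simp
      from nonkissing_mixed[OF d this h(3)] show ?thesis
        using s2 h j' True by (simp add: segment_self)
    next
      case False
      then have "segment W i j = W ! i # segment W (Suc i) j' @ [W ! j]"
        using h j' segment_Cons[of i j W] segment_snoc[of "Suc i" j' W] by simp
      moreover from this have "chain (W ! i # segment W (Suc i) j' @ [W ! j])"
        using chain_segment[OF W, of i j] h by simp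
      ultimately show ?thesis
        using nonkissing_mixed[OF d _ h(3), of "segment W (Suc i) j'"] h j' False segment_Cons[of i j' W] segment_snoc[of "Suc i" j' W] by simp
    qed
  next
    fix i j assume h: "Suc i < j" "j < ?m" "sg (W ! i) \<noteq> sg (W ! j)"
    then obtain j' where j': "j = Suc j'" by (cases j) auto
    let ?u = "segment W (Suc i) j'" and ?x = "W ! i" and ?y = "W ! j"
    let ?y' = "nxt (W ! j') (\<not> sg ?y)"
    have r: "R (W ! j') ?y" using RW h j' by auto
    have y': "R (W ! j') ?y'" "sg ?y' \<noteq> sg ?y" using R_nxt[OF r] sg_nxt[OF r] by auto
    have ends: "?u \<noteq> []" "last ?u = W ! j'" "chain ?u" using h j' segment_ne last_segment chain_segment[OF W] by auto
    have e: "segment W i j = ?x # ?u @ [?y]" "segment W i j' = ?x # ?u" "segment W (Suc i) j = ?u @ [?y]"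
      using h j' segment_Cons[of i j W] segment_Cons[of i j' W] segment_snoc[of "Suc i" j' W] by simp_all
    have "chain (?x # ?u @ [?y])" using chain_segment[OF W, of i j] h e by simp
    from nonkissing_unmixed[OF d this h(3), of ?y'] have "d (?x # ?u @ [?y]) = max 0 (d (?x # ?u) - d (?u @ [?y']))"
      using y' ends h by simp
    moreover have "d ?u = d (?u @ [?y]) + d (?u @ [?y'])"
      using additive_right[OF dd ends(3), of ?y ?y'] r y' ends by auto
    ultimately show "?B i j = max 0 (?B i (j - 1) - (?B (Suc i) (j - 1) - ?B (Suc i) j))"
      using e j' by simp
  qed (use ne in simp)
  then show ?thesis using segment_all[OF ne] by simp
qed

section \<open>Laminations\<close>

text \<open>
  An integer vector \<open>w\<close> is realised by a lamination whose strands along a positive letter are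
  numbered by the nonnegative integers and, along the inverse letter, by the negative ones.  A strand
  with coordinate \<open>s\<close> on a letter \<open>l\<close> has coordinate \<open>s + w (vt l)\<close> on the next letter, which is
  positive if and only if that coordinate is nonnegative.  Strands are not born, merged or
  reordered, which is why they never kiss.
\<close>

definition coord :: "('v \<Rightarrow> int) \<Rightarrow> 'l list \<Rightarrow> int \<Rightarrow> nat \<Rightarrow> int" where
  "coord w W s i = s + (\<Sum>t<i. w (vt (W ! t)))"

definition reads :: "('v \<Rightarrow> int) \<Rightarrow> 'l list \<Rightarrow> int \<Rightarrow> bool" where
  "reads w W s \<longleftrightarrow> chain W \<and> (\<forall>i<length W. sg (W ! i) \<longleftrightarrow> 0 \<le> coord w W s i)"

text \<open>This concerns the forward direction only. The past of the strand is the future of the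
  inverse letter with coordinate \<open>- 1 - s\<close>.\<close>

definition terminates :: "('v \<Rightarrow> int) \<Rightarrow> 'l \<Rightarrow> int \<Rightarrow> bool" where
  "terminates w l s \<longleftrightarrow> (\<exists>W. reads w W s \<and> hd W = l \<and> terminal (last W))"

definition valid :: "'l \<Rightarrow> int \<Rightarrow> bool" where
  "valid l s \<longleftrightarrow> l \<in> E \<and> (sg l \<longleftrightarrow> 0 \<le> s)"

section \<open>Words that follow a strand\<close>

lemma coord_0 [simp]: "coord w W s 0 = s" by (simp add: coord_def)

lemma coord_Suc: "coord w W s (Suc i) = coord w W s i + w (vt (W ! i))" by (simp add: coord_def)

lemma coord_Cons: "coord w (l # W) s (Suc i) = coord w W (s + w (vt l)) i"
  by (simp add: coord_def sum.lessThan_Suc_shift del: sum.lessThan_Suc)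

lemma coord_shift: "coord w W s i = coord w W t i + (s - t)" by (simp add: coord_def)

lemma coord_append1: "i \<le> length U \<Longrightarrow> coord w (U @ W) s i = coord w U s i"
  by (simp add: coord_def nth_append)

lemma coord_append2: "coord w (U @ W) s (length U + i) = coord w W (coord w U s (length U)) i"
  by (induction i) (simp_all add: coord_append1 coord_Suc)

lemma reads_chain: "reads w W s \<Longrightarrow> chain W" by (simp add: reads_def)

lemma reads_ne: "reads w W s \<Longrightarrow> W \<noteq> []" by (auto simp: reads_def chain_def)

lemma reads_single: "reads w [l] s \<longleftrightarrow> valid l s"
  by (auto simp: reads_def valid_def chain_single)

lemma reads_Cons:
  assumes "W \<noteq> []"
  shows "reads w (l # W) s \<longleftrightarrow> (sg l \<longleftrightarrow> 0 \<le> s) \<and> R l (hd W) \<and> reads w W (s + w (vt l))"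
proof -
  have "(\<forall>i<length (l # W). P i) \<longleftrightarrow> P 0 \<and> (\<forall>i<length W. P (Suc i))" for P
    by (auto simp: less_Suc_eq_0_disj)
  then show ?thesis by (auto simp: reads_def chain_Cons[OF assms] coord_Cons)
qed

lemma reads_hd: "reads w W s \<Longrightarrow> sg (hd W) \<longleftrightarrow> 0 \<le> s"
  using reads_ne[of w W s] by (auto simp: reads_def hd_conv_nth)

lemma reads_valid: "reads w W s \<Longrightarrow> i < length W \<Longrightarrow> valid (W ! i) (coord w W s i)"
  by (auto simp: reads_def valid_def chain_def)

lemma reads_append:
  assumes "U \<noteq> []" "W \<noteq> []"
  shows "reads w (U @ W) s \<longleftrightarrow> reads w U s \<and> R (last U) (hd W) \<and> reads w W (coord w U s (length U))"
proof -
  have "(\<forall>i<length (U @ W). P i) \<longleftrightarrow> (\<forall>i<length U. P i) \<and> (\<forall>i<length W. P (length U + i))" for P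
    by (auto simp: ) (metis add_diff_inverse_nat nat_add_left_cancel_less)
  then show ?thesis
    by (auto simp: reads_def chain_append[OF assms] coord_append1 coord_append2 nth_append)
qed

lemma reads_drop: "reads w W s \<Longrightarrow> i < length W \<Longrightarrow> reads w (drop i W) (coord w W s i)"
  using reads_append[of "take i W" "drop i W" w s] reads_ne[of w W s] by (cases "i = 0") (auto simp: coord_def)

lemma reads_take: "reads w W s \<Longrightarrow> 0 < i \<Longrightarrow> i \<le> length W \<Longrightarrow> reads w (take i W) s"
  using reads_append[of "take i W" "drop i W" w s] reads_ne[of w W s] by (cases "i = length W") (auto simp: coord_def)

text \<open>A strand with coordinate t has coordinate -1 - t when run backwards: this involution
  exchanges nonnegative and negative integers, as \<open>iv\<close> exchanges signs. The shift at a
  vertex keeps its sign because negation and reversal cancel.\<close>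

lemma coord_inw:
  assumes "chain W" "i < length W"
  shows "coord w (inw W) (- 1 - coord w W s (length W - 1)) i = - 1 - coord w W s (length W - 1 - i)"
  using assms(2)
proof (induction i)
  case 0
  then show ?case by simp
next
  case (Suc i)
  let ?j = "length W - 1 - Suc i"
  have j: "Suc ?j = length W - 1 - i" "Suc ?j < length W" using Suc.prems by auto
  have "vt (inw W ! i) = vt (W ! ?j)"
    using nth_inw[of i W] Suc.prems vt_R[OF chain_nth[OF assms(1) j(2)]] j(1) by simp
  then have "coord w (inw W) (- 1 - coord w W s (length W - 1)) (Suc i) = - 1 - coord w W s (Suc ?j) + w (vt (W ! ?j))"
    using Suc j(1) by (simp add: coord_Suc)
  then show ?case by (simp add: coord_Suc)
qed

lemma reads_inw:
  assumes "reads w W s" shows "reads w (inw W) (- 1 - coord w W s (length W - 1))"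
proof -
  have "sg (inw W ! i) \<longleftrightarrow> 0 \<le> coord w (inw W) (- 1 - coord w W s (length W - 1)) i" if "i < length W" for i
    unfolding coord_inw[OF reads_chain[OF assms] that] nth_inw[OF that] sg_iv
    using assms that by (auto simp: reads_def)
  then show ?thesis using reads_chain[OF assms] by (simp add: reads_def)
qed

text \<open>Each letter puts a one-sided bound on the starting coordinate, so the admissible ones
  form an interval.\<close>

lemma reads_convex: "reads w W a \<Longrightarrow> reads w W b \<Longrightarrow> a \<le> c \<Longrightarrow> c \<le> b \<Longrightarrow> reads w W c"
  using coord_shift[of w W c _ a] coord_shift[of w W c _ b] unfolding reads_def by (smt (verit, del_insts))

text \<open>Negative letters only impose upper bounds on the starting coordinate.\<close>

lemma reads_negative: "reads w W a \<Longrightarrow> \<forall>l\<in>set W. \<not> sg l \<Longrightarrow> c \<le> a \<Longrightarrow> reads w W c"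
  using coord_shift[of w W c _ a] unfolding reads_def by (smt (verit, del_insts) nth_mem)

lemma reads_unique:
  "reads w W s \<Longrightarrow> reads w W' s \<Longrightarrow> hd W = hd W' \<Longrightarrow> terminal (last W) \<Longrightarrow> terminal (last W') \<Longrightarrow> W = W'"
proof (induction W arbitrary: s W')
  case Nil
  then show ?case using reads_ne by blast
next
  case (Cons l W)
  obtain V where W': "W' = l # V" using Cons.prems(2,3) reads_ne[of w W' s] by (cases W') auto
  have "W = [] \<longleftrightarrow> V = []"
    using Cons.prems(1,2,4,5) W' reads_Cons[of W w l s] reads_Cons[of V w l s]
    by (cases "W = []"; cases "V = []") (simp_all add: terminal_def)
  then show ?case
  proof (cases "W = [] \<or> V = []")
    case True
    then show ?thesis using \<open>W = [] \<longleftrightarrow> V = []\<close> W' by simp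
  next
    case False
    then have r: "R l (hd W)" "reads w W (s + w (vt l))" "R l (hd V)" "reads w V (s + w (vt l))"
      using Cons.prems reads_Cons[of W w l s] reads_Cons[of V w l s] W' by auto
    have "hd W = hd V" using R_unique[OF r(1,3)] reads_hd[OF r(2)] reads_hd[OF r(4)] by simp
    then show ?thesis using Cons.IH[OF r(2,4)] Cons.prems(4,5) W' False by auto
  qed
qed

text \<open>Words following the strands except for one jump upwards, at the vertex after the letter \<open>c\<close>.\<close>

definition path :: "('v \<Rightarrow> int) \<Rightarrow> 'l list \<Rightarrow> (nat \<Rightarrow> int) \<Rightarrow> nat \<Rightarrow> int \<Rightarrow> bool" where
  "path w W f c J \<longleftrightarrow> chain W \<and> 0 \<le> J \<and> (\<forall>i<length W. sg (W ! i) \<longleftrightarrow> 0 \<le> f i) \<and>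
     (\<forall>i. Suc i < length W \<longrightarrow> f (Suc i) = f i + w (vt (W ! i)) + (if i = c then J else 0))"

lemma path_reads: "reads w W s \<Longrightarrow> path w W (coord w W s) 0 0"
  by (simp add: path_def reads_def coord_Suc)

text \<open>Reversal and negation cancel, so the jump still goes upwards.\<close>

lemma path_inw:
  assumes p: "path w W f c J" and c: "Suc c < length W"
  shows "path w (inw W) (\<lambda>i. - 1 - f (length W - 1 - i)) (length W - 2 - c) J"
proof -
  have ch: "chain W" using p by (simp add: path_def)
  have "- 1 - f (length W - 1 - Suc i) = - 1 - f (length W - 1 - i) + w (vt (inw W ! i))
      + (if i = length W - 2 - c then J else 0)" if i: "Suc i < length W" for i
  proof -
    let ?j = "length W - 1 - Suc i"
    have j: "Suc ?j = length W - 1 - i" "Suc ?j < length W" using i by auto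
    have "vt (inw W ! i) = vt (W ! ?j)"
      using nth_inw[of i W] i vt_R[OF chain_nth[OF ch j(2)]] j(1) by simp
    moreover have "f (Suc ?j) = f ?j + w (vt (W ! ?j)) + (if ?j = c then J else 0)"
      using p j(2) by (simp add: path_def)
    moreover have "i = length W - 2 - c \<longleftrightarrow> ?j = c" using i c by auto
    ultimately show ?thesis using j(1) by simp
  qed
  then show ?thesis using p by (auto simp: path_def nth_inw)
qed

text \<open>
  If the upper path were kissed from below it would have to cross the other one, which is impossible
  unless it jumps over it.
\<close>

lemma path_no_kiss:
  assumes p: "path w W f c J" and p': "path w W' f' c' J'"
    and gap: "\<And>i. i < length W' \<Longrightarrow> Suc c < length W \<Longrightarrow> R (W' ! i) (W ! Suc c) \<Longrightarrow>
      f c < f' i \<Longrightarrow> f c + J \<le> f' i"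
  shows "\<not> kiss W W'"
proof
  assume "kiss W W'"
  then obtain p p' n where h: "p + n + 1 < length W" "p' + n + 1 < length W'"
    "\<And>k. k < n \<Longrightarrow> W ! (p + 1 + k) = W' ! (p' + 1 + k)"
    "\<not> sg (W ! p)" "sg (W ! (p + n + 1))" "sg (W' ! p')" "\<not> sg (W' ! (p' + n + 1))"
    "R (W ! p) (W' ! (p' + 1))" unfolding kiss_def by blast
  have ch: "chain W" "chain W'" and J: "0 \<le> J" "0 \<le> J'" using assms by (auto simp: path_def)
  have sgn: "sg (W ! i) \<longleftrightarrow> 0 \<le> f i" if "i < length W" for i using p that by (simp add: path_def)
  have sgn': "sg (W' ! i) \<longleftrightarrow> 0 \<le> f' i" if "i < length W'" for i using p' that by (simp add: path_def)
  have st: "f (Suc i) = f i + w (vt (W ! i)) + (if i = c then J else 0)" if "Suc i < length W" for i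
    using p that by (simp add: path_def)
  have st': "f' (Suc i) \<ge> f' i + w (vt (W' ! i))" if "Suc i < length W'" for i
    using p' that J by (simp add: path_def)
  have R1: "R (W ! (p + k)) (W ! Suc (p + k))" if "k \<le> n" for k using chain_nth[OF ch(1)] h(1) that by simp
  have R2: "R (W' ! (p' + k)) (W' ! Suc (p' + k))" if "k \<le> n" for k using chain_nth[OF ch(2)] h(2) that by simp
  have R3: "R (W' ! (p' + k)) (W ! Suc (p + k))" if "k \<le> n" for k
  proof (cases k)
    case 0
    then show ?thesis using R_square[of "W ! p" "W' ! (p' + 1)" "W' ! p'" "W ! (p + 1)"] h(8) R1[of 0] R2[of 0] by simp
  next
    case (Suc k')
    then have "W ! (p + k) = W' ! (p' + k)" using h(3)[of k'] that by simp
    then show ?thesis using R1[OF that] by simp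
  qed
  have v: "vt (W ! (p + k)) = vt (W' ! (p' + k))" if "k \<le> n" for k
    using vt_pred[OF R1[OF that] R3[OF that]] .
  \<comment> \<open>To kiss, \<open>W\<close> would have to start below \<open>W'\<close> and end
    above it. It stays strictly below until its jump; by \<open>gap\<close> the jump lands at most
    on the level of \<open>W'\<close>, and afterwards no further jump of \<open>W\<close> can take
    it above. Jumps of \<open>W'\<close> only help.\<close>
  have inv: "f (p + k) < f' (p' + k) \<or> (f (p + k) \<le> f' (p' + k) \<and> c < p + k)" if "k \<le> Suc n" for k
    using that
  proof (induction k)
    case 0
    show ?case using sgn[of p] sgn'[of p'] h(1,2,4,6) by simp
  next
    case (Suc k)
    then have k: "k \<le> n" by simp
    have a: "f (Suc (p + k)) = f (p + k) + w (vt (W ! (p + k))) + (if p + k = c then J else 0)"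
      using st[of "p + k"] h(1) k by simp
    have b: "f' (Suc (p' + k)) \<ge> f' (p' + k) + w (vt (W ! (p + k)))"
      using st'[of "p' + k"] h(2) k v[OF k] by simp
    have g: "p + k = c \<Longrightarrow> f (p + k) < f' (p' + k) \<Longrightarrow> f (p + k) + J \<le> f' (p' + k)"
      using gap[of "p' + k"] R3[OF k] h(1,2) k by auto
    show ?case using Suc.IH k a b g by auto
  qed
  have "f (p + Suc n) \<le> f' (p' + Suc n)" using inv[of "Suc n"] by auto
  moreover have "0 \<le> f (p + Suc n)" using sgn[of "p + Suc n"] h(1,5) by simp
  moreover have "f' (p' + Suc n) < 0" using sgn'[of "p' + Suc n"] h(2,7) by simp
  ultimately show False by simp
qed

lemma reads_no_kiss: "reads w W s \<Longrightarrow> reads w W' s' \<Longrightarrow> \<not> kiss W W'"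
  using path_no_kiss[OF path_reads path_reads] by fastforce

section \<open>Strands that run into a blossom\<close>

lemma terminates_valid: "terminates w l s \<Longrightarrow> valid l s"
  unfolding terminates_def using reads_valid[of w _ s 0] reads_ne by (fastforce simp: hd_conv_nth)

lemma terminates_step:
  assumes "R l m" "valid l s" "valid m (s + w (vt l))"
  shows "terminates w l s \<longleftrightarrow> terminates w m (s + w (vt l))"
proof
  assume "terminates w l s"
  then obtain W where W: "reads w W s" "hd W = l" "terminal (last W)" by (auto simp: terminates_def)
  then obtain V where V: "W = l # V" using reads_ne by (metis list.exhaust_sel)
  have "V \<noteq> []" using W V assms(1) by (auto simp: terminal_def)
  then have r: "R l (hd V)" "reads w V (s + w (vt l))" "terminal (last V)" using W V reads_Cons by auto
  moreover have "hd V = m" using R_unique[OF r(1) assms(1)] reads_hd[OF r(2)] assms(3) by (simp add: valid_def)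
  ultimately show "terminates w m (s + w (vt l))" by (auto simp: terminates_def)
next
  assume "terminates w m (s + w (vt l))"
  then obtain V where V: "reads w V (s + w (vt l))" "hd V = m" "terminal (last V)" by (auto simp: terminates_def)
  then have "reads w (l # V) s" using reads_Cons[of V w l s] reads_ne assms by (auto simp: valid_def)
  then show "terminates w l s" using V reads_ne by (auto simp: terminates_def intro!: exI[of _ "l # V"])
qed

lemma valid_nxt: "R l m \<Longrightarrow> valid (nxt l (0 \<le> s)) s"
  using R_nxt sg_nxt R_letters unfolding valid_def by metis

lemma not_terminates_next:
  assumes "valid l s" "\<not> terminates w l s"
  shows "R l (nxt l (0 \<le> s + w (vt l)))" "valid (nxt l (0 \<le> s + w (vt l))) (s + w (vt l))"
    "\<not> terminates w (nxt l (0 \<le> s + w (vt l))) (s + w (vt l))"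
proof -
  have "\<not> terminal l" using assms reads_single[of w l s] by (auto simp: terminates_def dest: spec[of _ "[l]"])
  then obtain m where m: "R l m" by (auto simp: terminal_def)
  show r: "R l (nxt l (0 \<le> s + w (vt l)))" using R_nxt[OF m] .
  show v: "valid (nxt l (0 \<le> s + w (vt l))) (s + w (vt l))" using valid_nxt[OF m] .
  show "\<not> terminates w (nxt l (0 \<le> s + w (vt l))) (s + w (vt l))" using terminates_step[where w=w, OF r assms(1) v] assms(2) by simp
qed

lemma reads_suffix_terminates: "reads w W s \<Longrightarrow> terminal (last W) \<Longrightarrow> i < length W \<Longrightarrow> terminates w (W ! i) (coord w W s i)"
  unfolding terminates_def using reads_drop[of w W s i] by (intro exI[of _ "drop i W"]) (auto simp: hd_drop_conv_nth)

text \<open>A coordinate changes by at most \<open>M\<close> in one step, so one of absolute value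
  larger than about \<open>n * M\<close> keeps its sign for \<open>n\<close> steps. A strand that
  did not terminate in the meantime would read a long word with constant sign, which
  \<open>positive_bound\<close> forbids.\<close>

lemma not_terminates_bound: "\<exists>B\<ge>0. \<forall>l s. valid l s \<longrightarrow> \<not> terminates w l s \<longrightarrow> \<bar>s\<bar> \<le> B"
proof -
  obtain N where N: "\<And>W. successively R W \<Longrightarrow> \<forall>l\<in>set W. sg l \<Longrightarrow> length W < N"
    using positive_bound by blast
  define M where "M = (\<Sum>l\<in>E. \<bar>w (vt l)\<bar>)"
  have M: "\<bar>w (vt l)\<bar> \<le> M" if "l \<in> E" for l
    unfolding M_def using that finite_letters by (intro member_le_sum) auto
  have M0: "0 \<le> M" unfolding M_def by (simp add: sum_nonneg)
  have pos: "\<exists>W. successively R W \<and> hd W = l \<and> length W = Suc n \<and> (\<forall>l\<in>set W. sg l)"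
    if "valid l s" "\<not> terminates w l s" "int n * M \<le> s" for n l s
    using that
  proof (induction n arbitrary: l s)
    case 0
    then show ?case by (intro exI[of _ "[l]"]) (auto simp: valid_def)
  next
    case (Suc n)
    note nt = not_terminates_next[OF Suc.prems(1,2)]
    have s: "int n * M \<le> s + w (vt l)"
      using Suc.prems(3) M[of l] Suc.prems(1) by (auto simp: valid_def algebra_simps)
    obtain W where W: "successively R W" "hd W = nxt l (0 \<le> s + w (vt l))" "length W = Suc n" "\<forall>l\<in>set W. sg l"
      using Suc.IH[OF nt(2,3) s] by blast
    have "0 \<le> int (Suc n) * M" using M0 by simp
    then have "sg l" using Suc.prems(1,3) by (auto simp: valid_def)
    then show ?case using W nt(1) by (intro exI[of _ "l # W"]) (cases W; auto)
  qed
  have neg: "\<exists>W. successively R W \<and> hd W = l \<and> length W = Suc n \<and> (\<forall>l\<in>set W. \<not> sg l)"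
    if "valid l s" "\<not> terminates w l s" "s \<le> - 1 - int n * M" for n l s
    using that
  proof (induction n arbitrary: l s)
    case 0
    then show ?case by (intro exI[of _ "[l]"]) (auto simp: valid_def)
  next
    case (Suc n)
    note nt = not_terminates_next[OF Suc.prems(1,2)]
    have s: "s + w (vt l) \<le> - 1 - int n * M"
      using Suc.prems(3) M[of l] Suc.prems(1) by (auto simp: valid_def algebra_simps)
    obtain W where W: "successively R W" "hd W = nxt l (0 \<le> s + w (vt l))" "length W = Suc n" "\<forall>l\<in>set W. \<not> sg l"
      using Suc.IH[OF nt(2,3) s] by blast
    have "0 \<le> int (Suc n) * M" using M0 by simp
    then have "\<not> sg l" using Suc.prems(1,3) by (auto simp: valid_def)
    then show ?case using W nt(1) by (intro exI[of _ "l # W"]) (cases W; auto)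
  qed
  have "\<bar>s\<bar> \<le> 1 + int N * M" if v: "valid l s" "\<not> terminates w l s" for l s
  proof (rule ccontr)
    assume "\<not> ?thesis"
    then consider "int N * M \<le> s" | "s \<le> - 1 - int N * M" by linarith
    then show False
    proof cases
      case 1
      then show False using pos[OF v 1] N by force
    next
      case 2
      then obtain W where W: "successively R W" "length W = Suc N" "\<forall>l\<in>set W. \<not> sg l" using neg[OF v 2] by blast
      then have "length (inw W) < N" by (intro N) (auto simp: successively_inw set_inw)
      then show False using W by simp
    qed
  qed
  moreover have "0 \<le> 1 + int N * M" using M0 by simp
  ultimately show ?thesis by blast
qed

text \<open>
  The finitely many states that do not terminate are permuted by the flow, so their past does not
  terminate either.
\<close>

lemma terminates_iv:
  assumes "terminates w (iv l) (- 1 - s)" shows "terminates w l s"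
proof -
  define X where "X = {(l, s). valid l s \<and> \<not> terminates w l s}"
  define st where "st = (\<lambda>(l, s). (nxt l (0 \<le> s + w (vt l)), s + w (vt l)))"
  obtain B where B: "\<And>l s. valid l s \<Longrightarrow> \<not> terminates w l s \<Longrightarrow> \<bar>s\<bar> \<le> B"
    using not_terminates_bound[of w] by blast
  have "X \<subseteq> E \<times> {- B..B}" using B by (fastforce simp: X_def valid_def)
  then have fin: "finite X" by (rule finite_subset) (use finite_letters in simp)
  have sub: "st ` X \<subseteq> X" using not_terminates_next by (auto simp: X_def st_def)
  have "inj_on st X"
  proof (rule inj_onI, clarify)
    fix l s l' s' assume h: "(l, s) \<in> X" "(l', s') \<in> X" "st (l, s) = st (l', s')"
    then have nt: "valid l s" "\<not> terminates w l s" "valid l' s'" "\<not> terminates w l' s'" by (auto simp: X_def)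
    let ?m = "nxt l (0 \<le> s + w (vt l))"
    have r: "R l ?m" "R l' ?m" using not_terminates_next(1)[OF nt(1,2)] not_terminates_next(1)[OF nt(3,4)] h(3) by (auto simp: st_def)
    have s: "s = s'" using vt_pred[OF r] h(3) by (auto simp: st_def)
    then have "l = l'" using R_pred_unique[OF r] nt by (auto simp: valid_def)
    with s show "l = l' \<and> s = s'" by simp
  qed
  with fin sub have surj: "st ` X = X" by (rule endo_inj_surj)
  \<comment> \<open>Running backwards from a state in \<open>X\<close> leads to its preimage under
    \<open>st\<close>, again in \<open>X\<close>; so no finite word \<open>V\<close> brings the
    reversed strand to a blossom.\<close>
  have "\<not> (reads w V (- 1 - s) \<and> hd V = iv l \<and> terminal (last V))" if "(l, s) \<in> X" for V l s
    using that
  proof (induction V arbitrary: l s)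
    case Nil
    then show ?case using reads_ne by blast
  next
    case (Cons k V)
    show ?case
    proof
      assume a: "reads w (k # V) (- 1 - s) \<and> hd (k # V) = iv l \<and> terminal (last (k # V))"
      from surj Cons.prems obtain l' s' where x': "(l', s') \<in> X" "st (l', s') = (l, s)"
        by (metis imageE surj_pair)
      then have nt: "valid l' s'" "\<not> terminates w l' s'" and ls: "l = nxt l' (0 \<le> s' + w (vt l'))" "s = s' + w (vt l')"
        by (auto simp: X_def st_def)
      have r: "R l' l" using not_terminates_next(1)[OF nt] ls by simp
      have r': "R (iv l) (iv l')" using R_iv[OF r] .
      have ne: "V \<noteq> []" using a r' by (auto simp: terminal_def)
      have v: "vt k = vt l'" using a vt_R[OF r] by simp
      have V: "R (iv l) (hd V)" "reads w V (- 1 - s')" "terminal (last V)"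
        using a ne reads_Cons[OF ne, of w k "- 1 - s"] v ls by auto
      have "hd V = iv l'"
        using R_unique[OF V(1) r'] reads_hd[OF V(2)] nt by (auto simp: valid_def)
      then show False using Cons.IH[OF x'(1)] V by blast
    qed
  qed
  moreover have "valid l s" using terminates_valid[OF assms] iv_letters[of "iv l"] by (auto simp: valid_def)
  ultimately have "terminates w l s \<or> \<not> terminates w (iv l) (- 1 - s)" unfolding X_def terminates_def[of w "iv l"] by blast
  then show ?thesis using assms by blast
qed

lemma terminates_iv_iff: "terminates w (iv l) (- 1 - s) \<longleftrightarrow> terminates w l s"
  using terminates_iv[of w l s] terminates_iv[of w "iv l" "- 1 - s"] by auto

section \<open>Maximal families of non-kissing walks\<close>

text \<open>For the undirected walk of \<open>Z\<close>, not being self-kissing means both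
  \<open>\<not> kiss Z Z\<close> and \<open>\<not> kiss Z (inw Z)\<close>. Towards \<open>X\<close>
  one orientation suffices, since \<open>X\<close> is closed under inversion.\<close>

definition maximal_family :: "'l list set \<Rightarrow> bool" where
  "maximal_family X \<longleftrightarrow> finite X \<and> (\<forall>W\<in>X. walk W \<and> mixed W \<and> inw W \<in> X) \<and> (\<forall>W\<in>X. \<forall>V\<in>X. \<not> kiss W V) \<and>
     (\<forall>Z. walk Z \<longrightarrow> mixed Z \<longrightarrow> \<not> kiss Z Z \<longrightarrow> \<not> kiss Z (inw Z) \<longrightarrow>
        (\<forall>V\<in>X. \<not> kiss Z V \<and> \<not> kiss V Z) \<longrightarrow> Z \<in> X)"

lemma mixed_inw [simp]: "mixed (inw W) \<longleftrightarrow> mixed W"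
  by (auto simp: mixed_def set_inw)

text \<open>
  Otherwise take, at the vertex after a letter of a nonterminating strand, the next terminating
  strands above and below it.  The word that follows the lower strand up to this vertex and the
  upper strand afterwards kisses nothing, so it belongs to \<open>X\<close>; but there is no room for it
  between the two strands.
\<close>

lemma all_strands_terminate:
  assumes X: "maximal_family X" and rd: "\<And>W. W \<in> X \<Longrightarrow> \<exists>s. reads w W s" and v: "valid l s"
  shows "terminates w l s"
proof (rule ccontr)
  assume nt: "\<not> terminates w l s"
  define m where "m = nxt l (0 \<le> s + w (vt l))"
  have lm: "R l m" using not_terminates_next(1)[OF v nt] by (simp add: m_def)
  \<comment> \<open>Strands arriving in front of \<open>m\<close> with coordinate \<open>t\<close>
    do so along \<open>st t\<close>, so all strands at this place are indexed by one
    integer.\<close>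
  define st where "st = (\<lambda>s::int. prv m (0 \<le> s))"
  have stR: "R (st t) m" and stsg: "sg (st t) \<longleftrightarrow> 0 \<le> t" for t
    using R_prv[OF lm] sg_prv[OF lm] by (auto simp: st_def)
  have st_valid: "valid (st t) t" for t
    using stsg R_letters[OF stR] by (simp add: valid_def)
  have st_eq: "k = st t" if "R k m" "sg k \<longleftrightarrow> 0 \<le> t" for k t
    using R_pred_unique[OF that(1) stR] that(2) stsg by blast
  have st_vt: "vt (st t) = vt (st t')" for t t' using vt_pred[OF stR stR] .
  define T where "T = (\<lambda>t. terminates w (st t) t)"
  have T0: "\<not> T s" using nt st_eq[OF lm, of s] v by (auto simp: T_def valid_def)
  obtain B where B: "\<And>l s. valid l s \<Longrightarrow> \<not> terminates w l s \<Longrightarrow> \<bar>s\<bar> \<le> B" using not_terminates_bound[of w] by blast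
  have TB: "T t" if "B < \<bar>t\<bar>" for t
  proof (rule ccontr)
    assume "\<not> T t"
    then have "\<bar>t\<bar> \<le> B" unfolding T_def by (rule B[OF st_valid])
    with that show False by simp
  qed
  \<comment> \<open>Strands far from 0 terminate, so there are nearest terminating coordinates
    \<open>s1\<close> above and \<open>s2\<close> below \<open>s\<close>.\<close>
  have "\<exists>n. T (s + 1 + int n)" using TB by (intro exI[of _ "nat (\<bar>B\<bar> + \<bar>s\<bar> + 1)"]) auto
  then obtain n where n: "T (s + 1 + int n)" "\<And>k. k < n \<Longrightarrow> \<not> T (s + 1 + int k)"
    using LeastI_ex[of "\<lambda>n. T (s + 1 + int n)"] not_less_Least by blast
  have "\<exists>n. T (s - 1 - int n)" using TB by (intro exI[of _ "nat (\<bar>B\<bar> + \<bar>s\<bar> + 1)"]) auto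
  then obtain n' where n': "T (s - 1 - int n')" "\<And>k. k < n' \<Longrightarrow> \<not> T (s - 1 - int k)"
    using LeastI_ex[of "\<lambda>n. T (s - 1 - int n)"] not_less_Least by blast
  define s1 where "s1 = s + 1 + int n"
  define s2 where "s2 = s - 1 - int n'"
  have s12: "s2 < s" "s < s1" by (simp_all add: s1_def s2_def)
  have T1: "T s1" and T2: "T s2" using n n' by (simp_all add: s1_def s2_def)
  have gapT: "\<not> T t" if "s2 < t" "t < s1" for t
  proof (cases t s rule: linorder_cases)
    case less
    then show ?thesis using n'(2)[of "nat (s - 1 - t)"] that by (simp add: s2_def)
  next
    case greater
    then show ?thesis using n(2)[of "nat (t - s - 1)"] that by (simp add: s1_def)
  qed (use T0 in simp)

  obtain Y where Y: "reads w Y s1" "hd Y = st s1" "terminal (last Y)" using T1 by (auto simp: T_def terminates_def)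
  then obtain C where YC: "Y = st s1 # C" using reads_ne by (metis list.exhaust_sel)
  have Cne: "C \<noteq> []" using Y YC stR[of s1] by (auto simp: terminal_def)
  define b where "b = s1 + w (vt (st s1))"
  have C: "R (st s1) (hd C)" "reads w C b" "terminal (last C)"
    using Y YC Cne reads_Cons[OF Cne] by (auto simp: b_def)
  have RC: "R (st t) (hd C)" for t using R_square[OF stR stR C(1)] .
  \<comment> \<open>Termination is invariant under reversal, so the lower strand can also be
    followed back to a blossom.\<close>
  have "terminates w (iv (st s2)) (- 1 - s2)" using T2 terminates_iv_iff by (simp add: T_def)
  then obtain V where V: "reads w V (- 1 - s2)" "hd V = iv (st s2)" "terminal (last V)" by (auto simp: terminates_def)
  have Vne: "V \<noteq> []" using V reads_ne by blast
  define A where "A = inw V"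
  define a where "a = - 1 - coord w V (- 1 - s2) (length V - 1)"
  have Ane: "A \<noteq> []" and lA: "length A = length V" using Vne by (auto simp: A_def)
  have A: "reads w A a" using reads_inw[OF V(1)] by (simp add: A_def a_def)
  have coA: "coord w A a i = - 1 - coord w V (- 1 - s2) (length V - 1 - i)" if "i < length A" for i
    using coord_inw[OF reads_chain[OF V(1)], of i w "- 1 - s2"] that lA by (simp add: A_def a_def)
  have A0: "0 < length A" using Ane by simp
  have lastA: "last A = st s2" and hdA: "terminal (iv (hd A))" using V Vne by (simp_all add: A_def last_inw hd_inw)
  have As2: "coord w A a (length A - 1) = s2" using coA[of "length A - 1"] Vne lA by simp
  have A_nth: "A ! i = iv (V ! (length V - 1 - i))" if "i < length A" for i
    using nth_inw[of i V] that lA by (simp add: A_def)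

  define Z where "Z = A @ C"
  have Zch: "chain Z" unfolding Z_def using chain_append[OF Ane Cne] A C RC lastA reads_chain by simp
  have Zw: "walk Z" using Zch hdA C(3) Ane Cne by (simp add: walk_def Z_def)
  \<comment> \<open>The coordinates along \<open>Z\<close>: those of the lower strand up to the
    junction, then those of the upper one. The only jump is \<open>s1 - s2\<close>, after the letter
    \<open>length A - 1\<close>.\<close>
  define f where "f i = (if i < length A then coord w A a i else coord w C b (i - length A))" for i
  have fs: "f (Suc i) = f i + w (vt (Z ! i)) + (if i = length A - 1 then s1 - s2 else 0)"
    if i: "Suc i < length Z" for i
  proof -
    consider "Suc i < length A" | "i = length A - 1" | "length A \<le> i" by linarith
    then show ?thesis
    proof cases
      case 1
      then have "i \<noteq> length A - 1" by linarith
      then show ?thesis using 1 by (simp add: f_def Z_def nth_append coord_Suc)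
    next
      case 2
      then have "Z ! i = st s2" using lastA Ane by (simp add: Z_def nth_append last_conv_nth)
      then show ?thesis using 2 As2 Ane st_vt[of s1 s2] by (simp add: f_def b_def)
    next
      case 3
      then have "i \<noteq> length A - 1" "\<not> i < length A" "\<not> Suc i < length A" "Suc i - length A = Suc (i - length A)"
        using A0 by linarith+
      then show ?thesis by (simp add: f_def Z_def nth_append coord_Suc)
    qed
  qed
  have fsg: "sg (Z ! i) \<longleftrightarrow> 0 \<le> f i" if "i < length Z" for i
    using that A C(2) by (auto simp: f_def Z_def nth_append reads_def)
  have pZ: "path w Z f (length A - 1) (s1 - s2)"
    using Zch s12 fs fsg by (simp add: path_def)
  have fT: "terminates w (Z ! i) (f i)" if i: "i < length Z" for i
  proof (cases "i < length A")
    case True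
    then have "terminates w (V ! (length V - 1 - i)) (coord w V (- 1 - s2) (length V - 1 - i))"
      using reads_suffix_terminates[OF V(1,3)] lA by simp
    then have "terminates w (iv (V ! (length V - 1 - i))) (- 1 - coord w V (- 1 - s2) (length V - 1 - i))"
      using terminates_iv_iff by simp
    then show ?thesis using True A_nth coA by (simp add: Z_def nth_append f_def)
  next
    case False
    then show ?thesis
      using reads_suffix_terminates[OF C(2,3), of "i - length A"] i by (simp add: Z_def nth_append f_def)
  qed
  have fc: "f (length A - 1) = s2" using As2 Ane by (simp add: f_def)
  have Zc: "Z ! Suc (length A - 1) = hd C" using Ane Cne by (simp add: Z_def nth_append hd_conv_nth)
  \<comment> \<open>A path consisting of terminating states cannot pass the junction strictly
    between \<open>s2\<close> and \<open>s1\<close>; this is the gap condition of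
    \<open>path_no_kiss\<close>.\<close>
  have top: "\<not> kiss Z W'" if W': "path w W' f' c' J'" and t: "\<And>i. i < length W' \<Longrightarrow> terminates w (W' ! i) (f' i)"
    for W' f' c' J'
  proof (rule path_no_kiss[OF pZ W'])
    fix i assume i: "i < length W'" "R (W' ! i) (Z ! Suc (length A - 1))" "f (length A - 1) < f' i"
    have "R (W' ! i) m" using R_square[OF RC[of s] _ stR] i(2) Zc by simp
    then have "W' ! i = st (f' i)" using W' i(1) by (intro st_eq) (auto simp: path_def)
    then have "T (f' i)" using t[OF i(1)] by (simp add: T_def)
    then show "f (length A - 1) + (s1 - s2) \<le> f' i" using gapT[of "f' i"] i(3) fc by linarith
  qed
  have k1: "\<not> kiss Z Z" using top[OF pZ fT] .
  have k2: "\<not> kiss Z (inw Z)"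
  proof (rule top[OF path_inw[OF pZ]])
    show "Suc (length A - 1) < length Z" using Ane Cne by (simp add: Z_def)
    fix i assume "i < length (inw Z)"
    then show "terminates w (inw Z ! i) (- 1 - f (length Z - 1 - i))"
      using fT[of "length Z - 1 - i"] terminates_iv_iff by (simp add: nth_inw)
  qed
  have k3: "\<not> kiss Z W \<and> \<not> kiss W Z" if WX: "W \<in> X" for W
  proof -
    obtain r where r: "reads w W r" using rd[OF WX] by blast
    have "terminal (last W)" using X WX unfolding maximal_family_def walk_def by blast
    then have "\<not> kiss Z W" by (rule top[OF path_reads[OF r] reads_suffix_terminates[OF r]])
    moreover have "\<not> kiss W Z" using path_no_kiss[OF path_reads[OF r] pZ] by simp
    ultimately show ?thesis ..
  qed
  \<comment> \<open>The strand \<open>s\<close> can follow neither \<open>C\<close> forwards nor, by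
    \<open>contrV\<close>, \<open>V\<close> backwards, as it would then terminate.\<close>
  have contrC: "False" if "reads w C (s + w (vt (st s)))"
  proof -
    have "valid (hd C) (s + w (vt (st s)))" using reads_hd[OF that] RC R_letters by (auto simp: valid_def)
    moreover have "terminates w (hd C) (s + w (vt (st s)))" using that C(3) by (auto simp: terminates_def)
    ultimately have "T s" using terminates_step[where w=w, OF RC st_valid] by (simp add: T_def)
    then show False using T0 by simp
  qed
  have contrV: "False" if "reads w V (- 1 - s)"
  proof -
    have "sg (iv (st s2)) \<longleftrightarrow> 0 \<le> - 1 - s" using reads_hd[OF that] V(2) by simp
    then have "st s2 = st s" by (intro st_eq stR) auto
    then have "terminates w (iv (st s)) (- 1 - s)" using that V by (auto simp: terminates_def)
    then show False using T0 terminates_iv_iff by (simp add: T_def)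
  qed
  \<comment> \<open>If \<open>A\<close> were entirely positive, \<open>V\<close> would be entirely
    negative and could also be read from the smaller coordinate \<open>- 1 - s\<close>. In the same
    way \<open>C\<close> must contain a positive letter.\<close>
  have "\<exists>l\<in>set A. \<not> sg l"
  proof (rule ccontr)
    assume "\<not> ?thesis"
    then have "\<forall>l\<in>set V. \<not> sg l" by (auto simp: A_def set_inw)
    from reads_negative[OF V(1) this] s12 contrV show False by simp
  qed
  moreover have "\<exists>l\<in>set C. sg l"
  proof (rule ccontr)
    assume "\<not> ?thesis"
    then have "reads w C (s + w (vt (st s)))"
      using reads_negative[OF C(2), of "s + w (vt (st s))"] s12 st_vt[of s s1] by (auto simp: b_def)
    then show False by (rule contrC)
  qed
  ultimately have "mixed Z" by (auto simp: mixed_def Z_def)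
  with X Zw k1 k2 k3 have "Z \<in> X" unfolding maximal_family_def by blast
  then obtain z where z: "reads w Z z" using rd by blast
  \<comment> \<open>The strand along \<open>Z\<close> passes the junction with coordinate
    \<open>t\<close>. By convexity, \<open>t \<le> s2\<close> would allow \<open>s\<close> to follow
    \<open>C\<close>, and \<open>s1 \<le> t\<close> would allow it to follow \<open>V\<close>
    backwards. So \<open>t\<close> lies strictly in the gap, although this strand
    terminates.\<close>
  define t where "t = coord w A z (length A - 1)"
  have zA: "reads w A z" and zC: "reads w C (coord w A z (length A))"
    using z reads_append[OF Ane Cne, of w z] by (auto simp: Z_def)
  have "coord w A z (length A) = t + w (vt (last A))"
    using coord_Suc[of w A z "length A - 1"] Ane by (simp add: t_def last_conv_nth)
  then have tC: "reads w C (t + w (vt (st s)))" using zC lastA st_vt[of s2 s] by simp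
  have tV: "reads w V (- 1 - t)" using reads_inw[OF zA] by (simp add: A_def t_def)
  have "\<not> t \<le> s2"
    using reads_convex[OF tC, of "s1 + w (vt (st s))" "s + w (vt (st s))"] C(2) s12 st_vt[of s s1] contrC
    by (auto simp: b_def)
  moreover have "\<not> s1 \<le> t"
    using reads_convex[OF tV V(1), of "- 1 - s"] s12 contrV by auto
  moreover have "T t"
  proof -
    have "valid (last A) t"
      using reads_valid[OF zA, of "length A - 1"] Ane by (simp add: t_def last_conv_nth)
    then have "last A = st t" using lastA stR by (intro st_eq) (auto simp: valid_def)
    moreover have "terminates w (Z ! (length A - 1)) (coord w Z z (length A - 1))"
    proof (rule reads_suffix_terminates[OF z])
      show "terminal (last Z)" using C(3) Cne by (simp add: Z_def)
      show "length A - 1 < length Z" using A0 by (simp add: Z_def trans_less_add1)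
    qed
    ultimately show ?thesis using Ane
      by (simp add: T_def t_def Z_def nth_append last_conv_nth coord_append1)
  qed
  ultimately show False using gapT[of t] by simp
qed

text \<open>The lamination cut down to finitely many strands: on each letter \<open>l\<close>, the
  \<open>K l\<close> strands with coordinates nearest to 0.\<close>

definition band_count :: "('l \<Rightarrow> int) \<Rightarrow> ('v \<Rightarrow> int) \<Rightarrow> 'l list \<Rightarrow> real" where
  "band_count K w u = real (card {s. reads w u s \<and> - K (hd u) \<le> s \<and> s < K (hd u)})"

text \<open>The hypothesis on \<open>K\<close> says that the outermost strand kept on a positive
  letter continues to the outermost one kept on the next. The cut is therefore compatible with the
  flow, and strands of a lamination do not kiss.\<close>

lemma nonkissing_band_count:
  assumes nn: "\<And>l. 0 \<le> K l" and sym: "\<And>l. K (iv l) = K l"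
    and step: "\<And>l m. R l m \<Longrightarrow> sg l \<Longrightarrow> sg m \<Longrightarrow> K m = K l + w (vt l)"
  shows "nonkissing (band_count K w)"
proof -
  let ?S = "\<lambda>u. {s. reads w u s \<and> - K (hd u) \<le> s \<and> s < K (hd u)}"
  have fin: "finite (?S u)" for u by (rule finite_subset[of _ "{- K (hd u)..<K (hd u)}"]) auto
  have step': "K l = K m + w (vt l)" if "R l m" "\<not> sg l" "\<not> sg m" for l m
    using step[OF R_iv[OF that(1)]] that sym vt_R[OF that(1)] by simp
  have "band_count K w u = band_count K w (u @ [nxt (last u) True]) + band_count K w (u @ [nxt (last u) False])"
    if u: "chain u" "\<not> terminal (last u)" for u
  proof -
    have ne: "u \<noteq> []" using u by (auto simp: chain_def)
    obtain m where "R (last u) m" using u by (auto simp: terminal_def)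
    note nxt = R_nxt[OF this] sg_nxt[OF this]
    have r: "reads w (u @ [nxt (last u) c]) s \<longleftrightarrow> reads w u s \<and> (c \<longleftrightarrow> 0 \<le> coord w u s (length u))" for c s
      using reads_append[OF ne, of "[nxt (last u) c]" w s] nxt R_letters by (auto simp: reads_single valid_def)
    have "?S u = ?S (u @ [nxt (last u) True]) \<union> ?S (u @ [nxt (last u) False])" using r ne by auto
    moreover have "?S (u @ [nxt (last u) True]) \<inter> ?S (u @ [nxt (last u) False]) = {}" using r by auto
    ultimately show ?thesis unfolding band_count_def using card_Un_disjoint[OF fin fin] by simp
  qed
  moreover have "band_count K w u = band_count K w (prv (hd u) True # u) + band_count K w (prv (hd u) False # u)"
    if u: "chain u" "\<not> terminal (iv (hd u))" for u
  proof -
    let ?h = "hd u" and ?x = "\<lambda>c. prv (hd u) c"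
    have ne: "u \<noteq> []" using u by (auto simp: chain_def)
    obtain k where k: "R k ?h" using u terminal_pred by auto
    note prv = R_prv[OF k] sg_prv[OF k]
    define d where "d = w (vt k)"
    have d: "w (vt (?x c)) = d" for c using vt_pred[OF prv(1) k] by (simp add: d_def)
    have r: "reads w (?x c # u) t \<longleftrightarrow> reads w u (t + d) \<and> (c \<longleftrightarrow> 0 \<le> t)" for c t
      using reads_Cons[OF ne] prv d by auto
    have Kt: "K (?x (0 \<le> t)) = (if 0 \<le> t then K (?x True) else K (?x False))" for t :: int by simp
    \<comment> \<open>Between letters of equal sign the bounds shift exactly by \<open>d\<close>. A
      strand that turns is never cut off on either letter, because the counts \<open>K\<close> at
      this vertex are nonnegative.\<close>
    have b: "(- K (?x (0 \<le> t)) \<le> t \<and> t < K (?x (0 \<le> t))) \<longleftrightarrow> (- K ?h \<le> t + d \<and> t + d < K ?h)"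
      if "sg ?h \<longleftrightarrow> 0 \<le> t + d" for t
    proof (cases "sg ?h")
      case True
      have p: "K ?h = K (?x True) + d" using step[OF prv(1)] prv(2) True d by simp
      let ?n = "nxt (?x False) False"
      have "K (?x False) = K ?n + d"
        using step'[of "?x False" ?n] R_nxt[OF prv(1)] sg_nxt[OF prv(1)] prv(2) d by simp
      then show ?thesis using p that True nn[of ?n] nn[of "?x True"] nn[of ?h] nn[of "?x False"]
        unfolding Kt by (smt (verit))
    next
      case False
      have p: "K (?x False) = K ?h + d" using step'[OF prv(1)] prv(2) False d by simp
      let ?n = "nxt (?x True) True"
      have "K ?n = K (?x True) + d"
        using step[of "?x True" ?n] R_nxt[OF prv(1)] sg_nxt[OF prv(1)] prv(2) d by simp
      then show ?thesis using p that False nn[of ?n] nn[of "?x True"] nn[of ?h] nn[of "?x False"]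
        unfolding Kt by (smt (verit))
    qed
    have e: "?S u = (\<lambda>t. t + d) ` (?S (?x True # u) \<union> ?S (?x False # u))"
    proof (intro equalityI subsetI)
      fix s assume s: "s \<in> ?S u"
      have "reads w u (s - d + d)" using s by simp
      then have "sg ?h \<longleftrightarrow> 0 \<le> s - d + d" by (rule reads_hd)
      from b[OF this] s have "s - d \<in> ?S (?x (0 \<le> s - d) # u)" using r[of "0 \<le> s - d" "s - d"] by simp
      then have "s - d \<in> ?S (?x True # u) \<union> ?S (?x False # u)" by (cases "0 \<le> s - d") auto
      then show "s \<in> (\<lambda>t. t + d) ` (?S (?x True # u) \<union> ?S (?x False # u))"
        by (intro image_eqI[of _ _ "s - d"]) auto
    next
      fix s assume "s \<in> (\<lambda>t. t + d) ` (?S (?x True # u) \<union> ?S (?x False # u))"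
      then obtain t c where t: "s = t + d" "t \<in> ?S (?x c # u)" by blast
      then have t': "reads w u (t + d)" "c \<longleftrightarrow> 0 \<le> t" "- K (?x c) \<le> t" "t < K (?x c)" using r by auto
      from b[OF reads_hd[OF t'(1)]] t' t(1) show "s \<in> ?S u" by auto
    qed
    have "card (?S u) = card (?S (?x True # u) \<union> ?S (?x False # u))"
      unfolding e by (rule card_image) (auto simp: inj_on_def)
    also have "\<dots> = card (?S (?x True # u)) + card (?S (?x False # u))"
      by (rule card_Un_disjoint[OF fin fin]) (auto simp: r)
    finally show ?thesis unfolding band_count_def by simp
  qed
  moreover have "band_count K w (x # s @ [y]) = 0 \<or> band_count K w (x' # s @ [y']) = 0"
    if h: "chain (x # s @ [y'])" "\<not> sg x" "sg y" "sg x'" "\<not> sg y'" for x s y x' y'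
  proof (rule ccontr)
    assume "\<not> ?thesis"
    then have "?S (x # s @ [y]) \<noteq> {}" "?S (x' # s @ [y']) \<noteq> {}"
      unfolding band_count_def by (metis card.empty of_nat_0)+
    then obtain t t' where t: "reads w (x # s @ [y]) t" "reads w (x' # s @ [y']) t'" by blast
    have "R x (hd (s @ [y']))" using h(1) chain_Cons[of "s @ [y']" x] by simp
    then have "kiss (x # s @ [y]) (x' # s @ [y'])" unfolding kiss_def using h
      by (intro exI[of _ 0] exI[of _ "length s"]) (auto simp: nth_append hd_conv_nth)
    then show False using reads_no_kiss[OF t] by blast
  qed
  moreover have "0 \<le> band_count K w u" for u by (simp add: band_count_def)
  ultimately show ?thesis unfolding nonkissing_def additive_def by blast
qed

lemma band_count_letter:
  assumes "l \<in> E" "0 \<le> K l" shows "band_count K w [l] = real_of_int (K l)"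
proof -
  have "{s. reads w [l] s \<and> - K (hd [l]) \<le> s \<and> s < K (hd [l])} = (if sg l then {0..<K l} else {- K l..<0})"
    using assms by (auto simp: reads_single valid_def)
  then show ?thesis using assms(2) unfolding band_count_def by (auto simp: )
qed

text \<open>The sum over words counts each undirected walk twice; for a family closed under
  inversion the division is exact by \<open>weight_at_double\<close>.\<close>

definition weight_at :: "'l list set \<Rightarrow> 'v \<Rightarrow> int" where
  "weight_at X a = (\<Sum>W\<in>X. gvec W a) div 2"

lemma letter_count_step:
  assumes X: "finite X" "\<And>W. W \<in> X \<Longrightarrow> walk W" "\<And>W. W \<in> X \<Longrightarrow> inw W \<in> X"
    and l: "R l m" "sg l" "sg m"
  shows "(\<Sum>W\<in>X. int (occ [m] W)) = (\<Sum>W\<in>X. int (occ [l] W)) + weight_at X (vt l)"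
    and "2 * weight_at X (vt l) = (\<Sum>W\<in>X. gvec W (vt l))"
proof -
  have m: "nxt l True = m" using nxt_eq[OF l(1)] l(3) by simp
  have c: "total X (\<lambda>_. 1) u = real_of_int (\<Sum>W\<in>X. int (occ u W))" for u
    by (simp add: total_def)
  have "2 * (total X (\<lambda>_. 1) [nxt l True] - total X (\<lambda>_. 1) [l]) = (\<Sum>W\<in>X. 1 * real_of_int (gvec W (vt l)))"
    using X by (intro total_letter_diff[OF _ _ _ _ _ l(1,2)]) auto
  then have "real_of_int (2 * ((\<Sum>W\<in>X. int (occ [m] W)) - (\<Sum>W\<in>X. int (occ [l] W)))) = real_of_int (\<Sum>W\<in>X. gvec W (vt l))"
    unfolding c m by simp
  then have "2 * ((\<Sum>W\<in>X. int (occ [m] W)) - (\<Sum>W\<in>X. int (occ [l] W))) = (\<Sum>W\<in>X. gvec W (vt l))"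
    by (simp only: of_int_eq_iff)
  then have "weight_at X (vt l) = (\<Sum>W\<in>X. int (occ [m] W)) - (\<Sum>W\<in>X. int (occ [l] W))"
    "2 * ((\<Sum>W\<in>X. int (occ [m] W)) - (\<Sum>W\<in>X. int (occ [l] W))) = (\<Sum>W\<in>X. gvec W (vt l))"
    unfolding weight_at_def by presburger+
  then show "(\<Sum>W\<in>X. int (occ [m] W)) = (\<Sum>W\<in>X. int (occ [l] W)) + weight_at X (vt l)"
    "2 * weight_at X (vt l) = (\<Sum>W\<in>X. gvec W (vt l))" by simp_all
qed

lemma positive_letter_at: obtains l m where "R l m" "sg l" "sg m" "vt l = a"
proof -
  obtain k m where k: "vt k = a" "R k m" using vt_surj by blast
  let ?l = "prv m True"
  have l: "R ?l m" "sg ?l" using R_prv[OF k(2)] sg_prv[OF k(2)] by auto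
  then have "R ?l (nxt ?l True)" "sg (nxt ?l True)" using R_nxt sg_nxt by blast+
  then show ?thesis using that l vt_pred[OF l(1) k(2)] k(1) by blast
qed

lemma weight_at_double:
  assumes "finite X" "\<And>W. W \<in> X \<Longrightarrow> walk W" "\<And>W. W \<in> X \<Longrightarrow> inw W \<in> X"
  shows "2 * weight_at X a = (\<Sum>W\<in>X. gvec W a)"
proof -
  obtain l m where l: "R l m" "sg l" "sg m" "vt l = a" by (rule positive_letter_at)
  then show ?thesis using letter_count_step(2)[OF assms l(1-3)] by simp
qed

text \<open>With \<open>K\<close> the letter counts of \<open>X\<close>, the truncated lamination of
  \<open>weight_at X\<close> and the family \<open>X\<close> are nonkissing counts with the same
  values on letters. They agree on all words, so the value 1 at \<open>W\<close> exhibits a strand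
  along \<open>W\<close>.\<close>

lemma family_reads:
  assumes X: "finite X" "\<And>W. W \<in> X \<Longrightarrow> walk W" "\<And>W. W \<in> X \<Longrightarrow> inw W \<in> X"
    and nk: "\<And>W W'. W \<in> X \<Longrightarrow> W' \<in> X \<Longrightarrow> \<not> kiss W W'" and W: "W \<in> X"
  shows "\<exists>s. reads (weight_at X) W s"
proof -
  define K where "K l = (\<Sum>W\<in>X. int (occ [l] W))" for l
  have c: "total X (\<lambda>_. 1) [l] = real_of_int (K l)" for l by (simp add: total_def K_def)
  have sym: "K (iv l) = K l" for l
  proof -
    have "total X (\<lambda>_. 1) (inw [l]) = total X (\<lambda>_. 1) [l]" using X by (intro total_inw) auto
    then have "total X (\<lambda>_. 1) [iv l] = total X (\<lambda>_. 1) [l]" by (simp add: inw_def)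
    then show ?thesis unfolding c by simp
  qed
  have nn: "0 \<le> K l" for l by (simp add: K_def sum_nonneg)
  have b: "nonkissing (band_count K (weight_at X))"
    using nn sym letter_count_step(1)[OF X] by (intro nonkissing_band_count) (auto simp: K_def)
  have n: "nonkissing (total X (\<lambda>_. 1))" using X nk by (intro nonkissing_total) auto
  have "band_count K (weight_at X) W = total X (\<lambda>_. 1) W"
    using nonkissing_unique[OF b n] band_count_letter nn c X(2)[OF W] walk_chain by simp
  also have "\<dots> = 1" using X W by (subst total_walk) auto
  finally have "{s. reads (weight_at X) W s \<and> - K (hd W) \<le> s \<and> s < K (hd W)} \<noteq> {}"
    unfolding band_count_def by (metis card.empty of_nat_0 zero_neq_one)
  then show ?thesis by blast
qed

text \<open>Scaling by 2C + 1 sends nonnegative coordinates to values \<ge> 0 and negative ones to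
  values \<le> -(2C + 1). Along \<open>W\<close> the vector \<open>u\<close> perturbs them by at
  most C in absolute value; the offset C turns this into an error between 0 and 2C, which preserves
  signs.\<close>

lemma reads_scale:
  assumes r: "reads v W s" and C: "(\<Sum>t<length W. \<bar>u (vt (W ! t))\<bar>) \<le> C"
  shows "reads (\<lambda>a. (2 * C + 1) * v a + u a) W ((2 * C + 1) * s + C)"
proof -
  let ?w = "\<lambda>a. (2 * C + 1) * v a + u a" and ?N = "2 * C + 1"
  have neg: "x \<le> - ?N \<Longrightarrow> \<bar>d\<bar> \<le> C \<Longrightarrow> x + (C + d) < 0" for x d by linarith
  have "sg (W ! i) \<longleftrightarrow> 0 \<le> coord ?w W (?N * s + C) i" if i: "i < length W" for i
  proof -
    let ?d = "\<Sum>t<i. u (vt (W ! t))"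
    have "\<bar>?d\<bar> \<le> (\<Sum>t<i. \<bar>u (vt (W ! t))\<bar>)" by (rule sum_abs)
    also have "\<dots> \<le> (\<Sum>t<length W. \<bar>u (vt (W ! t))\<bar>)" using i by (intro sum_mono2) auto
    finally have d: "\<bar>?d\<bar> \<le> C" using C by simp
    have e: "coord ?w W (?N * s + C) i = ?N * coord v W s i + (C + ?d)"
      by (simp add: coord_def sum.distrib sum_distrib_left algebra_simps)
    show ?thesis
    proof (cases "0 \<le> coord v W s i")
      case True
      then have "0 \<le> ?N * coord v W s i" using d by (intro mult_nonneg_nonneg) auto
      then show ?thesis using r i True d e by (simp add: reads_def)
    next
      case False
      then have "?N * coord v W s i \<le> ?N * (- 1)" using d by (intro mult_left_mono) auto
      then have "?N * coord v W s i \<le> - ?N" by simp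
      then have "?N * coord v W s i + (C + ?d) < 0" using d by (rule neg)
      then have "coord ?w W (?N * s + C) i < 0" using e by simp
      then show ?thesis using r i False by (simp add: reads_def)
    qed
  qed
  then show ?thesis using reads_chain[OF r] by (simp add: reads_def)
qed

section \<open>Counting the strands along the walks of a maximal family\<close>

lemma finite_reads: assumes "mixed W" shows "finite {s. reads w W s}"
proof -
  obtain i j where i: "i < length W" "sg (W ! i)" and j: "j < length W" "\<not> sg (W ! j)"
    using assms unfolding mixed_def by (metis in_set_conv_nth)
  have "{s. reads w W s} \<subseteq> {- coord w W 0 i..- coord w W 0 j}"
  proof
    fix s assume "s \<in> {s. reads w W s}"
    then have "0 \<le> coord w W s i" "\<not> 0 \<le> coord w W s j" using i j unfolding reads_def by blast+
    then show "s \<in> {- coord w W 0 i..- coord w W 0 j}"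
      using coord_shift[of w W s i 0] coord_shift[of w W s j 0] by simp
  qed
  then show ?thesis by (rule finite_subset) simp
qed

lemma card_reads_inw: assumes "W \<noteq> []" shows "card {s. reads w (inw W) s} = card {s. reads w W s}"
proof -
  let ?d = "coord w W 0 (length W - 1)"
  have a: "reads w (inw W) (- 1 - (s + ?d))" if "reads w W s" for s
    using reads_inw[OF that] coord_shift[of w W s _ 0] by (simp add: add.commute)
  have "coord w (inw W) (- 1 - coord w W 0 (length W - 1)) (length W - 1) = - 1" if "chain W"
    using coord_inw[OF that, of "length W - 1" w 0] assms by simp
  then have d: "coord w (inw W) 0 (length W - 1) = ?d" if "chain W"
    using coord_shift[of w "inw W" "- 1 - ?d" "length W - 1" 0] that by simp
  have b: "reads w W (- 1 - (s + ?d))" if r: "reads w (inw W) s" for s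
  proof -
    have "chain W" using reads_chain[OF r] by simp
    then show ?thesis
      using reads_inw[OF r] coord_shift[of w "inw W" s "length W - 1" 0] d by (simp add: add.commute)
  qed
  show ?thesis
    by (rule bij_betw_same_card[of "\<lambda>s. - 1 - (s + ?d)"], rule bij_betwI[of _ _ _ "\<lambda>s. - 1 - (s + ?d)"])
       (use a b in auto)
qed

text \<open>The flow is deterministic in both directions, so one state determines the whole walk and
  the position on it.\<close>

lemma reads_same_walk:
  assumes W: "reads w W s" "walk W" "i < length W" and V: "reads w V t" "walk V" "j < length V"
    and e: "W ! i = V ! j" "coord w W s i = coord w V t j"
  shows "W = V \<and> s = t \<and> i = j"
proof -
  have tail: "drop i W = drop j V"
    if h: "reads w W s" "walk W" "i < length W" "reads w V t" "walk V" "j < length V"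
      "W ! i = V ! j" "coord w W s i = coord w V t j" for W V s t i j
  proof (rule reads_unique)
    show "reads w (drop i W) (coord w W s i)" by (rule reads_drop[OF h(1,3)])
    show "reads w (drop j V) (coord w W s i)" unfolding h(8) by (rule reads_drop[OF h(4,6)])
    show "hd (drop i W) = hd (drop j V)" using h(3,6,7) by (simp only: hd_drop_conv_nth)
    show "terminal (last (drop i W))" "terminal (last (drop j V))" using h(2,3,5,6) by (simp_all add: walk_def)
  qed
  have ch: "chain W" "chain V" using W V walk_chain by auto
  let ?i = "length W - 1 - i" and ?j = "length V - 1 - j"
  have ij': "?i < length W" "length W - 1 - ?i = i" "?j < length V" "length V - 1 - ?j = j"
    using W(3) V(3) by auto
  have "drop ?i (inw W) = drop ?j (inw V)"
  proof (rule tail)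
    show "reads w (inw W) (- 1 - coord w W s (length W - 1))" "reads w (inw V) (- 1 - coord w V t (length V - 1))"
      by (rule reads_inw[OF W(1)], rule reads_inw[OF V(1)])
    show "walk (inw W)" "walk (inw V)" using W(2) V(2) by (simp_all only: walk_inw)
    show "?i < length (inw W)" "?j < length (inw V)" using ij' by (simp_all only: length_inw)
    show "inw W ! ?i = inw V ! ?j"
      unfolding nth_inw[OF ij'(1)] nth_inw[OF ij'(3)] ij' e(1) ..
    show "coord w (inw W) (- 1 - coord w W s (length W - 1)) ?i = coord w (inw V) (- 1 - coord w V t (length V - 1)) ?j"
      unfolding coord_inw[OF ch(1) ij'(1)] coord_inw[OF ch(2) ij'(3)] ij' e(2) ..
  qed
  moreover have "drop (length U - 1 - k) (inw U) = inw (take (Suc k) U)" if "k < length U" for U :: "'l list" and k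
    using that by (simp add: inw_def drop_rev take_map)
  ultimately have "inw (take (Suc i) W) = inw (take (Suc j) V)" using W(3) V(3) by (simp only:)
  then have tk: "take (Suc i) W = take (Suc j) V" by (metis inw_inw)
  have "length (take (Suc i) W) = length (take (Suc j) V)" unfolding tk ..
  then have ij: "i = j" using W(3) V(3) by (simp add: min_def split: if_splits)
  have "take i W = take j V"
    using arg_cong[OF tk, of "take i"] ij by simp
  with tail[OF W V e] have WV: "W = V" by (metis append_take_drop_id)
  then have "s = t" using e(2) ij coord_shift[of w W s i t] by simp
  with WV ij show ?thesis by simp
qed

text \<open>A strand through the turn terminates in both directions, so it runs along a whole walk.
  This walk is mixed because of the turn and kisses nothing that strands follow, hence lies in
  \<open>X\<close> by maximality. The bijection sends a strand on a walk, with a position of the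
  turn, to its coordinate there.\<close>

lemma count_turns:
  assumes X: "maximal_family X" and rd: "\<And>W. W \<in> X \<Longrightarrow> \<exists>s. reads w W s"
    and lm: "R l m" "sg l \<noteq> sg m"
  shows "(\<Sum>W\<in>X. int (card {s. reads w W s}) * int (occ [l, m] W)) = int (card {s. reads w [l, m] s})"
proof -
  have fX: "finite X" and wX: "\<And>W. W \<in> X \<Longrightarrow> walk W" and mX: "\<And>W. W \<in> X \<Longrightarrow> mixed W"
    using X unfolding maximal_family_def by blast+
  define P where "P W = {i. Suc i < length W \<and> W ! i = l \<and> W ! Suc i = m}" for W
  let ?S = "Sigma X (\<lambda>W. {s. reads w W s} \<times> P W)"
  have fP: "finite (P W)" for W unfolding P_def by (rule finite_subset[of _ "{..<length W}"]) auto
  have "card ?S = (\<Sum>W\<in>X. card ({s. reads w W s} \<times> P W))"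
    using fX finite_reads[OF mX] fP by (intro card_SigmaI) auto
  also have "\<dots> = (\<Sum>W\<in>X. card {s. reads w W s} * occ [l, m] W)"
    by (simp add: card_cartesian_product P_def occ_pair)
  finally have S: "int (card ?S) = (\<Sum>W\<in>X. int (card {s. reads w W s}) * int (occ [l, m] W))" by simp
  let ?f = "\<lambda>(W, s, i). coord w W s i"
  have inj: "inj_on ?f ?S"
  proof (rule inj_onI)
    fix p q assume h: "p \<in> ?S" "q \<in> ?S" "?f p = ?f q"
    obtain W s i V t j where pq: "p = (W, s, i)" "q = (V, t, j)" by (metis surj_pair)
    have "W = V \<and> s = t \<and> i = j"
      using h wX unfolding pq by (intro reads_same_walk) (auto simp: P_def)
    then show "p = q" unfolding pq by simp
  qed
  have img: "?f ` ?S = {s. reads w [l, m] s}"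
  proof (intro equalityI subsetI)
    fix s assume "s \<in> ?f ` ?S"
    then obtain W t i where h: "reads w W t" "i \<in> P W" "s = coord w W t i" by auto
    then have "reads w [W ! i, W ! Suc i] s"
      using reads_take[OF reads_drop[OF h(1), of i], of 2]
      by (simp add: P_def take_Suc_conv_app_nth numeral_2_eq_2 hd_drop_conv_nth Suc_leI less_diff_conv)
    then show "s \<in> {s. reads w [l, m] s}" using h(2) by (simp add: P_def)
  next
    fix s assume "s \<in> {s. reads w [l, m] s}"
    then have r: "reads w [l, m] s" by simp
    have v: "valid l s" using reads_valid[OF r, of 0] by simp
    have v': "valid (iv l) (- 1 - s)" using v iv_letters by (auto simp: valid_def)
    have vm: "valid m (s + w (vt l))" using reads_valid[OF r, of 1] by (simp add: coord_def)
    have "terminates w l s" "terminates w (iv l) (- 1 - s)"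
      using all_strands_terminate[OF X rd] v v' by blast+
    then obtain Y V where Y: "reads w Y s" "hd Y = l" "terminal (last Y)"
      and V: "reads w V (- 1 - s)" "hd V = iv l" "terminal (last V)" unfolding terminates_def by blast
    obtain C where C: "Y = l # C" using Y reads_ne by (metis list.exhaust_sel)
    have Cne: "C \<noteq> []" using Y C lm(1) by (auto simp: terminal_def)
    have rC: "R l (hd C)" "reads w C (s + w (vt l))" using Y C reads_Cons[OF Cne] by auto
    have hC: "hd C = m" using R_unique[OF rC(1) lm(1)] reads_hd[OF rC(2)] vm by (simp add: valid_def)
    define A where "A = inw V"
    have Vne: "V \<noteq> []" using V reads_ne by blast
    have Ane: "A \<noteq> []" and Al: "last A = l" "length A = length V" "terminal (iv (hd A))"
      using Vne V by (simp_all add: A_def last_inw hd_inw)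
    obtain a where a: "reads w A a" "coord w A a (length A - 1) = s"
      using reads_inw[OF V(1)] coord_inw[OF reads_chain[OF V(1)], of "length V - 1" w "- 1 - s"] Vne Al(2)
      by (auto simp: A_def)
    have aC: "coord w A a (length A) = s + w (vt l)"
      using coord_Suc[of w A a "length A - 1"] Ane Al(1) a(2) by (simp add: last_conv_nth)
    let ?Z = "A @ C"
    have rZ: "reads w ?Z a" using reads_append[OF Ane Cne] a(1) aC rC Al(1) by simp
    have wZ: "walk ?Z" using reads_chain[OF rZ] Ane Cne Al Y C by (simp add: walk_def)
    have "l \<in> set A" "m \<in> set C" using Al(1) Ane hC Cne by (auto intro: last_in_set hd_in_set)
    then have mZ: "mixed ?Z" using lm(2) by (auto simp: mixed_def)
    have "\<not> kiss ?Z ?Z" "\<not> kiss ?Z (inw ?Z)" using reads_no_kiss rZ reads_inw[OF rZ] by blast+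
    moreover have "\<not> kiss ?Z V \<and> \<not> kiss V ?Z" if "V \<in> X" for V
      using rd[OF that] reads_no_kiss rZ by blast
    ultimately have "?Z \<in> X" using X wZ mZ unfolding maximal_family_def by blast
    moreover have "length A - 1 \<in> P ?Z"
      using Ane Cne Al(1) hC by (simp add: P_def nth_append last_conv_nth hd_conv_nth)
    moreover have "coord w ?Z a (length A - 1) = s" using a(2) by (simp add: coord_append1)
    ultimately show "s \<in> ?f ` ?S" using rZ by (intro image_eqI[of _ _ "(?Z, a, length A - 1)"]) auto
  qed
  have "card ?S = card {s. reads w [l, m] s}" using card_image[OF inj] img by simp
  with S show ?thesis by simp
qed

text \<open>A strand turns exactly if adding \<open>w (vt l)\<close> changes the sign class of its
  coordinate.\<close>

lemma card_turns:
  assumes "R l m" "sg l \<noteq> sg m"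
  shows "int (card {s. reads w [l, m] s}) = max 0 (if sg l then - w (vt l) else w (vt l))"
proof -
  have e: "reads w [l, m] s \<longleftrightarrow> (sg l \<longleftrightarrow> 0 \<le> s) \<and> (\<not> sg l \<longleftrightarrow> 0 \<le> s + w (vt l))" for s
    using reads_Cons[of "[m]" w l s] assms R_letters[OF assms(1)] by (simp add: reads_single valid_def)
  show ?thesis
  proof (cases "sg l")
    case True
    then have "{s. reads w [l, m] s} = {0..<- w (vt l)}" unfolding e by auto
    then show ?thesis using True by simp
  next
    case False
    then have "{s. reads w [l, m] s} = {- w (vt l)..<0}" unfolding e by auto
    then show ?thesis using False by simp
  qed
qed

text \<open>At a vertex the lamination has \<open>max 0 (w a)\<close> strands through the peak and
  \<open>max 0 (- w a)\<close> through the deep in one orientation, with difference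
  \<open>w a\<close>. The other orientation doubles this.\<close>

lemma lamination_vector:
  assumes X: "maximal_family X" and rd: "\<And>W. W \<in> X \<Longrightarrow> \<exists>s. reads w W s"
  shows "2 * w a = (\<Sum>W\<in>X. int (card {s. reads w W s}) * gvec W a)"
proof -
  obtain l m where l: "R l m" "sg l" "sg m" "vt l = a" by (rule positive_letter_at)
  let ?q = "prv m False" and ?P = "nxt l True" and ?N = "nxt l False"
  let ?k = "\<lambda>W. int (card {s. reads w W s})"
  have fX: "finite X" and wX: "\<And>W. W \<in> X \<Longrightarrow> walk W" and iX: "\<And>W. W \<in> X \<Longrightarrow> inw W \<in> X"
    using X unfolding maximal_family_def by blast+
  have q: "R ?q m" "\<not> sg ?q" using R_prv[OF l(1)] sg_prv[OF l(1)] by auto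
  have P: "R l ?P" "sg ?P" "R l ?N" "\<not> sg ?N" using R_nxt[OF l(1)] sg_nxt[OF l(1)] by auto
  have qP: "R ?q ?P" using R_nxt[OF q(1), of True] nxt_pred[OF q(1) l(1)] by simp
  have vq: "vt ?q = a" using vt_pred[OF q(1) l(1)] l(4) by simp
  have k: "?k (inw W) = ?k W" if "W \<in> X" for W
    using card_reads_inw[of W w] wX[OF that] by (auto simp: walk_def chain_def)
  have sym: "(\<Sum>W\<in>X. ?k W * int (occ u (inw W))) = (\<Sum>W\<in>X. ?k W * int (occ u W))" for u
    using k iX by (intro sum.reindex_bij_witness[of _ inw inw]) auto
  have "(\<Sum>W\<in>X. ?k W * gvec W a) = (\<Sum>W\<in>X. ?k W * int (occ [?q, ?P] W) + ?k W * int (occ [?q, ?P] (inw W))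
      - ?k W * int (occ [l, ?N] W) - ?k W * int (occ [l, ?N] (inw W)))"
  proof (intro sum.cong refl)
    fix W assume "W \<in> X"
    then have e: "gvec W a = int (occ [?q, ?P] W) + int (occ [?q, ?P] (inw W)) - int (occ [l, ?N] W) - int (occ [l, ?N] (inw W))"
      using gvec_occ[OF walk_chain[OF wX] l(1,2)] l(4) by simp
    show "?k W * gvec W a = ?k W * int (occ [?q, ?P] W) + ?k W * int (occ [?q, ?P] (inw W))
      - ?k W * int (occ [l, ?N] W) - ?k W * int (occ [l, ?N] (inw W))"
      unfolding e by (simp only: distrib_left right_diff_distrib)
  qed
  also have "\<dots> = 2 * (\<Sum>W\<in>X. ?k W * int (occ [?q, ?P] W)) - 2 * (\<Sum>W\<in>X. ?k W * int (occ [l, ?N] W))"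
    unfolding sum.distrib sum_subtractf sym by simp
  also have "\<dots> = 2 * w a"
    using count_turns[OF X rd qP] count_turns[OF X rd P(3)] card_turns[OF qP, of w] card_turns[OF P(3), of w]
      q P l vq by simp
  finally show ?thesis by simp
qed

lemma maximal_family_generates:
  assumes X: "maximal_family X"
  shows "\<exists>k. (\<forall>W\<in>X. k (inw W) = k W) \<and> (\<forall>a. 2 * u a = (\<Sum>W\<in>X. k W * gvec W a))"
proof -
  have fX: "finite X" and wX: "\<And>W. W \<in> X \<Longrightarrow> walk W" and iX: "\<And>W. W \<in> X \<Longrightarrow> inw W \<in> X"
    and nk: "\<And>W W'. W \<in> X \<Longrightarrow> W' \<in> X \<Longrightarrow> \<not> kiss W W'"
    using X unfolding maximal_family_def by blast+
  let ?v = "weight_at X"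
  define C where "C = (\<Sum>W\<in>X. \<Sum>t<length W. \<bar>u (vt (W ! t))\<bar>)"
  let ?w = "\<lambda>a. (2 * C + 1) * ?v a + u a"
  have rd: "\<exists>s. reads ?w W s" if W: "W \<in> X" for W
  proof -
    obtain s where s: "reads ?v W s" using family_reads[OF fX wX iX nk W] by blast
    have "(\<Sum>t<length W. \<bar>u (vt (W ! t))\<bar>) \<le> C"
      unfolding C_def by (rule member_le_sum[OF W _ fX]) (simp add: sum_nonneg)
    from reads_scale[OF s this] show ?thesis by blast
  qed
  \<comment> \<open>The multiple 2C + 1 of every walk, added to make all walks of \<open>X\<close>
    carry strands, is taken away again; so coefficients may be negative.\<close>
  let ?k = "\<lambda>W. int (card {s. reads ?w W s}) - (2 * C + 1)"
  have "2 * u a = (\<Sum>W\<in>X. ?k W * gvec W a)" for a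
  proof -
    have "(\<Sum>W\<in>X. ?k W * gvec W a)
        = (\<Sum>W\<in>X. int (card {s. reads ?w W s}) * gvec W a) - (2 * C + 1) * (\<Sum>W\<in>X. gvec W a)"
      unfolding left_diff_distrib sum_subtractf sum_distrib_left ..
    also have "\<dots> = 2 * ?w a - (2 * C + 1) * (2 * ?v a)"
      by (simp only: lamination_vector[where w="?w", OF X rd] weight_at_double[OF fX wX iX])
    finally have "(\<Sum>W\<in>X. ?k W * gvec W a) = 2 * ?w a - (2 * C + 1) * (2 * ?v a)" .
    then show ?thesis by (simp add: algebra_simps)
  qed
  moreover have "?k (inw W) = ?k W" if "W \<in> X" for W
    using card_reads_inw[of W ?w] wX[OF that] by (auto simp: walk_def chain_def)
  ultimately show ?thesis by (intro exI[of _ ?k]) auto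
qed

section \<open>The exchange relation of words\<close>

definition family :: "'l list set \<Rightarrow> bool" where
  "family X \<longleftrightarrow> finite X \<and> (\<forall>W\<in>X. walk W \<and> mixed W \<and> inw W \<in> X) \<and> (\<forall>W\<in>X. \<forall>V\<in>X. \<not> kiss W V)"

lemma family_maximal: "maximal_family X \<Longrightarrow> family X"
  unfolding maximal_family_def family_def by blast

lemma familyD:
  assumes "family X"
  shows "finite X" "\<And>W. W \<in> X \<Longrightarrow> walk W" "\<And>W. W \<in> X \<Longrightarrow> mixed W" "\<And>W. W \<in> X \<Longrightarrow> inw W \<in> X"
    "\<And>W V. W \<in> X \<Longrightarrow> V \<in> X \<Longrightarrow> \<not> kiss W V"
  using assms unfolding family_def by blast+

lemma family_weights_unique:
  assumes X: "family X" "\<And>W. W \<in> X \<Longrightarrow> 0 \<le> x W" "\<And>W. x (inw W) = x W"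
    and Y: "family Y" "\<And>W. W \<in> Y \<Longrightarrow> 0 \<le> y W" "\<And>W. y (inw W) = y W"
    and g: "\<And>a. (\<Sum>W\<in>X. x W * real_of_int (gvec W a)) = (\<Sum>W\<in>Y. y W * real_of_int (gvec W a))"
    and W: "W \<in> X \<union> Y"
  shows "(if W \<in> X then x W else 0) = (if W \<in> Y then y W else 0)"
  by (rule weights_unique[OF familyD(1,2)[OF X(1)] X(2) familyD(4)[OF X(1)] X(3) familyD(5)[OF X(1)]
        familyD(1,2)[OF Y(1)] Y(2) familyD(4)[OF Y(1)] Y(3) familyD(5)[OF Y(1)] g])
     (use W familyD(2,3)[OF X(1)] familyD(2,3)[OF Y(1)] in blast)+

text \<open>The positive and negative parts of \<open>c\<close> are two nonnegative weightings of
  \<open>X\<close> with equal sums.\<close>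

lemma family_independent:
  assumes X: "family X" and c: "\<And>W. c (inw W) = c W"
    and g: "\<And>a. (\<Sum>W\<in>X. c W * real_of_int (gvec W a)) = 0" and W: "W \<in> X"
  shows "c W = 0"
proof -
  have "(\<Sum>W\<in>X. max 0 (c W) * real_of_int (gvec W a)) = (\<Sum>W\<in>X. max 0 (- c W) * real_of_int (gvec W a))" for a
  proof -
    have "(\<Sum>W\<in>X. max 0 (c W) * real_of_int (gvec W a)) - (\<Sum>W\<in>X. max 0 (- c W) * real_of_int (gvec W a))
        = (\<Sum>W\<in>X. c W * real_of_int (gvec W a))"
      unfolding sum_subtractf[symmetric] by (rule sum.cong) (auto simp: max_def)
    then show ?thesis using g by simp
  qed
  then have "(if W \<in> X then max 0 (c W) else 0) = (if W \<in> X then max 0 (- c W) else 0)"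
    using c W by (intro family_weights_unique[where x="\<lambda>W. max 0 (c W)" and y="\<lambda>W. max 0 (- c W)", OF X _ _ X]) simp_all
  then show ?thesis using W by (simp add: max_def split: if_splits)
qed

lemma additive_pad:
  assumes c: "additive c" and d: "\<And>l. l \<in> E \<Longrightarrow> 0 \<le> d l" "\<And>l m. R l m \<Longrightarrow> sg l = sg m \<Longrightarrow> d m = d l"
  shows "additive (\<lambda>u. c u + pad d u)"
proof -
  \<comment> \<open>Padding the zero count isolates the additivity of \<open>pad d\<close>.\<close>
  have "nonkissing (\<lambda>u. 0 + pad d u)"
    using d by (intro nonkissing_pad) (auto simp: nonkissing_def additive_def)
  then have "additive (pad d)" by (simp add: nonkissing_def)
  with c show ?thesis unfolding additive_def by (auto simp: add_increasing algebra_simps)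
qed

lemma kwI:
  assumes "p + n + 1 < length W" "p' + n + 1 < length W'" "\<And>k. k < n \<Longrightarrow> W ! (p + 1 + k) = W' ! (p' + 1 + k)"
    "\<not> sg (W ! p)" "sg (W ! (p + n + 1))" "sg (W' ! p')" "\<not> sg (W' ! (p' + n + 1))" "R (W ! p) (W' ! (p' + 1))"
  shows "kiss W W'"
  unfolding kiss_def using assms by blast

text \<open>The family \<open>M\<close> may kiss itself; only kisses with \<open>S\<close> are
  excluded. As in \<open>weights_unique\<close>, padding by straight walks equalises the letter
  counts, after which \<open>count_persists\<close> applies.\<close>

lemma surviving_walk:
  assumes M: "finite M" "\<And>W. W \<in> M \<Longrightarrow> walk W" "\<And>W. W \<in> M \<Longrightarrow> 0 \<le> m W"
      "\<And>W. W \<in> M \<Longrightarrow> inw W \<in> M" "\<And>W. m (inw W) = m W"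
    and X: "family X" "\<And>W. W \<in> X \<Longrightarrow> 0 \<le> x W" "\<And>W. x (inw W) = x W"
    and g: "\<And>a. (\<Sum>W\<in>M. m W * real_of_int (gvec W a)) = (\<Sum>W\<in>X. x W * real_of_int (gvec W a))"
    and S: "walk S" "mixed S" "\<And>W. W \<in> M \<Longrightarrow> \<not> kiss S W" "\<And>W. W \<in> M \<Longrightarrow> \<not> kiss W S"
  shows "(if S \<in> M then m S else 0) \<le> (if S \<in> X then x S else 0)"
proof -
  note F = familyD[OF X(1)]
  let ?c = "total M m" and ?d = "total X x"
  have c: "additive ?c" using M by (intro additive_total) auto
  have d: "nonkissing ?d" using F X by (intro nonkissing_total) auto
  have sy: "?c [iv l] = ?c [l]" "?d [iv l] = ?d [l]" for l
    using total_inw[of M m "[l]"] total_inw[of X x "[l]"] M X F by (auto simp: inw_def)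
  have pos: "?c [k] - ?d [k] = ?c [l] - ?d [l]" if "R l k" "sg l" "sg k" for l k
  proof -
    have "k = nxt l True" using nxt_eq[OF that(1)] that by simp
    then show ?thesis
      using total_letter_diff[where X=M and x=m, OF M that(1,2)]
        total_letter_diff[where X=X and x=x, OF F(1,2) X(2) F(4) X(3) that(1,2)] g[of "vt l"] by simp
  qed
  have step: "?c [k] - ?d [k] = ?c [l] - ?d [l]" if "R l k" "sg l = sg k" for l k
    using pos[OF that(1)] pos[OF R_iv[OF that(1)]] that sy by (cases "sg l") auto
  let ?p = "\<lambda>l. max 0 (?d [l] - ?c [l])" and ?q = "\<lambda>l. max 0 (?c [l] - ?d [l])"
  have st: "?p k = ?p l" "?q k = ?q l" if "R l k" "sg l = sg k" for l k
    using step[OF that] by auto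
  have a: "additive (\<lambda>u. ?c u + pad ?p u)" by (rule additive_pad[OF c]) (simp, rule st)
  have b: "nonkissing (\<lambda>u. ?d u + pad ?q u)" by (rule nonkissing_pad[OF d]) (simp, rule st)
  have "?c S + pad ?p S \<le> ?d S + pad ?q S"
  proof (rule count_persists[OF a b])
    show "?c [l] + pad ?p [l] = ?d [l] + pad ?q [l]" for l by (auto simp: pad_def mixed_def)
    show "chain S" using S walk_chain by simp
    fix p n x' y'
    assume h: "p + n + 1 < length S" "sg (S ! p) \<noteq> sg (S ! (p + n + 1))" "sg x' \<noteq> sg (S ! p)"
      "sg y' \<noteq> sg (S ! (p + n + 1))" "R x' (S ! (p + 1))" "R (S ! (p + n)) y'"
    let ?s = "take n (drop (p + 1) S)"
    let ?u = "x' # ?s @ [y']"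
    have ls: "length ?s = n" using h(1) by simp
    have mx: "mixed ?u" using h(2-4) by (auto simp: mixed_def)
    have "occ ?u W = 0" if W: "W \<in> M" for W
    proof (rule ccontr)
      assume "occ ?u W \<noteq> 0"
      then have "{i. i + length ?u \<le> length W \<and> (\<forall>k<length ?u. W ! (i + k) = ?u ! k)} \<noteq> {}"
        unfolding occ_index by (metis card.empty)
      then obtain i where i: "i + length ?u \<le> length W" "\<forall>k<length ?u. W ! (i + k) = ?u ! k" by blast
      have len: "i + n + 1 < length W" using i(1) ls by simp
      have e: "W ! i = x'" "W ! (i + n + 1) = y'"
        using i(2)[rule_format, of 0] i(2)[rule_format, of "n + 1"] ls by (auto simp: nth_append)
      have mid: "S ! (p + 1 + k) = W ! (i + 1 + k)" if "k < n" for k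
        using i(2)[rule_format, of "1 + k"] that h(1) ls by (auto simp: nth_append)
      have chS: "chain S" and chW: "chain W" using S M(2)[OF W] walk_chain by auto
      have r1: "R (S ! p) (S ! (p + 1))" using chain_nth[OF chS, of p] h(1) by simp
      have r2: "R (W ! i) (W ! (i + 1))" using chain_nth[OF chW, of i] len by simp
      have r3: "R (W ! i) (S ! (p + 1))" using h(5) e by simp
      have r4: "R (S ! p) (W ! (i + 1))" using R_square[OF r3 r1 r2] .
      show False
      \<comment> \<open>The occurrence in \<open>W\<close> and the segment of \<open>S\<close>
        enclose the same string with opposite end signs; the sign of \<open>S ! p\<close> decides
        which of the two is on top.\<close>
      proof (cases "sg (S ! p)")
        case True
        have "kiss W S"
        proof (rule kwI[OF len h(1)])
          show "\<not> sg (W ! i)" "sg (W ! (i + n + 1))" "sg (S ! p)" "\<not> sg (S ! (p + n + 1))"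
            using True h(2-4) unfolding e by blast+
        qed (simp only: mid, rule r3)
        then show False using S(4)[OF W] by simp
      next
        case False
        have "kiss S W"
        proof (rule kwI[OF h(1) len])
          show "\<not> sg (S ! p)" "sg (S ! (p + n + 1))" "sg (W ! i)" "\<not> sg (W ! (i + n + 1))"
            using False h(2-4) unfolding e by blast+
        qed (rule mid, assumption, rule r4)
        then show False using S(3)[OF W] by simp
      qed
    qed
    then have "?c ?u = 0" unfolding total_def by (intro sum.neutral) simp
    then show "?c ?u + pad ?p ?u = 0" using mx by (simp add: pad_def)
  qed
  then show ?thesis using S M F by (simp add: pad_def total_walk)
qed

lemma sum_pair:
  assumes "chain W" "W \<notin> X" "inw W \<notin> X" "finite X" "c (inw W) = c W" "\<And>a. f (inw W) a = f W a"
  shows "(\<Sum>U\<in>insert W (insert (inw W) X). c U * f U a) = 2 * c W * f W a + (\<Sum>U\<in>X. c U * f U a :: 'b::comm_ring_1)"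
proof -
  have "W \<notin> insert (inw W) X" using assms not_palindrome[OF assms(1)] by auto
  then have "(\<Sum>U\<in>insert W (insert (inw W) X). c U * f U a) = c W * f W a + (c (inw W) * f (inw W) a + (\<Sum>U\<in>X. c U * f U a))"
    using assms by simp
  then show ?thesis by (simp add: assms(5,6) algebra_simps)
qed

lemma exchange_relation:
  assumes X: "maximal_family (insert W (insert (inw W) X))" and Y: "maximal_family (insert V (insert (inw V) X))"
    and W: "W \<notin> X" "inw W \<notin> X" and V: "V \<notin> X" "inw V \<notin> X" and WV: "V \<noteq> W" "V \<noteq> inw W"
  shows "\<exists>k::'l list \<Rightarrow> int. (\<forall>U. k (inw U) = k U) \<and> (\<forall>U\<in>X. 0 \<le> k U) \<and>
    (\<forall>a. 2 * (gvec W a + gvec V a) = (\<Sum>U\<in>X. k U * gvec U a))"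
proof -
  let ?X = "insert W (insert (inw W) X)" and ?Y = "insert V (insert (inw V) X)"
  have fX: "family ?X" and fY: "family ?Y" using X Y family_maximal by auto
  note dX = familyD[OF fX] and dY = familyD[OF fY]
  have wW: "walk W" and wV: "walk V" using dX(2)[of W] dY(2)[of V] by auto
  then have cW: "chain W" and cV: "chain V" using walk_chain by auto
  have fin: "finite X" using dX(1) by simp
  have WV': "inw V \<noteq> W" "inw V \<noteq> inw W" using WV by (metis inw_inw)+
  have iX: "inw U \<in> X" if "U \<in> X" for U
  proof -
    have "inw U \<in> ?X" using dX(4)[of U] that by simp
    moreover have "inw U \<noteq> W" "inw U \<noteq> inw W" using that W by (metis inw_inw)+
    ultimately show ?thesis by simp
  qed
  have gW: "gvec (inw W) a = gvec W a" and gV: "gvec (inw V) a = gvec V a" for a using gvec_inw cW cV by auto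
  obtain k where k: "\<forall>U\<in>?X. k (inw U) = k U" "\<And>a. 2 * gvec V a = (\<Sum>U\<in>?X. k U * gvec U a)"
    using maximal_family_generates[OF X, of "gvec V"] by blast
  obtain k' where k': "\<forall>U\<in>?Y. k' (inw U) = k' U" "\<And>a. 2 * gvec W a = (\<Sum>U\<in>?Y. k' U * gvec U a)"
    using maximal_family_generates[OF Y, of "gvec W"] by blast
  have kW: "k (inw W) = k W" and kV: "k' (inw V) = k' V" using k(1) k'(1) by blast+
  have kX: "k (inw U) = k U" and kX': "k' (inw U) = k' U" if "U \<in> X" for U using k(1) k'(1) that by blast+
  have iX': "inw U \<in> X \<longleftrightarrow> U \<in> X" for U using iX[of U] iX[of "inw U"] by (metis inw_inw)
  have eV: "2 * gvec V a = 2 * k W * gvec W a + (\<Sum>U\<in>X. k U * gvec U a)" for a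
    using k(2)[of a] sum_pair[where c=k and f=gvec and a=a, OF cW W fin kW gW] by simp
  have eW: "2 * gvec W a = 2 * k' V * gvec V a + (\<Sum>U\<in>X. k' U * gvec U a)" for a
    using k'(2)[of a] sum_pair[where c=k' and f=gvec and a=a, OF cV V fin kV gV] by simp
  define kk where "kk U = (if U \<in> X then k U else 0)" for U
  have kk: "kk (inw U) = kk U" for U
    using kX[of U] iX'[of U] by (simp add: kk_def)
  have prod1: "k W * k' V = 1"
  proof -
    \<comment> \<open>The coefficients left after substituting the expansion of
      \<open>gvec V\<close> into that of \<open>gvec W\<close> and moving everything to one side: a
      dependence inside the first family, so all of them are 0.\<close>
    define c where "c U = (if U \<in> X then k' U + k' V * k U else if U = W \<or> U = inw W then k W * k' V - 1 else 0)" for U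
    have csym: "c (inw U) = c U" for U
    proof (cases "U \<in> X")
      case True
      then show ?thesis using iX[OF True] kX[OF True] kX'[OF True] by (simp add: c_def)
    next
      case False
      then have "inw U \<notin> X" using iX' by simp
      moreover have "inw U = W \<longleftrightarrow> U = inw W" "inw U = inw W \<longleftrightarrow> U = W" by (metis inw_inw)+
      ultimately show ?thesis using False by (auto simp: c_def)
    qed
    have "(\<Sum>U\<in>?X. c U * gvec U a) = 0" for a
    proof -
      have "(\<Sum>U\<in>?X. c U * gvec U a) = 2 * c W * gvec W a + (\<Sum>U\<in>X. c U * gvec U a)"
        using csym by (intro sum_pair[OF cW W fin _ gW])
      also have "(\<Sum>U\<in>X. c U * gvec U a) = (\<Sum>U\<in>X. k' U * gvec U a) + k' V * (\<Sum>U\<in>X. k U * gvec U a)"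
        unfolding sum_distrib_left sum.distrib[symmetric] by (rule sum.cong) (auto simp: c_def algebra_simps)
      also have "\<dots> = (2 * gvec W a - 2 * k' V * gvec V a) + k' V * (2 * gvec V a - 2 * k W * gvec W a)"
        using eV[of a] eW[of a] by simp
      also have "2 * c W * gvec W a = 2 * (k W * k' V - 1) * gvec W a" using W by (simp add: c_def)
      finally show ?thesis by (simp add: algebra_simps)
    qed
    then have "(\<Sum>U\<in>?X. real_of_int (c U) * real_of_int (gvec U a)) = 0" for a
      by (simp only: of_int_mult[symmetric] of_int_sum[symmetric] of_int_0)
    then have "real_of_int (c W) = 0"
      by (intro family_independent[where c="\<lambda>U. real_of_int (c U)", OF fX]) (simp_all add: csym)
    then have "c W = 0" by (simp only: of_int_eq_0_iff)
    then show ?thesis using W by (simp add: c_def)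
  qed
  have "k W \<noteq> 1"
  proof
    assume k1: "k W = 1"
    \<comment> \<open>With coefficient 1, moving the negative part of \<open>k\<close> to the side
      of \<open>V\<close> gives two nonnegative combinations with the same sum, over the first and
      over the second family. Only the second one involves \<open>V\<close>.\<close>
    define x where "x U = (if U \<in> X then max 0 (real_of_int (k U)) else if U = W \<or> U = inw W then 1 else 0)" for U
    define y where "y U = (if U \<in> X then max 0 (- real_of_int (k U)) else if U = V \<or> U = inw V then 1 else 0)" for U
    have sw: "inw U = A \<longleftrightarrow> U = inw A" for U A by (metis inw_inw)
    have xs: "x (inw U) = x U" and ys: "y (inw U) = y U" for U
      using kX[of U] by (auto simp: x_def y_def iX' sw)
    have "(\<Sum>U\<in>?X. x U * real_of_int (gvec U a)) = (\<Sum>U\<in>?Y. y U * real_of_int (gvec U a))" for a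
    proof -
      have 1: "(\<Sum>U\<in>?X. x U * real_of_int (gvec U a)) = 2 * x W * real_of_int (gvec W a) + (\<Sum>U\<in>X. x U * real_of_int (gvec U a))"
        using xs gW by (intro sum_pair[OF cW W fin]) auto
      have 2: "(\<Sum>U\<in>?Y. y U * real_of_int (gvec U a)) = 2 * y V * real_of_int (gvec V a) + (\<Sum>U\<in>X. y U * real_of_int (gvec U a))"
        using ys gV by (intro sum_pair[OF cV V fin]) auto
      have 3: "(\<Sum>U\<in>X. x U * real_of_int (gvec U a)) - (\<Sum>U\<in>X. y U * real_of_int (gvec U a)) = real_of_int (\<Sum>U\<in>X. k U * gvec U a)"
        unfolding sum_subtractf[symmetric] of_int_sum by (rule sum.cong) (auto simp: x_def y_def max_def)
      have 4: "real_of_int (2 * gvec V a) = real_of_int (2 * gvec W a) + real_of_int (\<Sum>U\<in>X. k U * gvec U a)"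
        using eV[of a] k1 by simp
      show ?thesis using 1 2 3 4 W V by (simp add: x_def y_def)
    qed
    from family_weights_unique[where x=x and y=y, OF fX _ xs fY _ ys this, of V]
    have "(if V \<in> ?X then x V else 0) = (if V \<in> ?Y then y V else 0)"
      by (simp add: x_def y_def)
    then show False using V WV by (simp add: y_def)
  qed
  with prod1 have k1: "k W = - 1" by (auto simp: zmult_eq_1_iff)
  have rel: "2 * (gvec W a + gvec V a) = (\<Sum>U\<in>X. kk U * gvec U a)" for a
  proof -
    have "(\<Sum>U\<in>X. kk U * gvec U a) = (\<Sum>U\<in>X. k U * gvec U a)" by (rule sum.cong) (auto simp: kk_def)
    then show ?thesis using eV[of a] k1 by simp
  qed
  have "0 \<le> kk S" if S: "S \<in> X" for S
  proof (rule ccontr)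
    assume neg: "\<not> 0 \<le> kk S"
    \<comment> \<open>Terms with negative coefficients move to the side of \<open>W\<close> and
      \<open>V\<close> and form \<open>?M\<close>; the positive ones remain in the non-kissing
      family \<open>?P\<close>. As \<open>S\<close> lies in the common part, it kisses nothing in
      \<open>?M\<close>, so \<open>surviving_walk\<close> forces it into \<open>?P\<close>.\<close>
    let ?N = "{U \<in> X. kk U < 0}" and ?P = "{U \<in> X. 0 < kk U}"
    let ?M = "insert W (insert (inw W) (insert V (insert (inw V) ?N)))"
    define m where "m U = (if U \<in> X then real_of_int (- kk U) else 1)" for U
    have ms: "m (inw U) = m U" for U by (simp add: m_def iX' kk)
    have sub: "?M \<subseteq> ?X \<union> ?Y" by blast
    have famP: "family ?P" unfolding family_def
      using fin dX(2,3,5) iX kk by auto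
    have sums: "(\<Sum>U\<in>?M. m U * real_of_int (gvec U a)) = (\<Sum>U\<in>?P. real_of_int (kk U) * real_of_int (gvec U a))" for a
    proof -
      have N: "V \<notin> ?N" "inw V \<notin> ?N" "finite ?N" using V fin by auto
      have "W \<notin> insert V (insert (inw V) ?N)" "inw W \<notin> insert V (insert (inw V) ?N)"
        using W WV WV' by auto
      then have "(\<Sum>U\<in>?M. m U * real_of_int (gvec U a)) = 2 * m W * real_of_int (gvec W a)
          + (2 * m V * real_of_int (gvec V a) + (\<Sum>U\<in>?N. m U * real_of_int (gvec U a)))"
        using ms gW gV fin sum_pair[where c=m and f="\<lambda>U a. real_of_int (gvec U a)" and a=a, OF cV N]
        by (subst sum_pair[OF cW]) auto
      also have "(\<Sum>U\<in>?N. m U * real_of_int (gvec U a)) = (\<Sum>U\<in>?P. real_of_int (kk U) * real_of_int (gvec U a)) - real_of_int (\<Sum>U\<in>X. kk U * gvec U a)"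
      proof -
        have "(\<Sum>U\<in>X. real_of_int (kk U) * real_of_int (gvec U a)) =
            (\<Sum>U\<in>X. (if 0 < kk U then real_of_int (kk U) * real_of_int (gvec U a) else 0)
              - (if kk U < 0 then m U * real_of_int (gvec U a) else 0))"
          by (rule sum.cong) (auto simp: m_def)
        also have "\<dots> = (\<Sum>U\<in>?P. real_of_int (kk U) * real_of_int (gvec U a)) - (\<Sum>U\<in>?N. m U * real_of_int (gvec U a))"
          unfolding sum_subtractf sum.inter_filter[OF fin] ..
        finally show ?thesis by simp
      qed
      also have "real_of_int (\<Sum>U\<in>X. kk U * gvec U a) = 2 * real_of_int (gvec W a) + 2 * real_of_int (gvec V a)"
        unfolding rel[symmetric] by simp
      finally show ?thesis using W V by (simp add: m_def)
    qed
    have M: "walk U" "inw U \<in> ?M" if "U \<in> ?M" for U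
      using that dX(2)[of U] dY(2)[of U] iX kk by auto
    have nk: "\<not> kiss S U" "\<not> kiss U S" if "U \<in> ?M" for U
      using that sub S dX(5)[of S U] dX(5)[of U S] dY(5)[of S U] dY(5)[of U S] by blast+
    have nonneg: "0 \<le> m U" if "U \<in> ?M" for U
      using that W V by (auto simp: m_def)
    have "(if S \<in> ?M then m S else 0) \<le> (if S \<in> ?P then real_of_int (kk S) else 0)"
    proof (rule surviving_walk[where x="\<lambda>U. real_of_int (kk U)" and m=m and M="?M" and X="?P"])
      show "finite ?M" using fin by simp
      show "walk S" "mixed S" using dX(2,3)[of S] S by simp_all
      show "real_of_int (kk (inw U)) = real_of_int (kk U)" for U by (simp only: kk)
      show "0 \<le> real_of_int (kk U)" if "U \<in> ?P" for U using that by simp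
    qed (fact M nonneg ms famP sums nk)+
    then show False using S neg by (auto simp: m_def split: if_splits)
  qed
  with kk rel show ?thesis by blast
qed

text \<open>Passage from positions to concatenations, the form in which top and bottom strings are
  given.\<close>

lemma kiss_factor:
  "kiss W V \<longleftrightarrow> (\<exists>xs x s y zs xs' x' y' zs'. W = xs @ [x] @ s @ [y] @ zs \<and> V = xs' @ [x'] @ s @ [y'] @ zs' \<and>
    \<not> sg x \<and> sg y \<and> sg x' \<and> \<not> sg y' \<and> R x (hd (s @ [y'])))"
proof
  assume "kiss W V"
  then obtain p p' n where h: "p + n + 1 < length W" "p' + n + 1 < length V"
    "\<And>k. k < n \<Longrightarrow> W ! (p + 1 + k) = V ! (p' + 1 + k)"
    "\<not> sg (W ! p)" "sg (W ! (p + n + 1))" "sg (V ! p')" "\<not> sg (V ! (p' + n + 1))"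
    "R (W ! p) (V ! (p' + 1))" unfolding kiss_def by blast
  have split: "U = take q U @ [U ! q] @ take n (drop (q + 1) U) @ [U ! (q + n + 1)] @ drop (q + n + 2) U"
    if q: "q + n + 1 < length U" for U :: "'l list" and q
  proof -
    have "drop (q + 1) U = take n (drop (q + 1) U) @ drop (q + 1 + n) U"
      by (metis append_take_drop_id drop_drop add.commute)
    moreover have "drop (q + 1 + n) U = [U ! (q + n + 1)] @ drop (q + n + 2) U"
      using Cons_nth_drop_Suc[of "q + n + 1" U] q by (simp add: add.commute add.left_commute)
    moreover have "U = take q U @ [U ! q] @ drop (q + 1) U"
      using id_take_nth_drop[of q U] q by simp
    ultimately show ?thesis by simp
  qed
  let ?s = "take n (drop (p + 1) W)"
  have s: "?s = take n (drop (p' + 1) V)"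
    using h(1-3) by (intro nth_equalityI) auto
  have "hd (?s @ [V ! (p' + n + 1)]) = V ! (p' + 1)"
    unfolding s using h(2) by (cases n) (auto simp: hd_conv_nth nth_append)
  with h(8) have r: "R (W ! p) (hd (?s @ [V ! (p' + n + 1)]))" by simp
  show "\<exists>xs x s y zs xs' x' y' zs'. W = xs @ [x] @ s @ [y] @ zs \<and> V = xs' @ [x'] @ s @ [y'] @ zs' \<and>
    \<not> sg x \<and> sg y \<and> sg x' \<and> \<not> sg y' \<and> R x (hd (s @ [y']))"
    using split[OF h(1)] split[OF h(2)] h(4-7) r unfolding s[symmetric] by blast
next
  assume "\<exists>xs x s y zs xs' x' y' zs'. W = xs @ [x] @ s @ [y] @ zs \<and> V = xs' @ [x'] @ s @ [y'] @ zs' \<and>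
    \<not> sg x \<and> sg y \<and> sg x' \<and> \<not> sg y' \<and> R x (hd (s @ [y']))"
  then obtain xs x s y zs xs' x' y' zs' where e: "W = xs @ [x] @ s @ [y] @ zs" "V = xs' @ [x'] @ s @ [y'] @ zs'"
    and sg: "\<not> sg x" "sg y" "sg x'" "\<not> sg y'" and r: "R x (hd (s @ [y']))" by blast
  have W: "W ! length xs = x" "W ! (length xs + length s + 1) = y"
    "\<And>k. k < length s \<Longrightarrow> W ! (length xs + 1 + k) = s ! k" by (simp_all add: e nth_append)
  have V: "V ! length xs' = x'" "V ! (length xs' + length s + 1) = y'"
    "\<And>k. k < length s \<Longrightarrow> V ! (length xs' + 1 + k) = s ! k" by (simp_all add: e nth_append)
  have "V ! (length xs' + 1) = hd (s @ [y'])" using V(2) V(3)[of 0] by (cases s) simp_all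
  with r W(1) have r': "R (W ! length xs) (V ! (length xs' + 1))" by simp
  show "kiss W V"
    by (rule kwI[of "length xs" "length s" W "length xs'" V]) (use e W V sg r' in simp_all)
qed

lemma mixed_turn: assumes "mixed W" shows "\<exists>i. Suc i < length W \<and> sg (W ! i) \<noteq> sg (W ! Suc i)"
proof (rule ccontr)
  assume n: "\<not> ?thesis"
  have "sg (W ! i) = sg (W ! 0)" if "i < length W" for i
    using that
  proof (induction i)
    case (Suc i)
    then show ?case using n by (metis Suc_lessD)
  qed simp
  then show False using assms unfolding mixed_def by (metis in_set_conv_nth)
qed

end

section \<open>Relations and strings of gentle quivers\<close>

text \<open>The elements supported on paths that contain a path from \<open>S\<close> form an ideal,
  since a factor of a piece of a path is a factor of the path.\<close>

lemma in_path_ideal: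
  fixes B :: "('v, 'e) pre_digraph" and J :: "('v \<times> 'e list \<Rightarrow> 'k::field) set"
  assumes fin: "fin_digraph B" and S: "S \<subseteq> paths B"
    and J: "J = Idl\<^bsub>path_algebra B\<^esub> (basis_path ` S)" and x: "basis_path (u, p) \<in> J"
  shows "\<exists>xs q zs. p = xs @ q @ zs \<and> (path_end B u xs, q) \<in> S"
proof -
  let ?R = "path_algebra B :: ('v \<times> 'e list \<Rightarrow> 'k) ring"
  interpret ring ?R using fin by (rule ring_path_algebra)
  define P where "P u p \<longleftrightarrow> (\<exists>xs q zs. p = xs @ q @ zs \<and> (path_end B u xs, q) \<in> S)" for u p
  have P_left: "P u p" if "P u (take i p)" for u p i
    using that unfolding P_def by (metis append_take_drop_id append.assoc)
  have P_right: "P u p" if "P (path_end B u (take i p)) (drop i p)" for u p i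
  proof -
    from that obtain xs q zs where "drop i p = xs @ q @ zs" "(path_end B (path_end B u (take i p)) xs, q) \<in> S"
      unfolding P_def by blast
    then have "p = (take i p @ xs) @ q @ zs \<and> (path_end B u (take i p @ xs), q) \<in> S"
      by (metis append.assoc append_take_drop_id path_end_append)
    then show ?thesis unfolding P_def by blast
  qed
  let ?K = "{f \<in> carrier ?R. \<forall>u p. f (u, p) \<noteq> 0 \<longrightarrow> P u p}"
  have add: "f \<oplus>\<^bsub>?R\<^esub> g = (\<lambda>x. f x + g x)" for f g by (simp add: path_algebra_def)
  have zero: "\<zero>\<^bsub>?R\<^esub> = (\<lambda>x. 0)" by (simp add: path_algebra_def)
  have mult: "\<exists>i\<le>length p. f (u, take i p) \<noteq> 0 \<and> g (path_end B u (take i p), drop i p) \<noteq> 0"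
    if "(f \<otimes>\<^bsub>?R\<^esub> g) (u, p) \<noteq> 0" for f g u p
    using that unfolding path_mult_eq by (metis (no_types, lifting) atMost_iff mult_zero_left mult_zero_right sum.neutral)
  have neg: "\<ominus>\<^bsub>?R\<^esub> f = (\<lambda>x. - f x)" if "f \<in> carrier ?R" for f
  proof (rule minus_equality)
    show "(\<lambda>x. - f x) \<oplus>\<^bsub>?R\<^esub> f = \<zero>\<^bsub>?R\<^esub>" unfolding add zero by simp
    show "(\<lambda>x. - f x) \<in> carrier ?R" using that by (simp add: path_algebra_def)
  qed (fact that)
  have "ideal ?K ?R"
  proof (rule idealI)
    show "subgroup ?K (add_monoid ?R)"
    proof (rule add.subgroupI)
      have "\<zero>\<^bsub>?R\<^esub> \<in> ?K" using zero_closed zero by simp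
      then show "?K \<noteq> {}" by blast
    next
      fix f assume f: "f \<in> ?K"
      then have "\<ominus>\<^bsub>?R\<^esub> f \<in> carrier ?R" by simp
      with f neg[of f] show "\<ominus>\<^bsub>?R\<^esub> f \<in> ?K" by simp
    next
      fix f g assume fg: "f \<in> ?K" "g \<in> ?K"
      then have "f \<oplus>\<^bsub>?R\<^esub> g \<in> carrier ?R" by simp
      moreover have "P u p" if "(f \<oplus>\<^bsub>?R\<^esub> g) (u, p) \<noteq> 0" for u p
      proof -
        have "f (u, p) \<noteq> 0 \<or> g (u, p) \<noteq> 0" using that unfolding add by auto
        then show ?thesis using fg by blast
      qed
      ultimately show "f \<oplus>\<^bsub>?R\<^esub> g \<in> ?K" by blast
    qed auto
  next
    fix f g assume fg: "f \<in> ?K" "g \<in> carrier ?R"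
    then have "f \<in> carrier ?R" by simp
    then have "g \<otimes>\<^bsub>?R\<^esub> f \<in> carrier ?R" "f \<otimes>\<^bsub>?R\<^esub> g \<in> carrier ?R" using fg(2) by (simp_all only: m_closed)
    moreover have "P u p" if gf: "(g \<otimes>\<^bsub>?R\<^esub> f) (u, p) \<noteq> 0" for u p
    proof -
      obtain i where "f (path_end B u (take i p), drop i p) \<noteq> 0" using mult[OF gf] by blast
      then have "P (path_end B u (take i p)) (drop i p)" using fg(1) by blast
      then show ?thesis by (rule P_right)
    qed
    moreover have "P u p" if gf: "(f \<otimes>\<^bsub>?R\<^esub> g) (u, p) \<noteq> 0" for u p
    proof -
      obtain i where "f (u, take i p) \<noteq> 0" using mult[OF gf] by blast
      then have "P u (take i p)" using fg(1) by blast
      then show ?thesis by (rule P_left)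
    qed
    ultimately show "g \<otimes>\<^bsub>?R\<^esub> f \<in> ?K" "f \<otimes>\<^bsub>?R\<^esub> g \<in> ?K" by blast+
  qed (rule ring_axioms)
  moreover have "basis_path ` S \<subseteq> ?K"
  proof (rule image_subsetI)
    fix y assume y: "y \<in> S"
    obtain v q where vq: "y = (v, q)" by force
    have "{x. basis_path y x \<noteq> (0::'k)} = {y}" by (auto simp: basis_path_def)
    then have "basis_path y \<in> carrier ?R" using y S by (auto simp: path_algebra_def)
    moreover have "P v q"
      unfolding P_def using y vq by (intro exI[of _ "[]"] exI[of _ q]) simp
    ultimately show "(basis_path y :: 'v \<times> 'e list \<Rightarrow> 'k) \<in> ?K" unfolding vq by (auto simp: basis_path_def)
  qed
  ultimately have "J \<subseteq> ?K" unfolding J by (rule genideal_minimal)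
  with x have "P u p" by (auto simp: basis_path_def)
  then show ?thesis by (simp add: P_def)
qed

text \<open>The generators have length two, so a path in the ideal has a forbidden pair of
  consecutive arrows.\<close>

lemma gentle_path_in_ideal:
  assumes g: "gentle_quiver B J" and p: "arrows_elem B p \<in> J"
  shows "\<exists>xs a b zs. p = xs @ [a, b] @ zs \<and> arrows_elem B [a, b] \<in> J"
proof -
  from g obtain S where S: "S \<subseteq> {(u, p) \<in> paths B. length p = 2}"
    and J: "J = Idl\<^bsub>path_algebra B\<^esub> (basis_path ` S)" and fin: "fin_digraph B"
    by (auto simp: gentle_quiver_def bound_quiver_def)
  have Sp: "S \<subseteq> paths B" using S by auto
  from in_path_ideal[OF fin Sp J p[unfolded arrows_elem_def]]
  obtain xs q zs where q: "p = xs @ q @ zs" "(path_end B (tail B (hd p)) xs, q) \<in> S" by blast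
  let ?v = "path_end B (tail B (hd p)) xs"
  have q2: "(?v, q) \<in> paths B" "length q = 2" using S q(2) by auto
  then obtain a b where ab: "q = [a, b]" by (auto simp: numeral_2_eq_2 length_Suc_conv)
  have v: "?v = tail B a" using q2(1) by (simp add: paths_iff ab pre_digraph.cas.simps)
  interpret ring "path_algebra B" using fin by (rule ring_path_algebra)
  have "basis_path ` S \<subseteq> carrier (path_algebra B)"
  proof (rule image_subsetI)
    fix y assume y: "y \<in> S"
    have "{x. basis_path y x \<noteq> 0} = {y}" by (auto simp: basis_path_def)
    then show "basis_path y \<in> carrier (path_algebra B)" using y Sp by (auto simp: path_algebra_def)
  qed
  then have "basis_path (?v, q) \<in> J" unfolding J using genideal_self q(2) by blast
  then have "arrows_elem B [a, b] \<in> J" using v ab by (simp add: arrows_elem_def)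
  then show ?thesis using q(1) ab by blast
qed

section \<open>Strings as words of consecutively composable letters\<close>

definition letters :: "('v, 'e) pre_digraph \<Rightarrow> 'e letter set" where
  "letters B = {l. fst l \<in> arcs B}"

definition composable ::
    "('v, 'e) pre_digraph \<Rightarrow> ('v \<times> 'e list \<Rightarrow> 'k::field) set \<Rightarrow> 'e letter \<Rightarrow> 'e letter \<Rightarrow> bool" where
  "composable B J l m \<longleftrightarrow> l \<in> letters B \<and> m \<in> letters B \<and> letter_target B l = letter_source B m \<and>
     m \<noteq> letter_inverse l \<and> (snd l \<and> snd m \<longrightarrow> arrows_elem B [fst l, fst m] \<notin> J) \<and>
     (\<not> snd l \<and> \<not> snd m \<longrightarrow> arrows_elem B [fst m, fst l] \<notin> J)"

lemma letter_inverse_inverse [simp]: "letter_inverse (letter_inverse l) = l"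
  by (cases l) simp

lemma snd_letter_inverse [simp]: "snd (letter_inverse l) = (\<not> snd l)"
  by (cases l) simp

lemma fst_letter_inverse [simp]: "fst (letter_inverse l) = fst l"
  by (cases l) simp

lemma letter_source_inverse [simp]: "letter_source B (letter_inverse l) = letter_target B l"
  by (cases l) simp

lemma letter_target_inverse [simp]: "letter_target B (letter_inverse l) = letter_source B l"
  by (cases l) simp

lemma letter_inverse_letters: "l \<in> letters B \<Longrightarrow> letter_inverse l \<in> letters B"
  by (simp add: letters_def)

lemma composable_inverse: "composable B J l m \<Longrightarrow> composable B J (letter_inverse m) (letter_inverse l)"
  by (auto simp: composable_def letter_inverse_letters)

lemma factors_pair: "[a, b] \<in> factors ls \<longleftrightarrow> (\<exists>i. Suc i < length ls \<and> ls ! i = a \<and> ls ! Suc i = b)"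
proof
  assume "[a, b] \<in> factors ls"
  then obtain xs zs where "ls = xs @ [a, b] @ zs" by (auto simp: factors_def)
  then show "\<exists>i. Suc i < length ls \<and> ls ! i = a \<and> ls ! Suc i = b"
    by (intro exI[of _ "length xs"]) (simp add: nth_append)
next
  assume "\<exists>i. Suc i < length ls \<and> ls ! i = a \<and> ls ! Suc i = b"
  then obtain i where i: "Suc i < length ls" "ls ! i = a" "ls ! Suc i = b" by blast
  then have "ls = take i ls @ [a, b] @ drop (Suc (Suc i)) ls"
    by (metis Cons_nth_drop_Suc Suc_lessD append_Cons append_Nil append_take_drop_id)
  then show "[a, b] \<in> factors ls" unfolding factors_def by blast
qed

lemma factors_trans: "ys = us @ vs @ ws \<Longrightarrow> ys \<in> factors ls \<Longrightarrow> vs \<in> factors ls"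
  unfolding factors_def by (auto, metis append.assoc)

text \<open>By \<open>gentle_path_in_ideal\<close>, avoiding all paths of the ideal is a condition
  on consecutive letters only.\<close>

lemma is_string_iff:
  assumes g: "gentle_quiver B J" and ne: "ls \<noteq> []"
  shows "is_string B J (u, ls) \<longleftrightarrow>
    u = letter_source B (hd ls) \<and> set ls \<subseteq> letters B \<and> successively (composable B J) ls"
proof
  assume s: "is_string B J (u, ls)"
  have s1: "fst ` set ls \<subseteq> arcs B" "letter_source B (hd ls) = u"
    and s2: "\<And>i. Suc i < length ls \<Longrightarrow> letter_target B (ls ! i) = letter_source B (ls ! Suc i)"
    and s3: "\<And>p. p \<noteq> [] \<Longrightarrow> arrows_elem B p \<in> J \<Longrightarrow> map (\<lambda>\<alpha>. (\<alpha>, True)) p \<notin> factors ls"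
    and s4: "\<And>p. p \<noteq> [] \<Longrightarrow> arrows_elem B p \<in> J \<Longrightarrow> inverse_letters (map (\<lambda>\<alpha>. (\<alpha>, True)) p) \<notin> factors ls"
    and s5: "\<And>\<alpha>. [(\<alpha>, True), (\<alpha>, False)] \<notin> factors ls" "\<And>\<alpha>. [(\<alpha>, False), (\<alpha>, True)] \<notin> factors ls"
  proof -
    have *: "fst ` set ls \<subseteq> arcs B" "ls \<noteq> [] \<longrightarrow> letter_source B (hd ls) = u"
      "\<forall>i. Suc i < length ls \<longrightarrow> letter_target B (ls ! i) = letter_source B (ls ! Suc i)"
      "\<forall>p. p \<noteq> [] \<and> arrows_elem B p \<in> J \<longrightarrow> map (\<lambda>\<alpha>. (\<alpha>, True)) p \<notin> factors ls \<and>
        inverse_letters (map (\<lambda>\<alpha>. (\<alpha>, True)) p) \<notin> factors ls"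
      "\<forall>\<alpha>. [(\<alpha>, True), (\<alpha>, False)] \<notin> factors ls \<and> [(\<alpha>, False), (\<alpha>, True)] \<notin> factors ls"
      by (insert s[unfolded is_string.simps], (elim conjE, assumption)+)
    show "fst ` set ls \<subseteq> arcs B" by (rule *(1))
    show "letter_source B (hd ls) = u" using *(2) ne by simp
    show "letter_target B (ls ! i) = letter_source B (ls ! Suc i)" if "Suc i < length ls" for i
      using *(3) that by simp
    show "map (\<lambda>\<alpha>. (\<alpha>, True)) p \<notin> factors ls" "inverse_letters (map (\<lambda>\<alpha>. (\<alpha>, True)) p) \<notin> factors ls"
      if "p \<noteq> []" "arrows_elem B p \<in> J" for p using *(4) that by simp_all
    show "[(\<alpha>, True), (\<alpha>, False)] \<notin> factors ls" "[(\<alpha>, False), (\<alpha>, True)] \<notin> factors ls" for \<alpha>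
      using *(5) by simp_all
  qed
  have set: "set ls \<subseteq> letters B" using s1(1) by (auto simp: letters_def)
  have "composable B J (ls ! i) (ls ! Suc i)" if i: "Suc i < length ls" for i
  proof -
    let ?l = "ls ! i" and ?m = "ls ! Suc i"
    have f: "[?l, ?m] \<in> factors ls" unfolding factors_pair using i by blast
    have "?m \<noteq> letter_inverse ?l"
    proof
      assume e: "?m = letter_inverse ?l"
      obtain a b where ab: "?l = (a, b)" by force
      show False using s5 f unfolding e ab by (cases b) simp_all
    qed
    moreover have "arrows_elem B [fst ?l, fst ?m] \<notin> J" if "snd ?l" "snd ?m"
    proof
      assume "arrows_elem B [fst ?l, fst ?m] \<in> J"
      then have "map (\<lambda>\<alpha>. (\<alpha>, True)) [fst ?l, fst ?m] \<notin> factors ls" by (intro s3) simp_all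
      moreover have "map (\<lambda>\<alpha>. (\<alpha>, True)) [fst ?l, fst ?m] = [?l, ?m]" using that by (simp add: prod_eq_iff)
      ultimately show False using f by simp
    qed
    moreover have "arrows_elem B [fst ?m, fst ?l] \<notin> J" if "\<not> snd ?l" "\<not> snd ?m"
    proof
      assume "arrows_elem B [fst ?m, fst ?l] \<in> J"
      then have "inverse_letters (map (\<lambda>\<alpha>. (\<alpha>, True)) [fst ?m, fst ?l]) \<notin> factors ls" by (intro s4) simp_all
      moreover have "inverse_letters (map (\<lambda>\<alpha>. (\<alpha>, True)) [fst ?m, fst ?l]) = [?l, ?m]"
        using that by (simp add: inverse_letters_def prod_eq_iff)
      ultimately show False using f by simp
    qed
    moreover have "letter_target B ?l = letter_source B ?m" using s2[OF i] .
    moreover have "?l \<in> letters B" "?m \<in> letters B"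
      using subsetD[OF set nth_mem[of i ls]] subsetD[OF set nth_mem[of "Suc i" ls]] i by simp_all
    ultimately show ?thesis by (simp add: composable_def)
  qed
  then show "u = letter_source B (hd ls) \<and> set ls \<subseteq> letters B \<and> successively (composable B J) ls"
    using s1(2) set by (simp add: successively_conv_nth)
next
  assume a: "u = letter_source B (hd ls) \<and> set ls \<subseteq> letters B \<and> successively (composable B J) ls"
  have c: "composable B J (ls ! i) (ls ! Suc i)" if "Suc i < length ls" for i
    using a that by (simp add: successively_conv_nth)
  have cf: "composable B J l m" if "[l, m] \<in> factors ls" for l m
    using that c unfolding factors_pair by blast
  interpret fin_digraph B using g by (simp add: gentle_quiver_def bound_quiver_def)
  have "hd ls \<in> letters B" using a ne by auto
  then have "u \<in> verts B" using a by (cases "hd ls") (auto simp: letters_def)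
  moreover have "map (\<lambda>\<alpha>. (\<alpha>, True)) p \<notin> factors ls \<and> inverse_letters (map (\<lambda>\<alpha>. (\<alpha>, True)) p) \<notin> factors ls"
    if p: "arrows_elem B p \<in> J" for p
  proof -
    from gentle_path_in_ideal[OF g p] obtain xs a b zs where
      q: "p = xs @ [a, b] @ zs" "arrows_elem B [a, b] \<in> J" by blast
    have "[(a, True), (b, True)] \<notin> factors ls" "[(b, False), (a, False)] \<notin> factors ls"
      using cf[of "(a, True)" "(b, True)"] cf[of "(b, False)" "(a, False)"] q(2) by (auto simp: composable_def)
    moreover have "map (\<lambda>\<alpha>. (\<alpha>, True)) p = map (\<lambda>\<alpha>. (\<alpha>, True)) xs @ [(a, True), (b, True)] @ map (\<lambda>\<alpha>. (\<alpha>, True)) zs"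
      "inverse_letters (map (\<lambda>\<alpha>. (\<alpha>, True)) p) = inverse_letters (map (\<lambda>\<alpha>. (\<alpha>, True)) zs) @ [(b, False), (a, False)]
        @ inverse_letters (map (\<lambda>\<alpha>. (\<alpha>, True)) xs)"
      by (simp_all add: q(1) inverse_letters_def)
    ultimately show ?thesis using factors_trans by metis
  qed
  moreover have "[(\<alpha>, True), (\<alpha>, False)] \<notin> factors ls \<and> [(\<alpha>, False), (\<alpha>, True)] \<notin> factors ls" for \<alpha>
    using cf[of "(\<alpha>, True)" "(\<alpha>, False)"] cf[of "(\<alpha>, False)" "(\<alpha>, True)"] by (auto simp: composable_def)
  moreover have "\<forall>i. Suc i < length ls \<longrightarrow> letter_target B (ls ! i) = letter_source B (ls ! Suc i)"
    using c by (auto simp: composable_def)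
  moreover have "fst ` set ls \<subseteq> arcs B" "ls \<noteq> [] \<longrightarrow> letter_source B (hd ls) = u" using a by (auto simp: letters_def)
  ultimately show "is_string B J (u, ls)" unfolding is_string.simps by blast
qed

lemma card_pair_split:
  assumes "x \<noteq> y" and "card {z \<in> {x, y}. P z} \<le> 1" and "card {z \<in> {x, y}. \<not> P z} \<le> 1"
  shows "P x \<longleftrightarrow> \<not> P y"
proof -
  have c: "card {x, y} = 2" using assms(1) by simp
  show ?thesis
  proof (cases "P x"; cases "P y")
    assume "P x" "P y"
    then have "{z \<in> {x, y}. P z} = {x, y}" by auto
    then show ?thesis using assms(2) c by (simp only:)
  next
    assume "\<not> P x" "\<not> P y"
    then have "{z \<in> {x, y}. \<not> P z} = {x, y}" by auto
    then show ?thesis using assms(3) c by (simp only:)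
  qed auto
qed

text \<open>With two arrows on each side, "at most one in the ideal" and "at most one outside"
  become "exactly one" of each, so the relations form a perfect matching.\<close>

lemma gentle_node:
  assumes g: "gentle_quiver B J" and i: "card {e \<in> arcs B. head B e = x} = 2" and o: "card {e \<in> arcs B. tail B e = x} = 2"
  obtains i1 i2 o1 o2 where "{e \<in> arcs B. head B e = x} = {i1, i2}" "i1 \<noteq> i2"
    "{e \<in> arcs B. tail B e = x} = {o1, o2}" "o1 \<noteq> o2"
    "arrows_elem B [i1, o1] \<notin> J" "arrows_elem B [i2, o2] \<notin> J"
    "arrows_elem B [i1, o2] \<in> J" "arrows_elem B [i2, o1] \<in> J"
proof -
  obtain i1 i2 where I: "{e \<in> arcs B. head B e = x} = {i1, i2}" "i1 \<noteq> i2" using i by (auto simp: card_2_iff)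
  obtain o1 o2 where O: "{e \<in> arcs B. tail B e = x} = {o1, o2}" "o1 \<noteq> o2" using o by (auto simp: card_2_iff)
  let ?P = "\<lambda>a b. arrows_elem B [a, b] \<in> J"
  have out: "?P a o1 \<longleftrightarrow> \<not> ?P a o2" if a: "a \<in> {i1, i2}" for a
  proof (rule card_pair_split[OF O(2)])
    have ax: "a \<in> arcs B" "head B a = x" using a I by auto
    have e: "{c \<in> arcs B. x = tail B c \<and> Q c} = {c \<in> {o1, o2}. Q c}" for Q using O by auto
    have "card {c \<in> arcs B. head B a = tail B c \<and> ?P a c} \<le> 1" "card {c \<in> arcs B. head B a = tail B c \<and> \<not> ?P a c} \<le> 1"
      using g ax(1) unfolding gentle_quiver_def by blast+
    then show "card {c \<in> {o1, o2}. ?P a c} \<le> 1" "card {c \<in> {o1, o2}. \<not> ?P a c} \<le> 1"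
      unfolding ax(2) e .
  qed
  have inn: "?P i1 b \<longleftrightarrow> \<not> ?P i2 b" if b: "b \<in> {o1, o2}" for b
  proof (rule card_pair_split[OF I(2)])
    have bx: "b \<in> arcs B" "tail B b = x" using b O by auto
    have e: "{c \<in> arcs B. head B c = x \<and> Q c} = {c \<in> {i1, i2}. Q c}" for Q using I by auto
    have "card {c \<in> arcs B. head B c = tail B b \<and> ?P c b} \<le> 1" "card {c \<in> arcs B. head B c = tail B b \<and> \<not> ?P c b} \<le> 1"
      using g bx(1) unfolding gentle_quiver_def by blast+
    then show "card {c \<in> {i1, i2}. ?P c b} \<le> 1" "card {c \<in> {i1, i2}. \<not> ?P c b} \<le> 1"
      unfolding bx(2) e .
  qed
  show ?thesis
  proof (cases "?P i1 o1")
    case True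
    then have "\<not> ?P i1 o2" "\<not> ?P i2 o1" "?P i2 o2" using out[of i1] out[of i2] inn[of o1] by simp_all
    with True show ?thesis using that[OF I, of o2 o1] O by (simp add: insert_commute)
  next
    case False
    then have "?P i1 o2" "?P i2 o1" "\<not> ?P i2 o2" using out[of i1] out[of i2] inn[of o1] by simp_all
    with False show ?thesis using that[OF I O] by simp
  qed
qed

section \<open>Walks of the blossoming quiver\<close>

locale blossoming =
  fixes Q :: "('v::finite, 'e) pre_digraph"
    and I :: "('v \<times> 'e list \<Rightarrow> 'k::field) set"
    and J :: "(('v + 'v blossom) \<times> ('e + 'v blossom) list \<Rightarrow> 'k) set"
  assumes verts_UNIV: "verts Q = UNIV" and gentle_Q: "gentle_quiver Q I" and ideal_J: "blossoming_ideal Q I J"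
begin

abbreviation B where "B \<equiv> blossoming_quiver Q"

definition vertex_of :: "('e + 'v blossom) letter \<Rightarrow> 'v" where
  "vertex_of l = (case letter_target B l of Inl v \<Rightarrow> v | Inr _ \<Rightarrow> undefined)"

lemma gentle_B: "gentle_quiver B J"
  using ideal_J by (simp add: blossoming_ideal_def)

lemma fin_Q: "fin_digraph Q"
  using gentle_Q by (simp add: gentle_quiver_def bound_quiver_def)

lemma fin_B: "fin_digraph B"
  using gentle_B by (simp add: gentle_quiver_def bound_quiver_def)

lemma degree_le: "in_degree Q v \<le> 2" "out_degree Q v \<le> 2"
  using gentle_Q verts_UNIV by (auto simp: gentle_quiver_def)

text \<open>Blossoms fill every in-degree up to two: \<open>degree_le\<close> makes the truncated
  subtraction exact, and \<open>verts_UNIV\<close> makes every \<open>Inl v\<close> a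
  vertex.\<close>

lemma card_in: "card {e \<in> arcs B. head B e = Inl v} = 2"
proof -
  interpret fin_digraph Q by (rule fin_Q)
  have "e \<in> {e \<in> arcs B. head B e = Inl v} \<longleftrightarrow>
      e \<in> Inl ` in_arcs Q v \<union> (\<lambda>n. Inr (In_Blossom v n)) ` {..<2 - in_degree Q v}" for e
    by (cases e; cases "projr e") (auto simp: blossoming_quiver_def blossoms_def verts_UNIV)
  then have e: "{e \<in> arcs B. head B e = Inl v} = Inl ` in_arcs Q v \<union> (\<lambda>n. Inr (In_Blossom v n)) ` {..<2 - in_degree Q v}"
    by blast
  have "card {e \<in> arcs B. head B e = Inl v} = in_degree Q v + (2 - in_degree Q v)"
    unfolding e by (subst card_Un_disjoint) (auto simp: card_image inj_on_def in_degree_def)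
  then show ?thesis using degree_le(1)[of v] by simp
qed

lemma card_out: "card {e \<in> arcs B. tail B e = Inl v} = 2"
proof -
  interpret fin_digraph Q by (rule fin_Q)
  have "e \<in> {e \<in> arcs B. tail B e = Inl v} \<longleftrightarrow>
      e \<in> Inl ` out_arcs Q v \<union> (\<lambda>n. Inr (Out_Blossom v n)) ` {..<2 - out_degree Q v}" for e
    by (cases e; cases "projr e") (auto simp: blossoming_quiver_def blossoms_def verts_UNIV)
  then have e: "{e \<in> arcs B. tail B e = Inl v} = Inl ` out_arcs Q v \<union> (\<lambda>n. Inr (Out_Blossom v n)) ` {..<2 - out_degree Q v}"
    by blast
  have "card {e \<in> arcs B. tail B e = Inl v} = out_degree Q v + (2 - out_degree Q v)"
    unfolding e by (subst card_Un_disjoint) (auto simp: card_image inj_on_def out_degree_def)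
  then show ?thesis using degree_le(2)[of v] by simp
qed

text \<open>The only arrow at a blossom carries its name, and the constructor decides whether it is
  incoming or outgoing; the only continuation there is to turn back.\<close>

lemma blossom_univalent:
  assumes "l \<in> letters B" "m \<in> letters B" "letter_target B l = Inr b" "letter_source B m = Inr b"
  shows "m = letter_inverse l"
proof -
  obtain e c f d where lm: "l = (e, c)" "m = (f, d)" by (cases l; cases m) auto
  have A: "g = Inr b \<and> (\<exists>v n. b = In_Blossom v n)" if "tail B g = Inr b" for g
    using that by (cases g; cases "projr g") (auto simp: blossoming_quiver_def)
  have C: "g = Inr b \<and> (\<exists>v n. b = Out_Blossom v n)" if "head B g = Inr b" for g
    using that by (cases g; cases "projr g") (auto simp: blossoming_quiver_def)
  show ?thesis
  proof (cases c; cases d)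
    assume cd: "c" "d"
    then show ?thesis using assms(3,4) C[of e] A[of f] lm by auto
  next
    assume cd: "c" "\<not> d"
    then show ?thesis using assms(3,4) C[of e] C[of f] lm by auto
  next
    assume cd: "\<not> c" "d"
    then show ?thesis using assms(3,4) A[of e] A[of f] lm by auto
  next
    assume cd: "\<not> c" "\<not> d"
    then show ?thesis using assms(3,4) A[of e] C[of f] lm by auto
  qed
qed

lemma composable_interior: "composable B J l m \<Longrightarrow> \<exists>v. letter_target B l = Inl v"
  using blossom_univalent by (metis composable_def sum.exhaust)

text \<open>Composability at a vertex is a complete bipartite graph from two arriving to two leaving
  letters, together with its inverse. If i1 o1 and i2 o2 are the nonzero compositions, then p = i1
  and q is the inverse of o2, while r = o1 and s is the inverse of i2.\<close>

lemma node:
  obtains p q r s where "snd p" "\<not> snd q" "snd r" "\<not> snd s" "p \<noteq> letter_inverse s" "q \<noteq> letter_inverse r"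
    "\<And>l. l \<in> letters B \<and> letter_target B l = Inl v \<longleftrightarrow> l \<in> {p, q, letter_inverse r, letter_inverse s}"
    "\<And>l m. composable B J l m \<and> letter_target B l = Inl v \<longleftrightarrow>
      l \<in> {p, q} \<and> m \<in> {r, s} \<or> l \<in> {letter_inverse r, letter_inverse s} \<and> m \<in> {letter_inverse p, letter_inverse q}"
proof -
  obtain i1 i2 o1 o2 where I: "{e \<in> arcs B. head B e = Inl v} = {i1, i2}" "i1 \<noteq> i2"
    and O: "{e \<in> arcs B. tail B e = Inl v} = {o1, o2}" "o1 \<noteq> o2"
    and rel: "arrows_elem B [i1, o1] \<notin> J" "arrows_elem B [i2, o2] \<notin> J"
      "arrows_elem B [i1, o2] \<in> J" "arrows_elem B [i2, o1] \<in> J"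
    by (rule gentle_node[OF gentle_B card_in card_out])
  have I': "e \<in> arcs B \<and> head B e = Inl v \<longleftrightarrow> e = i1 \<or> e = i2" for e using I(1) by blast
  have O': "e \<in> arcs B \<and> tail B e = Inl v \<longleftrightarrow> e = o1 \<or> e = o2" for e using O(1) by blast
  have T: "l \<in> letters B \<and> letter_target B l = Inl v \<longleftrightarrow> l \<in> {(i1, True), (o2, False), (o1, False), (i2, True)}" for l
  proof (cases l)
    case (Pair e c)
    then show ?thesis using I'[of e] O'[of e] by (cases c) (simp_all add: letters_def, blast+)
  qed
  have S: "m \<in> letters B \<and> letter_source B m = Inl v \<longleftrightarrow> m \<in> {(o1, True), (i2, False), (i1, False), (o2, True)}" for m
  proof (cases m)
    case (Pair e c)
    then show ?thesis using I'[of e] O'[of e] by (cases c) (simp_all add: letters_def, blast+)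
  qed
  have C: "composable B J l m \<and> letter_target B l = Inl v \<longleftrightarrow>
      l \<in> {(i1, True), (o2, False)} \<and> m \<in> {(o1, True), (i2, False)} \<or>
      l \<in> {(o1, False), (i2, True)} \<and> m \<in> {(i1, False), (o2, True)}" (is "_ \<longleftrightarrow> ?r") for l m
  proof
    assume c: "composable B J l m \<and> letter_target B l = Inl v"
    then have "l \<in> {(i1, True), (o2, False), (o1, False), (i2, True)}"
      "m \<in> {(o1, True), (i2, False), (i1, False), (o2, True)}"
      unfolding T[symmetric] S[symmetric] by (auto simp: composable_def)
    moreover have "m \<noteq> letter_inverse l" "snd l \<and> snd m \<longrightarrow> arrows_elem B [fst l, fst m] \<notin> J"
      "\<not> snd l \<and> \<not> snd m \<longrightarrow> arrows_elem B [fst m, fst l] \<notin> J"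
      using c by (simp_all add: composable_def)
    ultimately show ?r using rel by (elim insertE emptyE) simp_all
  next
    assume r: ?r
    then have lm: "l \<in> {(i1, True), (o2, False), (o1, False), (i2, True)}"
      "m \<in> {(o1, True), (i2, False), (i1, False), (o2, True)}" by blast+
    have "m \<noteq> letter_inverse l" "snd l \<and> snd m \<longrightarrow> arrows_elem B [fst l, fst m] \<notin> J"
      "\<not> snd l \<and> \<not> snd m \<longrightarrow> arrows_elem B [fst m, fst l] \<notin> J"
      using r rel I(2) O(2) by (elim disjE conjE insertE emptyE; simp)+
    then show "composable B J l m \<and> letter_target B l = Inl v"
      using lm unfolding T[symmetric] S[symmetric] by (auto simp: composable_def)
  qed
  show ?thesis
  proof (rule that[of "(i1, True)" "(o2, False)" "(o1, True)" "(i2, False)"])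
    show "l \<in> letters B \<and> letter_target B l = Inl v \<longleftrightarrow>
        l \<in> {(i1, True), (o2, False), letter_inverse (o1, True), letter_inverse (i2, False)}" for l
      unfolding T by simp
    show "composable B J l m \<and> letter_target B l = Inl v \<longleftrightarrow>
      l \<in> {(i1, True), (o2, False)} \<and> m \<in> {(o1, True), (i2, False)} \<or>
      l \<in> {letter_inverse (o1, True), letter_inverse (i2, False)} \<and>
      m \<in> {letter_inverse (i1, True), letter_inverse (o2, False)}" for l m
      unfolding C by simp
  qed (use I(2) O(2) in simp_all)
qed

text \<open>A positive word is a path; if it is long it lies in the ideal, and then two of its
  consecutive letters are not composable.\<close>

lemma positive_strings_bounded:
  "\<exists>N. \<forall>W. successively (composable B J) W \<longrightarrow> (\<forall>l\<in>set W. snd l) \<longrightarrow> length W < N"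
proof -
  from gentle_B obtain N where N: "\<forall>(u, p)\<in>paths B. N \<le> length p \<longrightarrow> basis_path (u, p) \<in> J"
    by (auto simp: gentle_quiver_def bound_quiver_def)
  interpret fin_digraph B by (rule fin_B)
  have "length W < N + 2" if W: "successively (composable B J) W" "\<forall>l\<in>set W. snd l" for W
  proof (rule ccontr)
    assume "\<not> length W < N + 2"
    then have len: "N + 2 \<le> length W" by simp
    let ?p = "map fst W"
    have c: "composable B J (W ! i) (W ! Suc i)" if "Suc i < length W" for i
      using W(1) that by (simp add: successively_conv_nth)
    have t: "head B (?p ! i) = tail B (?p ! Suc i)" if i: "Suc i < length W" for i
    proof -
      have "snd (W ! i)" "snd (W ! Suc i)" using W(2) i by auto
      then show ?thesis using c[OF i] i by (cases "W ! i"; cases "W ! Suc i") (auto simp: composable_def)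
    qed
    have mem: "?p ! i \<in> arcs B" if i: "i < length W" for i
    proof (cases "Suc i < length W")
      case True
      then show ?thesis using c[OF True] i by (simp add: composable_def letters_def)
    next
      case False
      then obtain j where "i = Suc j" using len i by (cases i) auto
      then show ?thesis using c[of j] i by (simp add: composable_def letters_def)
    qed
    have sub: "set ?p \<subseteq> arcs B" using mem by (metis in_set_conv_nth length_map subsetI)
    have ne: "?p \<noteq> []" using len by auto
    have cas_path: "cas (tail B (hd p)) p (path_end B (tail B (hd p)) p)"
      if "p \<noteq> []" "\<And>i. Suc i < length p \<Longrightarrow> head B (p ! i) = tail B (p ! Suc i)" for p
      using that
    proof (induction p)
      case (Cons e p)
      show ?case
      proof (cases p)
        case Nil
        then show ?thesis by simp
      next
        case (Cons f p')
        have "head B (p ! i) = tail B (p ! Suc i)" if "Suc i < length p" for i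
          using Cons.prems(2)[of "Suc i"] that by simp
        then have "cas (tail B (hd p)) p (path_end B (tail B (hd p)) p)" using Cons.IH Cons by blast
        moreover have "head B e = tail B (hd p)" using Cons.prems(2)[of 0] Cons by simp
        ultimately show ?thesis by simp
      qed
    qed simp
    have "cas (tail B (hd ?p)) ?p (path_end B (tail B (hd ?p)) ?p)"
      by (rule cas_path[OF ne]) (rule t, simp)
    moreover have "tail B (hd ?p) \<in> verts B" using sub ne by (cases W) auto
    ultimately have "(tail B (hd ?p), ?p) \<in> paths B" using sub by (simp add: paths_iff)
    then have "arrows_elem B ?p \<in> J" using N len by (auto simp: arrows_elem_def)
    from gentle_path_in_ideal[OF gentle_B this] obtain xs a b zs where
      q: "?p = xs @ [a, b] @ zs" "arrows_elem B [a, b] \<in> J" by blast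
    have i: "Suc (length xs) < length W" using arg_cong[OF q(1), of length] by simp
    have "fst (W ! length xs) = a" "fst (W ! Suc (length xs)) = b"
      using arg_cong[OF q(1), of "\<lambda>p. p ! length xs"] arg_cong[OF q(1), of "\<lambda>p. p ! Suc (length xs)"] i
      by (simp_all add: nth_append)
    moreover have "snd (W ! length xs)" "snd (W ! Suc (length xs))" using W(2) i by auto
    ultimately show False using c[OF i] q(2) by (simp add: composable_def)
  qed
  then show ?thesis by blast
qed

text \<open>Uniqueness, the opposite sign and the square property are finite checks in the picture
  of \<open>node\<close>.\<close>

sublocale gentle_track "letters B" letter_inverse snd "composable B J" vertex_of
proof
  interpret fin_digraph B by (rule fin_B)
  have "letters B = arcs B \<times> UNIV" by (auto simp: letters_def)
  then show "finite (letters B)" by simp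
next
  fix l m assume c: "composable B J l m"
  then obtain v where v: "letter_target B l = Inl v" using composable_interior by blast
  obtain p q r s where n: "snd p" "\<not> snd q" "snd r" "\<not> snd s"
    "\<And>l m. composable B J l m \<and> letter_target B l = Inl v \<longleftrightarrow>
      l \<in> {p, q} \<and> m \<in> {r, s} \<or> l \<in> {letter_inverse r, letter_inverse s} \<and> m \<in> {letter_inverse p, letter_inverse q}"
    by (rule node[of v]) (rule that, assumption+)
  show "\<exists>m'. composable B J l m' \<and> snd m' = (\<not> snd m)"
  proof (cases "l \<in> {p, q}")
    case True
    then have "composable B J l r" "composable B J l s" using n(5) by blast+
    then show ?thesis using n(3,4) by (cases "snd m") blast+
  next
    case False
    then have "composable B J l (letter_inverse p)" "composable B J l (letter_inverse q)"
      using n(5) c v by blast+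
    moreover have "\<not> snd (letter_inverse p)" "snd (letter_inverse q)" using n(1,2) by simp_all
    ultimately show ?thesis by (cases "snd m") blast+
  qed
next
  fix l m m' assume c: "composable B J l m" "composable B J l m'" "snd m = snd m'"
  then obtain v where v: "letter_target B l = Inl v" using composable_interior by blast
  obtain p q r s where n: "snd p" "\<not> snd q" "snd r" "\<not> snd s" "p \<noteq> letter_inverse s" "q \<noteq> letter_inverse r"
    "\<And>l m. composable B J l m \<and> letter_target B l = Inl v \<longleftrightarrow>
      l \<in> {p, q} \<and> m \<in> {r, s} \<or> l \<in> {letter_inverse r, letter_inverse s} \<and> m \<in> {letter_inverse p, letter_inverse q}"
    by (rule node[of v]) (rule that, assumption+)
  have "snd (letter_inverse s)" "\<not> snd (letter_inverse r)" "\<not> snd (letter_inverse p)" "snd (letter_inverse q)"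
    using n(1-4) by simp_all
  moreover have "l \<in> {p, q} \<and> m \<in> {r, s} \<or> l \<in> {letter_inverse r, letter_inverse s} \<and> m \<in> {letter_inverse p, letter_inverse q}"
    "l \<in> {p, q} \<and> m' \<in> {r, s} \<or> l \<in> {letter_inverse r, letter_inverse s} \<and> m' \<in> {letter_inverse p, letter_inverse q}"
    using n(7) c v by blast+
  ultimately show "m = m'" using n(1-6) c(3) by auto
next
  fix l m l' m' assume c: "composable B J l m" "composable B J l' m" "composable B J l m'"
  then obtain v where v: "letter_target B l = Inl v" using composable_interior by blast
  then have v': "letter_target B l' = Inl v" using c by (simp add: composable_def)
  obtain p q r s where n: "snd p" "\<not> snd q" "snd r" "\<not> snd s" "p \<noteq> letter_inverse s" "q \<noteq> letter_inverse r"
    "\<And>l m. composable B J l m \<and> letter_target B l = Inl v \<longleftrightarrow>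
      l \<in> {p, q} \<and> m \<in> {r, s} \<or> l \<in> {letter_inverse r, letter_inverse s} \<and> m \<in> {letter_inverse p, letter_inverse q}"
    by (rule node[of v]) (rule that, assumption+)
  have d: "p \<noteq> q" "r \<noteq> s" "p \<noteq> letter_inverse r" "q \<noteq> letter_inverse s"
    using n(1-4) snd_letter_inverse by metis+
  have "{p, q} \<inter> {letter_inverse r, letter_inverse s} = {}" using n(5,6) d by auto
  moreover have "{r, s} \<inter> {letter_inverse p, letter_inverse q} = {}"
    using n(5,6) d letter_inverse_inverse by (auto dest: arg_cong[of _ _ letter_inverse])
  moreover have "l \<in> {p, q} \<and> m \<in> {r, s} \<or> l \<in> {letter_inverse r, letter_inverse s} \<and> m \<in> {letter_inverse p, letter_inverse q}"
    "l' \<in> {p, q} \<and> m \<in> {r, s} \<or> l' \<in> {letter_inverse r, letter_inverse s} \<and> m \<in> {letter_inverse p, letter_inverse q}"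
    "l \<in> {p, q} \<and> m' \<in> {r, s} \<or> l \<in> {letter_inverse r, letter_inverse s} \<and> m' \<in> {letter_inverse p, letter_inverse q}"
    using n(7) c v v' by blast+
  ultimately have "l' \<in> {p, q} \<and> m' \<in> {r, s} \<or> l' \<in> {letter_inverse r, letter_inverse s} \<and> m' \<in> {letter_inverse p, letter_inverse q}"
    by blast
  then show "composable B J l' m'" using n(7) by blast
next
  fix l m l' m' assume c: "composable B J l m" "composable B J l' m'" "vertex_of l = vertex_of l'"
  then obtain v v' where v: "letter_target B l = Inl v" "letter_target B l' = Inl v'" using composable_interior by blast
  then have v': "letter_target B l' = Inl v" using c(3) by (simp add: vertex_of_def)
  obtain p q r s where n: "snd p"
    "\<And>l. l \<in> letters B \<and> letter_target B l = Inl v \<longleftrightarrow> l \<in> {p, q, letter_inverse r, letter_inverse s}"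
    "\<And>l m. composable B J l m \<and> letter_target B l = Inl v \<longleftrightarrow>
      l \<in> {p, q} \<and> m \<in> {r, s} \<or> l \<in> {letter_inverse r, letter_inverse s} \<and> m \<in> {letter_inverse p, letter_inverse q}"
    by (rule node[of v]) (rule that, assumption+)
  have l': "l' \<in> {p, q} \<or> l' \<in> {letter_inverse r, letter_inverse s}"
    using n(2)[of l'] c(2) v' by (auto simp: composable_def)
  from n(3)[of l m] c(1) v(1) consider "l \<in> {p, q}" "m \<in> {r, s}"
    | "l \<in> {letter_inverse r, letter_inverse s}" "m \<in> {letter_inverse p, letter_inverse q}" by blast
  then show "composable B J l' m \<or> (\<exists>n. composable B J l n \<and> l' = letter_inverse n)"
  proof cases
    case 1
    show ?thesis
    proof (cases "l' \<in> {p, q}")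
      case True
      then show ?thesis using 1 n(3) by blast
    next
      case False
      then obtain k where "k \<in> {r, s}" "l' = letter_inverse k" using l' by blast
      then show ?thesis using 1 n(3) by blast
    qed
  next
    case 2
    show ?thesis
    proof (cases "l' \<in> {p, q}")
      case True
      then have "letter_inverse l' \<in> {letter_inverse p, letter_inverse q}" by blast
      then have "composable B J l (letter_inverse l')" using 2 n(3) by blast
      then show ?thesis using letter_inverse_inverse by metis
    next
      case False
      then show ?thesis using l' 2 n(3) by blast
    qed
  qed
next
  fix a
  obtain p q r s where n: "snd p"
    "\<And>l m. composable B J l m \<and> letter_target B l = Inl a \<longleftrightarrow>
      l \<in> {p, q} \<and> m \<in> {r, s} \<or> l \<in> {letter_inverse r, letter_inverse s} \<and> m \<in> {letter_inverse p, letter_inverse q}"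
    by (rule node[of a]) (rule that, assumption+)
  then have "composable B J p r" "letter_target B p = Inl a" by blast+
  then show "\<exists>l m. vertex_of l = a \<and> composable B J l m" by (intro exI[of _ p] exI[of _ r]) (simp add: vertex_of_def)
next
  show "\<exists>N. \<forall>W. successively (composable B J) W \<longrightarrow> (\<forall>l\<in>set W. snd l) \<longrightarrow> length W < N"
    by (rule positive_strings_bounded)
qed (auto simp: composable_inverse letter_inverse_letters composable_def vertex_of_def)

declare is_string.simps [simp del]

section \<open>Walks, kisses and g-vectors in terms of words\<close>

definition word_of where "word_of W = (letter_source B (hd W), W)"

definition walk_of where "walk_of W = {word_of W, word_of (inw W)}"

lemma inverse_letters_inw: "inverse_letters W = inw W"
  by (simp add: inverse_letters_def inw_def)

lemma is_string_chain:
  assumes "ls \<noteq> []" shows "is_string B J (u, ls) \<longleftrightarrow> chain ls \<and> u = letter_source B (hd ls)"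
  using is_string_iff[OF gentle_B assms] assms by (auto simp: chain_def)

lemma word_of_inj: "word_of W = word_of V \<longleftrightarrow> W = V" by (auto simp: word_of_def)

lemma word_inverse_word_of: "W \<noteq> [] \<Longrightarrow> word_inverse B (word_of W) = word_of (inw W)"
  by (simp add: word_of_def inverse_letters_inw hd_inw)

text \<open>This excludes strings of length zero from being maximal.\<close>

lemma extendable_vertex:
  assumes "u \<in> verts B" shows "\<exists>l \<in> letters B. letter_source B l = u"
proof (cases u)
  case (Inl v)
  have "{e \<in> arcs B. tail B e = Inl v} \<noteq> {}" using card_out[of v] by (metis card.empty zero_neq_numeral)
  then obtain e where "e \<in> arcs B" "tail B e = Inl v" by blast
  then show ?thesis using Inl by (intro bexI[of _ "(e, True)"]) (auto simp: letters_def)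
next
  case (Inr b)
  then have b: "b \<in> blossoms Q" using assms by (auto simp: blossoming_quiver_def)
  show ?thesis
  proof (cases b)
    case (In_Blossom v n)
    then show ?thesis using Inr b
      by (intro bexI[of _ "(Inr b, True)"]) (auto simp: letters_def blossoming_quiver_def)
  next
    case (Out_Blossom v n)
    then show ?thesis using Inr b
      by (intro bexI[of _ "(Inr b, False)"]) (auto simp: letters_def blossoming_quiver_def)
  qed
qed

lemma maximal_string_iff: "maximal_string B J w \<longleftrightarrow> (\<exists>W. walk W \<and> w = word_of W)"
proof
  assume m: "maximal_string B J w"
  obtain u ls where w: "w = (u, ls)" by force
  have s: "is_string B J (u, ls)" and mx: "\<And>w'. is_string B J w' \<Longrightarrow> factor_word B (u, ls) w' \<Longrightarrow> w' = (u, ls)"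
    using m w unfolding maximal_string_def by blast+
  have ne: "ls \<noteq> []"
  proof
    assume e: "ls = []"
    then have "u \<in> verts B" using s by (simp add: is_string.simps)
    then obtain l where l: "l \<in> letters B" "letter_source B l = u" using extendable_vertex by blast
    have "is_string B J (u, [l])" using is_string_chain[of "[l]" u] l by (simp add: chain_single)
    moreover have "factor_word B (u, ls) (u, [l])" using e by (auto intro!: exI[of _ "[]"])
    ultimately have "(u, [l]) = (u, ls)" by (rule mx)
    then show False using e by simp
  qed
  have c: "chain ls" "u = letter_source B (hd ls)" using s is_string_chain[OF ne] by auto
  have "terminal (last ls)"
  proof (rule ccontr)
    assume "\<not> terminal (last ls)"
    then obtain l where "composable B J (last ls) l" by (auto simp: terminal_def)
    then have "is_string B J (u, ls @ [l])" using is_string_chain[of "ls @ [l]" u] c ne by (simp add: chain_snoc)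
    moreover have "factor_word B (u, ls) (u, ls @ [l])" by (auto intro!: exI[of _ "[]"])
    ultimately have "(u, ls @ [l]) = (u, ls)" by (rule mx)
    then show False by simp
  qed
  moreover have "terminal (letter_inverse (hd ls))"
  proof (rule ccontr)
    assume "\<not> terminal (letter_inverse (hd ls))"
    then obtain l where l: "composable B J l (hd ls)" using terminal_pred by blast
    then have "is_string B J (letter_source B l, l # ls)" using is_string_chain[of "l # ls"] c ne by (simp add: chain_Cons)
    moreover have "letter_target B l = u" using l c by (simp add: composable_def)
    then have "factor_word B (u, ls) (letter_source B l, l # ls)"
      unfolding factor_word.simps by (intro exI[where x = "[l]"] exI[where x = "[]"] conjI) simp_all
    ultimately have "(letter_source B l, l # ls) = (u, ls)" by (rule mx)
    then show False by simp
  qed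
  ultimately show "\<exists>W. walk W \<and> w = word_of W" using c w by (auto simp: walk_def word_of_def)
next
  assume "\<exists>W. walk W \<and> w = word_of W"
  then obtain W where W: "walk W" "w = word_of W" by blast
  then have ne: "W \<noteq> []" and ch: "chain W" by (auto simp: walk_def chain_def)
  have "w' = word_of W" if w': "is_string B J w'" "factor_word B (word_of W) w'" for w'
  proof -
    obtain u' ls where e: "w' = (u', ls)" by force
    from w'(2) obtain xs zs where f: "ls = xs @ W @ zs" by (auto simp: e word_of_def)
    have c: "chain ls" "u' = letter_source B (hd ls)" using is_string_chain[of ls u'] w'(1) e f ne by auto
    have "zs = []"
    proof (rule ccontr)
      assume z: "zs \<noteq> []"
      then have "composable B J (last W) (hd zs)" using c(1) f ne by (auto simp: chain_def successively_append_iff)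
      then show False using W(1) unfolding walk_def terminal_def by blast
    qed
    moreover have "xs = []"
    proof (rule ccontr)
      assume z: "xs \<noteq> []"
      then have "composable B J (last xs) (hd W)" using c(1) f ne by (auto simp: chain_def successively_append_iff)
      then show False using W(1) terminal_pred unfolding walk_def by blast
    qed
    ultimately show ?thesis using e f c by (simp add: word_of_def)
  qed
  moreover have "is_string B J (word_of W)" using is_string_chain[OF ne] ch by (simp add: word_of_def)
  ultimately show "maximal_string B J w" using W(2) by (simp add: maximal_string_def)
qed

lemma walks_eq: "walks B J = walk_of ` {W. walk W}"
proof -
  have "undirected B (word_of W) = walk_of W" if "walk W" for W
    using that word_inverse_word_of[of W] by (auto simp: undirected_def walk_of_def walk_def chain_def)
  then show ?thesis unfolding walks_def maximal_string_iff by (force simp: image_iff)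
qed

lemma walk_of_inw [simp]: "walk_of (inw W) = walk_of W" by (auto simp: walk_of_def)

lemma walk_of_eq: "walk_of W = walk_of V \<longleftrightarrow> V = W \<or> V = inw W"
proof -
  have "V = W \<or> V = inw W" if "walk_of W = walk_of V"
  proof -
    have "word_of V \<in> walk_of W" using that by (simp add: walk_of_def)
    then show ?thesis by (auto simp: walk_of_def word_of_inj)
  qed
  then show ?thesis by auto
qed

lemma mem_walk_of: "(u, L) \<in> walk_of W \<longleftrightarrow> L \<in> {W, inw W} \<and> u = letter_source B (hd L)"
  by (auto simp: walk_of_def word_of_def)

lemma kisses_if_kiss:
  assumes W: "walk W" and V: "walk V" and k: "kiss W V"
  shows "kisses B (walk_of W) (walk_of V)"
proof -
  from k obtain xs x s y zs xs' x' y' zs' where e: "W = xs @ [x] @ s @ [y] @ zs" "V = xs' @ [x'] @ s @ [y'] @ zs'"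
    and sg: "\<not> snd x" "snd y" "snd x'" "\<not> snd y'" and r: "composable B J x (hd (s @ [y']))"
    unfolding kiss_factor by blast
  obtain \<alpha> \<beta> \<alpha>' \<beta>' where l: "x = (\<alpha>, False)" "y = (\<beta>, True)" "x' = (\<alpha>', True)" "y' = (\<beta>', False)"
    using sg by (cases x; cases y; cases x'; cases y') auto
  have "successively (composable B J) ([x'] @ (s @ [y']) @ zs')"
    using V e by (auto simp: walk_def chain_def successively_append_iff)
  then have "composable B J x' (hd (s @ [y']))" by (cases s) (simp_all add: successively_append_iff)
  then have t: "letter_target B x = letter_target B x'" using r by (simp add: composable_def)
  have "undirected B (letter_target B x, s) \<in> top_strings B (walk_of W)"
    unfolding top_strings_def using e l mem_walk_of[of _ W W] by blast
  moreover have "undirected B (letter_target B x', s) \<in> bottom_strings B (walk_of V)"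
    unfolding bottom_strings_def using e l mem_walk_of[of _ V V] by blast
  ultimately show ?thesis using t unfolding kisses_def by auto
qed

text \<open>Top and bottom strings are undirected, so the common string may be traversed by
  \<open>W\<close> and \<open>V\<close> in opposite directions; then \<open>V\<close> has to be
  inverted.\<close>

lemma kiss_if_kisses:
  assumes W: "walk W" and V: "walk V" and k: "kisses B (walk_of W) (walk_of V)"
  shows "kiss W V \<or> kiss W (inw V)"
proof -
  from k obtain t where t: "t \<in> top_strings B (walk_of W)" "t \<in> bottom_strings B (walk_of V)" by (auto simp: kisses_def)
  from t(1) obtain u xs \<alpha> s \<beta> zs where T: "t = undirected B (letter_target B (\<alpha>, False), s)"
    "(u, xs @ [(\<alpha>, False)] @ s @ [(\<beta>, True)] @ zs) \<in> walk_of W" unfolding top_strings_def by blast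
  from t(2) obtain u' xs' \<alpha>' s' \<beta>' zs' where T': "t = undirected B (letter_target B (\<alpha>', True), s')"
    "(u', xs' @ [(\<alpha>', True)] @ s' @ [(\<beta>', False)] @ zs') \<in> walk_of V" unfolding bottom_strings_def by blast
  define x y x' y' where "x = (\<alpha>, False)" "y = (\<beta>, True)" "x' = (\<alpha>', True)" "y' = (\<beta>', False)"
  note l = this
  define W1 where "W1 = xs @ [x] @ s @ [y] @ zs"
  define V1 where "V1 = xs' @ [x'] @ s' @ [y'] @ zs'"
  have W1: "W1 \<in> {W, inw W}" and V1: "V1 \<in> {V, inw V}"
    using T(2) T'(2) unfolding mem_walk_of W1_def V1_def l by blast+
  have c1: "chain W1" "chain V1" using W1 V1 W V by (auto simp: walk_def)
  have sg: "\<not> snd x" "snd y" "snd x'" "\<not> snd y'" by (simp_all add: l)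
  have inV: "inw V1 = inw zs' @ [letter_inverse y'] @ inw s' @ [letter_inverse x'] @ inw xs'"
    by (simp add: V1_def inw_append inw_Cons)
  have chW: "composable B J x (hd (s @ [y]))"
    using c1(1) by (cases s) (auto simp: W1_def chain_def successively_append_iff)
  have chV: "composable B J x' (hd (s' @ [y']))"
    using c1(2) by (cases s') (auto simp: V1_def chain_def successively_append_iff)
  have "kiss W1 V1 \<or> kiss W1 (inw V1)"
  proof (cases "s = [] \<or> s' = []")
    case True
    have eq: "undirected B (letter_target B x, s) = undirected B (letter_target B x', s')"
      using T(1) T'(1) l by simp
    then have len: "length s = length s'"
      by (auto simp: undirected_def inverse_letters_inw doubleton_eq_iff)
    then have ss: "s = []" "s' = []" using True by auto
    then have tt: "letter_target B x = letter_target B x'"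
      using eq by (auto simp: undirected_def inverse_letters_inw doubleton_eq_iff)
    then have "vertex_of x' = vertex_of x" by (simp add: vertex_of_def)
    \<comment> \<open>An empty common string has no direction. Here \<open>vt_cases\<close> tells
      whether \<open>x\<close> arrives on the same side of the vertex as \<open>x'\<close> or on the
      opposite one, and so which orientation of \<open>V\<close> is kissed.\<close>
    from vt_cases[of x' y' x y] this chV chW ss consider "composable B J x y'" | n where "composable B J x' n" "x = letter_inverse n"
      by auto
    then show ?thesis
    proof cases
      case 1
      then have "kiss W1 V1" unfolding kiss_factor
        using W1_def V1_def sg ss by (metis append_Nil list.sel(1))
      then show ?thesis ..
    next
      case 2
      then have "composable B J x (letter_inverse x')" using R_iv by blast
      moreover have "inw V1 = inw zs' @ [letter_inverse y'] @ [] @ [letter_inverse x'] @ inw xs'" using inV ss by simp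
      moreover have "W1 = xs @ [x] @ [] @ [y] @ zs" using W1_def ss by simp
      ultimately have "kiss W1 (inw V1)" unfolding kiss_factor using sg
        by (metis append_Nil list.sel(1) snd_letter_inverse)
      then show ?thesis ..
    qed
  next
    case False
    then have ne: "s \<noteq> []" "s' \<noteq> []" by auto
    have hx: "composable B J x (hd s)" using chW ne by simp
    have "(letter_target B x, s) \<in> undirected B (letter_target B x', s')"
      using T(1) T'(1) l by (auto simp: undirected_def)
    then have "s = s' \<or> s = inw s'" by (auto simp: undirected_def inverse_letters_inw)
    then show ?thesis
    proof
      assume ss: "s = s'"
      have "kiss W1 V1" unfolding kiss_factor
        using W1_def V1_def[folded ss] sg hx ne by (metis hd_append2)
      then show ?thesis ..
    next
      assume ss: "s = inw s'"
      have "kiss W1 (inw V1)" unfolding kiss_factor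
        using W1_def inV[folded ss] sg hx ne by (metis hd_append2 snd_letter_inverse)
      then show ?thesis ..
    qed
  qed
  moreover have "chain W" "chain V" using W V walk_chain by auto
  ultimately show ?thesis using W1 V1 kiss_inw[of W V] kiss_inw[of W "inw V"] by auto
qed

lemma kisses_iff: "walk W \<Longrightarrow> walk V \<Longrightarrow> kisses B (walk_of W) (walk_of V) \<longleftrightarrow> kiss W V \<or> kiss W (inw V)"
  using kisses_if_kiss[of W V] kisses_if_kiss[of W "inw V"] kiss_if_kisses[of W V] by auto

lemma straight_iff: assumes W: "walk W" shows "straight B (walk_of W) \<longleftrightarrow> \<not> mixed W"
proof
  assume s: "straight B (walk_of W)"
  show "\<not> mixed W"
  proof
    assume "mixed W"
    then obtain i where i: "Suc i < length W" "snd (W ! i) \<noteq> snd (W ! Suc i)" using mixed_turn by blast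
    have "word_of W \<in> walk_of W" by (simp add: walk_of_def)
    then have "peaks_at B (word_of W) v = {}" "deeps_at B (word_of W) v = {}" for v
      using s unfolding straight_def by blast+
    then have "i \<notin> peaks_at B (word_of W) (letter_target B (W ! i))" "i \<notin> deeps_at B (word_of W) (letter_target B (W ! i))"
      by blast+
    then show False using i by (auto simp: word_of_def)
  qed
next
  assume n: "\<not> mixed W"
  have "peaks_at B w v = {} \<and> deeps_at B w v = {}" if "w \<in> walk_of W" for w v
  proof -
    from that obtain V where V: "w = word_of V" "V = W \<or> V = inw W" by (auto simp: walk_of_def)
    then have "\<not> mixed V" using n by auto
    then have "snd (V ! i) = snd (V ! Suc i)" if "Suc i < length V" for i
      using that nth_mem[of i V] nth_mem[of "Suc i" V] Suc_lessD unfolding mixed_def by blast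
    then show ?thesis using V(1) by (auto simp: word_of_def)
  qed
  then show "straight B (walk_of W)" unfolding straight_def by blast
qed

lemma proper_walks_eq:
  "proper_walks B J = walk_of ` {W. walk W \<and> mixed W \<and> \<not> kiss W W \<and> \<not> kiss W (inw W)}"
  unfolding proper_walks_def walks_eq using straight_iff kisses_iff by (auto simp: image_iff)

lemma word_g_vector_word_of:
  assumes W: "walk W" shows "word_g_vector Q (word_of W) $ v = real_of_int (gvec W v)"
proof -
  have "letter_target B (W ! i) = Inl v \<longleftrightarrow> vertex_of (W ! i) = v" if "Suc i < length W" for i
    using composable_interior[OF chain_nth[OF walk_chain[OF W] that]] by (auto simp: vertex_of_def)
  then have "peaks_at B (word_of W) (Inl v) = peaks W v" "deeps_at B (word_of W) (Inl v) = deeps W v"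
    by (auto simp: word_of_def peaks_def deeps_def)
  then show ?thesis by (simp add: word_g_vector_def gvec_def)
qed

lemma g_vector_walk_of:
  assumes W: "walk W" shows "g_vector Q (walk_of W) $ v = real_of_int (gvec W v)"
proof -
  have "word_g_vector Q (word_of (inw W)) = word_g_vector Q (word_of W)"
    using W by (simp add: vec_eq_iff word_g_vector_word_of gvec_inw walk_chain)
  then have "word_g_vector Q ` walk_of W = {word_g_vector Q (word_of W)}" by (simp add: walk_of_def)
  then show ?thesis using word_g_vector_word_of[OF W] by (simp add: g_vector_def)
qed

end

section \<open>The non-kissing fan\<close>

lemma convex_cone_hull_finite_subset:
  assumes "finite R"
  shows "convex_cone hull R \<subseteq> {\<Sum>r\<in>R. a r *\<^sub>R r | a. \<forall>r\<in>R. 0 \<le> a r}"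
proof (rule hull_minimal)
  show "R \<subseteq> {\<Sum>r\<in>R. a r *\<^sub>R r | a. \<forall>r\<in>R. 0 \<le> a r}"
  proof
    fix s assume s: "s \<in> R"
    have "s = (\<Sum>r\<in>R. (if r = s then 1 else 0) *\<^sub>R r)"
      using assms s by (simp add: if_distrib[of "\<lambda>c. c *\<^sub>R _"] cong: if_cong)
    then show "s \<in> {\<Sum>r\<in>R. a r *\<^sub>R r | a. \<forall>r\<in>R. 0 \<le> a r}"
      by (intro CollectI exI[of _ "\<lambda>r. if r = s then 1 else 0"]) simp
  qed
  show "convex_cone {\<Sum>r\<in>R. a r *\<^sub>R r | a. \<forall>r\<in>R. 0 \<le> a r}"
    unfolding convex_cone_iff
  proof (intro conjI ballI allI impI)
    show "0 \<in> {\<Sum>r\<in>R. a r *\<^sub>R r | a. \<forall>r\<in>R. 0 \<le> a r}" by (intro CollectI exI[of _ "\<lambda>_. 0"]) simp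
  next
    fix x y assume "x \<in> {\<Sum>r\<in>R. a r *\<^sub>R r | a. \<forall>r\<in>R. 0 \<le> a r}" "y \<in> {\<Sum>r\<in>R. a r *\<^sub>R r | a. \<forall>r\<in>R. 0 \<le> a r}"
    then obtain a b where "x = (\<Sum>r\<in>R. a r *\<^sub>R r)" "y = (\<Sum>r\<in>R. b r *\<^sub>R r)" "\<forall>r\<in>R. 0 \<le> a r" "\<forall>r\<in>R. 0 \<le> b r"
      by blast
    then show "x + y \<in> {\<Sum>r\<in>R. a r *\<^sub>R r | a. \<forall>r\<in>R. 0 \<le> a r}"
      by (intro CollectI exI[of _ "\<lambda>r. a r + b r"]) (simp add: scaleR_add_left sum.distrib)
  next
    fix x and c :: real assume "x \<in> {\<Sum>r\<in>R. a r *\<^sub>R r | a. \<forall>r\<in>R. 0 \<le> a r}" "0 \<le> c"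
    then obtain a where "x = (\<Sum>r\<in>R. a r *\<^sub>R r)" "\<forall>r\<in>R. 0 \<le> a r" by blast
    with \<open>0 \<le> c\<close> show "c *\<^sub>R x \<in> {\<Sum>r\<in>R. a r *\<^sub>R r | a. \<forall>r\<in>R. 0 \<le> a r}"
      by (intro CollectI exI[of _ "\<lambda>r. c * a r"]) (simp add: scaleR_sum_right)
  qed
qed

locale finite_blossoming = blossoming Q I J
  for Q :: "('v::finite, 'e) pre_digraph" and I :: "('v \<times> 'e list \<Rightarrow> 'k::field) set"
    and J :: "(('v + 'v blossom) \<times> ('e + 'v blossom) list \<Rightarrow> 'k) set" +
  assumes finite_complex: "non_kissing_finite Q J"
begin

abbreviation faces where "faces \<equiv> non_kissing_complex B J"
abbreviation g where "g \<equiv> g_vector Q"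

section \<open>Faces and families of words\<close>

definition words_of where "words_of F = {W. walk W \<and> walk_of W \<in> F}"

lemma face_subset: "F \<in> faces \<Longrightarrow> G \<subseteq> F \<Longrightarrow> G \<in> faces"
  unfolding non_kissing_complex_def by blast

text \<open>All subsets of a face are faces, so an infinite face would make the complex
  infinite.\<close>

lemma face_finite: assumes "F \<in> faces" shows "finite F"
proof -
  have "Pow F \<subseteq> faces" using face_subset[OF assms] by blast
  then have "finite (Pow F)" using finite_complex finite_subset unfolding non_kissing_finite_def by blast
  then show ?thesis by simp
qed

lemma face_proper: "F \<in> faces \<Longrightarrow> F \<subseteq> proper_walks B J"
  unfolding non_kissing_complex_def by blast

lemma proper_walkE:
  assumes "\<omega> \<in> proper_walks B J"
  obtains W where "walk W" "mixed W" "\<not> kiss W W" "\<not> kiss W (inw W)" "\<omega> = walk_of W"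
  using assms unfolding proper_walks_eq by blast

lemma fibre_words_of: assumes "walk V" "walk_of V \<in> F" shows "{W \<in> words_of F. walk_of W = walk_of V} = {V, inw V}"
  using assms unfolding words_of_def by (auto simp: walk_of_eq)

lemma finite_words_of: assumes "F \<in> faces" shows "finite (words_of F)"
proof -
  have "words_of F \<subseteq> snd ` \<Union>F" unfolding words_of_def walk_of_def word_of_def by force
  moreover have "finite (\<Union>F)"
  proof (rule finite_Union[OF face_finite[OF assms]])
    fix \<omega> assume "\<omega> \<in> F"
    then have "\<omega> \<in> proper_walks B J" using face_proper[OF assms] by blast
    then obtain W where "\<omega> = walk_of W" by (rule proper_walkE)
    then show "finite \<omega>" by (simp add: walk_of_def)
  qed
  ultimately show ?thesis by (meson finite_imageI finite_subset)
qed

lemma words_of_properties: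
  assumes F: "F \<in> faces" and W: "W \<in> words_of F"
  shows "walk W" "mixed W" "inw W \<in> words_of F"
proof -
  show w: "walk W" using W by (simp add: words_of_def)
  show "inw W \<in> words_of F" using W by (simp add: words_of_def)
  have "walk_of W \<in> proper_walks B J" using W face_proper[OF F] by (auto simp: words_of_def)
  then obtain V where "mixed V" "walk_of W = walk_of V" by (rule proper_walkE)
  then show "mixed W" by (auto simp: walk_of_eq)
qed

lemma family_words_of: assumes F: "F \<in> faces" shows "family (words_of F)"
  unfolding family_def
proof (intro conjI ballI)
  fix W V assume WV: "W \<in> words_of F" "V \<in> words_of F"
  then have "\<not> kissing B (walk_of W) (walk_of V)" using F unfolding non_kissing_complex_def words_of_def by blast
  then show "\<not> kiss W V" using kisses_iff[of W V] WV unfolding words_of_def kissing_def by blast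
qed (use finite_words_of[OF F] words_of_properties[OF F] in blast)+

lemma sum_words_of:
  assumes F: "F \<in> faces" shows "(\<Sum>W\<in>words_of F. h (walk_of W)) = 2 * (\<Sum>\<omega>\<in>F. h \<omega> :: real)"
proof -
  have "(\<Sum>W\<in>words_of F. h (walk_of W)) = (\<Sum>\<omega>\<in>F. \<Sum>W\<in>{W \<in> words_of F. walk_of W = \<omega>}. h (walk_of W))"
    by (rule sum.group[symmetric, OF finite_words_of[OF F] face_finite[OF F]]) (auto simp: words_of_def)
  also have "\<dots> = (\<Sum>\<omega>\<in>F. 2 * h \<omega>)"
  proof (rule sum.cong[OF refl])
    fix \<omega> assume w: "\<omega> \<in> F"
    then have "\<omega> \<in> proper_walks B J" using face_proper[OF F] by blast
    then obtain V where V: "walk V" "\<omega> = walk_of V" by (rule proper_walkE)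
    have "V \<noteq> inw V" using not_palindrome[OF walk_chain[OF V(1)]] by metis
    then show "(\<Sum>W\<in>{W \<in> words_of F. walk_of W = \<omega>}. h (walk_of W)) = 2 * h \<omega>"
      unfolding V(2) fibre_words_of[OF V(1) w[unfolded V(2)]] by simp
  qed
  finally show ?thesis by (simp add: sum_distrib_left)
qed

lemma gvec_sum_words_of:
  assumes F: "F \<in> faces"
  shows "(\<Sum>W\<in>words_of F. a (walk_of W) * real_of_int (gvec W v)) = 2 * (\<Sum>\<omega>\<in>F. a \<omega> *\<^sub>R g \<omega>) $ v"
proof -
  have "(\<Sum>W\<in>words_of F. a (walk_of W) * real_of_int (gvec W v)) = (\<Sum>W\<in>words_of F. a (walk_of W) * g (walk_of W) $ v)"
    by (rule sum.cong) (auto simp: words_of_def g_vector_walk_of)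
  also have "\<dots> = 2 * (\<Sum>\<omega>\<in>F. a \<omega> * g \<omega> $ v)" using sum_words_of[OF F, of "\<lambda>\<omega>. a \<omega> * g \<omega> $ v"] by simp
  finally show ?thesis by simp
qed

lemma face_unique:
  assumes F: "F \<in> faces" "\<And>\<omega>. \<omega> \<in> F \<Longrightarrow> 0 \<le> a \<omega>" and G: "G \<in> faces" "\<And>\<omega>. \<omega> \<in> G \<Longrightarrow> 0 \<le> b \<omega>"
    and eq: "(\<Sum>\<omega>\<in>F. a \<omega> *\<^sub>R g \<omega>) = (\<Sum>\<omega>\<in>G. b \<omega> *\<^sub>R g \<omega>)" and w: "\<omega> \<in> F \<union> G"
  shows "(if \<omega> \<in> F then a \<omega> else 0) = (if \<omega> \<in> G then b \<omega> else 0)"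
proof -
  have "\<omega> \<in> proper_walks B J" using w face_proper[OF F(1)] face_proper[OF G(1)] by blast
  then obtain W where W: "walk W" "\<omega> = walk_of W" by (rule proper_walkE)
  have "(if W \<in> words_of F then a (walk_of W) else 0) = (if W \<in> words_of G then b (walk_of W) else 0)"
  proof (rule family_weights_unique[OF family_words_of[OF F(1)] _ _ family_words_of[OF G(1)]])
    show "(\<Sum>W\<in>words_of F. a (walk_of W) * real_of_int (gvec W v)) = (\<Sum>W\<in>words_of G. b (walk_of W) * real_of_int (gvec W v))" for v
      by (simp only: gvec_sum_words_of[OF F(1)] gvec_sum_words_of[OF G(1)] eq)
  qed (use F(2) G(2) W w in \<open>auto simp: words_of_def\<close>)
  then show ?thesis by (simp only: words_of_def mem_Collect_eq W simp_thms)
qed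

lemma face_independent:
  assumes F: "F \<in> faces" and eq: "(\<Sum>\<omega>\<in>F. c \<omega> *\<^sub>R g \<omega>) = 0" and w: "\<omega> \<in> F"
  shows "c \<omega> = 0"
proof -
  have "\<omega> \<in> proper_walks B J" using w face_proper[OF F(1)] by blast
  then obtain W where W: "walk W" "\<omega> = walk_of W" by (rule proper_walkE)
  have "c (walk_of W) = 0"
    by (rule family_independent[OF family_words_of[OF F], where c = "\<lambda>W. c (walk_of W)" and W = W])
      (use gvec_sum_words_of[OF F, of c] eq W w in \<open>auto simp: words_of_def\<close>)
  then show ?thesis using W by simp
qed

lemma singleton_face: "\<omega> \<in> proper_walks B J \<Longrightarrow> {\<omega>} \<in> faces"
  unfolding non_kissing_complex_def proper_walks_def kissing_def by blast

text \<open>Apply \<open>face_unique\<close> with weight 1 to the two one-element faces.\<close>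

lemma g_inj: "inj_on g (proper_walks B J)"
proof (rule inj_onI)
  fix \<omega> \<omega>' assume w: "\<omega> \<in> proper_walks B J" "\<omega>' \<in> proper_walks B J" and eq: "g \<omega> = g \<omega>'"
  have "(if \<omega> \<in> {\<omega>} then 1 else 0 :: real) = (if \<omega> \<in> {\<omega>'} then 1 else 0)"
    by (rule face_unique[OF singleton_face[OF w(1)] _ singleton_face[OF w(2)]]) (use eq in auto)
  then show "\<omega> = \<omega>'" by (auto split: if_splits)
qed

lemma g_inj_face: "F \<in> faces \<Longrightarrow> inj_on g F"
  by (rule inj_on_subset[OF g_inj face_proper])

abbreviation fan where "fan \<equiv> non_kissing_fan Q J"

section \<open>Uniqueness of representations in the fan and exchange\<close>

lemma fanE:
  assumes "R \<in> fan" obtains F where "F \<in> faces" "R = g ` F"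
proof -
  from assms obtain F where "F \<in> faces" "R = g ` F" unfolding non_kissing_fan_def by (rule imageE)
  then show ?thesis by (intro that)
qed

lemma face_fan: "F \<in> faces \<Longrightarrow> g ` F \<in> fan"
  unfolding non_kissing_fan_def by (rule imageI)

lemma fan_finite: assumes "R \<in> fan" shows "finite R"
proof -
  from assms obtain F where "F \<in> faces" "R = g ` F" by (rule fanE)
  then show ?thesis by (simp only: face_finite finite_imageI)
qed

lemma fan_subset: assumes R: "R \<in> fan" and S: "S \<subseteq> R" shows "S \<in> fan"
proof -
  from R obtain F where F: "F \<in> faces" "R = g ` F" by (rule fanE)
  obtain G where "G \<subseteq> F" "S = g ` G" using S unfolding F(2) subset_image_iff by blast
  then show ?thesis using face_fan[OF face_subset[OF F(1)]] by blast
qed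

lemma fan_unique:
  assumes R: "R \<in> fan" "\<And>r. r \<in> R \<Longrightarrow> 0 \<le> a r" and S: "S \<in> fan" "\<And>r. r \<in> S \<Longrightarrow> 0 \<le> b r"
    and eq: "(\<Sum>r\<in>R. a r *\<^sub>R r) = (\<Sum>r\<in>S. b r *\<^sub>R r)"
  shows "(if r \<in> R then a r else 0) = (if r \<in> S then b r else 0)"
proof (cases "r \<in> R \<union> S")
  case True
  from R(1) obtain F where F: "F \<in> faces" "R = g ` F" by (rule fanE)
  from S(1) obtain G where G: "G \<in> faces" "S = g ` G" by (rule fanE)
  from True F G obtain \<omega> where w: "r = g \<omega>" "\<omega> \<in> F \<union> G" by blast
  have mem: "g \<omega> \<in> g ` H \<longleftrightarrow> \<omega> \<in> H" if "H \<in> faces" for H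
    using inj_on_image_mem_iff[OF g_inj] that w(2) face_proper F(1) G(1) by (meson UnE subsetD)
  have "(if \<omega> \<in> F then a (g \<omega>) else 0) = (if \<omega> \<in> G then b (g \<omega>) else 0)"
    by (rule face_unique[OF F(1) _ G(1), where a = "\<lambda>\<omega>. a (g \<omega>)" and b = "\<lambda>\<omega>. b (g \<omega>)"])
      (use eq w(2) R(2) S(2) in \<open>simp_all add: F(2) G(2) sum.reindex[OF g_inj_face[OF F(1)]]
        sum.reindex[OF g_inj_face[OF G(1)]]\<close>)
  then show ?thesis unfolding w(1) F(2) G(2) mem[OF F(1)] mem[OF G(1)] .
qed simp

lemma fan_independent:
  assumes R: "R \<in> fan" and eq: "(\<Sum>r\<in>R. c r *\<^sub>R r) = 0" and r: "r \<in> R"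
  shows "c r = 0"
proof -
  from R obtain F where F: "F \<in> faces" "R = g ` F" by (rule fanE)
  from r F obtain \<omega> where w: "r = g \<omega>" "\<omega> \<in> F" by blast
  have "c (g \<omega>) = 0"
    by (rule face_independent[OF F(1), where c = "\<lambda>\<omega>. c (g \<omega>)"])
      (use eq w(2) in \<open>simp_all add: F(2) sum.reindex[OF g_inj_face[OF F(1)]]\<close>)
  then show ?thesis using w by simp
qed

text \<open>Maximality is stated for cones. If adding \<omega> does not enlarge the cone, then
  \<open>g \<omega>\<close> is a nonnegative combination over \<open>F\<close>, and by
  \<open>fan_unique\<close> it must be one of its rays.\<close>

lemma maximal_face:
  assumes F: "F \<in> faces" and m: "spans_maximal_cone fan (g ` F)" and w: "insert \<omega> F \<in> faces"
  shows "\<omega> \<in> F"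
proof -
  have pw: "\<omega> \<in> proper_walks B J" using face_proper[OF w] by blast
  have "convex_cone hull (g ` F) \<subseteq> convex_cone hull (g ` insert \<omega> F)" by (intro hull_mono) blast
  then have "convex_cone hull (g ` insert \<omega> F) = convex_cone hull (g ` F)"
    using m face_fan[OF w] unfolding spans_maximal_cone_def by blast
  then have "g \<omega> \<in> convex_cone hull (g ` F)" using hull_inc[of "g \<omega>" "g ` insert \<omega> F" convex_cone] by simp
  then have "g \<omega> \<in> {\<Sum>r\<in>g ` F. a r *\<^sub>R r | a. \<forall>r\<in>g ` F. 0 \<le> a r}"
    using convex_cone_hull_finite_subset[OF finite_imageI[OF face_finite[OF F]]] by blast
  then obtain a where a: "g \<omega> = (\<Sum>r\<in>g ` F. a r *\<^sub>R r)" "\<And>r. r \<in> g ` F \<Longrightarrow> 0 \<le> a r" by blast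
  have "(if g \<omega> \<in> g ` {\<omega>} then 1 else 0) = (if g \<omega> \<in> g ` F then a (g \<omega>) else 0)"
    by (rule fan_unique[OF face_fan[OF singleton_face[OF pw]] _ face_fan[OF F] a(2)]) (use a(1) in auto)
  then have "g \<omega> \<in> g ` F" by (auto split: if_splits)
  then show ?thesis using inj_on_image_mem_iff[OF g_inj pw face_proper[OF F]] by blast
qed

lemma maximal_family_words_of:
  assumes F: "F \<in> faces" and m: "spans_maximal_cone fan (g ` F)"
  shows "maximal_family (words_of F)"
  unfolding maximal_family_def
proof (intro conjI allI impI)
  note fam = family_words_of[OF F]
  show "finite (words_of F)" "\<forall>W\<in>words_of F. walk W \<and> mixed W \<and> inw W \<in> words_of F" "\<forall>W\<in>words_of F. \<forall>V\<in>words_of F. \<not> kiss W V"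
    using fam unfolding family_def by blast+
  fix Z assume Z: "walk Z" "mixed Z" "\<not> kiss Z Z" "\<not> kiss Z (inw Z)" and n: "\<forall>V\<in>words_of F. \<not> kiss Z V \<and> \<not> kiss V Z"
  have pZ: "walk_of Z \<in> proper_walks B J" unfolding proper_walks_eq using Z by blast
  have "\<not> kissing B (walk_of Z) \<omega> \<and> \<not> kissing B \<omega> (walk_of Z)" if w: "\<omega> \<in> F" for \<omega>
  proof -
    have "\<omega> \<in> proper_walks B J" using w face_proper[OF F] by blast
    then obtain V where V: "walk V" "\<omega> = walk_of V" by (rule proper_walkE)
    then have "V \<in> words_of F" "inw V \<in> words_of F" using w by (simp_all add: words_of_def)
    then have "\<not> kiss Z V" "\<not> kiss Z (inw V)" "\<not> kiss V Z" "\<not> kiss (inw V) Z" using n by blast+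
    moreover have "kiss V (inw Z) \<longleftrightarrow> kiss (inw V) Z"
      using kiss_inw[of "inw V" Z] walk_chain[of Z] walk_chain[of "inw V"] V Z by simp
    ultimately show ?thesis using kisses_iff[OF Z(1) V(1)] kisses_iff[OF V(1) Z(1)] V(2)
      unfolding kissing_def by blast
  qed
  moreover have "\<not> kissing B (walk_of Z) (walk_of Z)" using pZ unfolding proper_walks_def kissing_def by blast
  ultimately have "insert (walk_of Z) F \<in> faces" using F pZ unfolding non_kissing_complex_def by blast
  then have "walk_of Z \<in> F" by (rule maximal_face[OF F m])
  then show "Z \<in> words_of F" using Z by (simp add: words_of_def)
qed

text \<open>The relation of words is carried over to rays. Injectivity of \<open>g\<close> on proper
  walks turns the common set of rays into a common face \<open>G\<close>.\<close>

lemma exchange_pair_relation: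
  assumes "exchange_pair fan r r' R R'"
  shows "r \<noteq> r'" "r' \<notin> R" "r \<notin> R'"
    "\<exists>a. (\<forall>s\<in>R - {r}. 0 \<le> a s) \<and> r + r' = (\<Sum>s\<in>R - {r}. a s *\<^sub>R s)"
proof -
  from assms have mR: "spans_maximal_cone fan R" and mR': "spans_maximal_cone fan R'"
    and adj: "convex_cone hull R \<noteq> convex_cone hull R'" and r: "r \<in> R" "r' \<in> R'" and P: "R - {r} = R' - {r'}"
    unfolding exchange_pair_def adjacent_cones_def by blast+
  have RR': "R \<noteq> R'" using adj by blast
  show rr: "r \<noteq> r'" using RR' r P by blast
  show r'R: "r' \<notin> R" using rr P by blast
  show "r \<notin> R'" using rr P by blast
  have fan: "R \<in> fan" "R' \<in> fan" using mR mR' unfolding spans_maximal_cone_def by blast+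
  from fan(1) obtain F where F: "F \<in> faces" "R = g ` F" by (rule fanE)
  from fan(2) obtain F' where F': "F' \<in> faces" "R' = g ` F'" by (rule fanE)
  from r F obtain \<omega> where w: "r = g \<omega>" "\<omega> \<in> F" by blast
  from r F' obtain \<omega>' where w': "r' = g \<omega>'" "\<omega>' \<in> F'" by blast
  define G where "G = F - {\<omega>}"
  have gG: "g ` G = R - {r}"
    using inj_on_image_set_diff[OF g_inj_face[OF F(1)], of F "{\<omega>}"] w F(2) by (simp add: G_def)
  have gG': "g ` (F' - {\<omega>'}) = R' - {r'}"
    using inj_on_image_set_diff[OF g_inj_face[OF F'(1)], of F' "{\<omega>'}"] w' F'(2) by simp
  have "F' - {\<omega>'} \<subseteq> proper_walks B J" "G \<subseteq> proper_walks B J"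
    using face_proper[OF F(1)] face_proper[OF F'(1)] unfolding G_def by blast+
  moreover have "g ` (F' - {\<omega>'}) = g ` G" unfolding gG gG' P ..
  ultimately have "F' - {\<omega>'} = G" by (simp only: inj_on_image_eq_iff[OF g_inj])
  then have FF: "F = insert \<omega> G" "F' = insert \<omega>' G" "\<omega> \<notin> G" "\<omega>' \<notin> G" using w(2) w'(2) unfolding G_def by blast+
  have G: "G \<in> faces" using face_subset[OF F(1)] by (simp add: G_def)
  have pw: "\<omega> \<in> proper_walks B J" "\<omega>' \<in> proper_walks B J" using face_proper F(1) F'(1) w w' by blast+
  obtain W where W: "walk W" "\<omega> = walk_of W" using pw(1) by (rule proper_walkE)
  obtain V where V: "walk V" "\<omega>' = walk_of V" using pw(2) by (rule proper_walkE)
  have ne: "\<omega> \<noteq> \<omega>'" using rr w w' by blast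
  have rF: "words_of F = insert W (insert (inw W) (words_of G))" and rF': "words_of F' = insert V (insert (inw V) (words_of G))"
    using W V unfolding FF words_of_def by (auto simp: walk_of_eq)
  have notin: "W \<notin> words_of G" "inw W \<notin> words_of G" "V \<notin> words_of G" "inw V \<notin> words_of G" "V \<noteq> W" "V \<noteq> inw W"
    using FF(3,4) W V ne by (auto simp: words_of_def)
  obtain k :: "('e + 'v blossom) letter list \<Rightarrow> int" where k: "\<And>U. k (inw U) = k U" "\<And>U. U \<in> words_of G \<Longrightarrow> 0 \<le> k U"
    "\<And>a. 2 * (gvec W a + gvec V a) = (\<Sum>U\<in>words_of G. k U * gvec U a)"
    using exchange_relation[OF maximal_family_words_of[OF F(1) mR[unfolded F(2)], unfolded rF]
        maximal_family_words_of[OF F'(1) mR'[unfolded F'(2)], unfolded rF'] notin] by blast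
  \<comment> \<open>The coefficient of a walk is that of either of its two words; the choice does
    not matter since \<open>k\<close> is invariant under \<open>inw\<close>.\<close>
  define \<kappa> where "\<kappa> \<eta> = real_of_int (k (SOME U. walk_of U = \<eta>))" for \<eta>
  have \<kappa>: "\<kappa> (walk_of U) = real_of_int (k U)" for U
  proof -
    have "walk_of (SOME U'. walk_of U' = walk_of U) = walk_of U" by (rule someI[where x = U]) simp
    then have "U = (SOME U'. walk_of U' = walk_of U) \<or> U = inw (SOME U'. walk_of U' = walk_of U)" by (simp only: walk_of_eq)
    then show ?thesis unfolding \<kappa>_def using k(1) by metis
  qed
  have "(r + r') $ v = (\<Sum>\<eta>\<in>G. \<kappa> \<eta> *\<^sub>R g \<eta>) $ v" for v
  proof -
    have "2 * (r + r') $ v = real_of_int (2 * (gvec W v + gvec V v))"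
      using w w' W V by (simp add: g_vector_walk_of)
    also have "\<dots> = (\<Sum>U\<in>words_of G. \<kappa> (walk_of U) * real_of_int (gvec U v))" unfolding k(3) by (simp add: \<kappa>)
    also have "\<dots> = 2 * (\<Sum>\<eta>\<in>G. \<kappa> \<eta> *\<^sub>R g \<eta>) $ v" by (rule gvec_sum_words_of[OF G])
    finally show ?thesis by (rule iffD1[OF mult_left_cancel, rotated]) simp
  qed
  then have sum: "r + r' = (\<Sum>\<eta>\<in>G. \<kappa> \<eta> *\<^sub>R g \<eta>)" unfolding vec_eq_iff by blast
  define a where "a = \<kappa> \<circ> inv_into G g"
  have a: "a (g \<eta>) = \<kappa> \<eta>" if "\<eta> \<in> G" for \<eta> using that g_inj_face[OF G] by (simp add: a_def)
  have "0 \<le> \<kappa> \<eta>" if e: "\<eta> \<in> G" for \<eta>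
  proof -
    have "\<eta> \<in> proper_walks B J" using e face_proper[OF G] by blast
    then obtain U where "walk U" "\<eta> = walk_of U" by (rule proper_walkE)
    then show ?thesis using k(2)[of U] e by (simp add: \<kappa> words_of_def)
  qed
  then have "\<forall>s\<in>R - {r}. 0 \<le> a s" unfolding gG[symmetric] using a by simp
  moreover have "r + r' = (\<Sum>s\<in>R - {r}. a s *\<^sub>R s)"
    unfolding gG[symmetric] sum.reindex[OF g_inj_face[OF G]] sum using a by (intro sum.cong) simp_all
  ultimately show "\<exists>a. (\<forall>s\<in>R - {r}. 0 \<le> a s) \<and> r + r' = (\<Sum>s\<in>R - {r}. a s *\<^sub>R s)" by blast
qed

lemma exchange_dependence_iff:
  assumes e: "exchange_pair fan r r' R R'" and rel: "r + r' = (\<Sum>s\<in>R - {r}. a s *\<^sub>R s)"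
  shows "exchange_dependence r r' R R' \<beta> \<longleftrightarrow>
    \<beta> = (\<lambda>s. if s = r \<or> s = r' then 1 else if s \<in> R - {r} then - a s else 0)" (is "_ \<longleftrightarrow> \<beta> = ?\<alpha>")
proof -
  note ne = exchange_pair_relation(1-3)[OF e]
  define P where "P = R - {r}"
  have fan: "R \<in> fan" "R' \<in> fan" and r: "r \<in> R" "r' \<in> R'" and P: "R - {r} = R' - {r'}"
    using e unfolding exchange_pair_def spans_maximal_cone_def by simp_all
  have R: "R = insert r P" using r(1) unfolding P_def by blast
  have R': "R' = insert r' P" using r(2) unfolding P_def P by blast
  note R = R R'
  have rP: "r \<notin> P" "r' \<notin> P" using ne(2) unfolding P_def by blast+
  have fin: "finite P" using fan_finite[OF fan(1)] by (simp add: P_def)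
  have un: "R \<union> R' = insert r (insert r' P)" using R by blast
  have sum: "(\<Sum>s\<in>R \<union> R'. c s *\<^sub>R s) = c r *\<^sub>R r + (c r' *\<^sub>R r' + (\<Sum>s\<in>P. c s *\<^sub>R s))" for c
    unfolding un using fin rP ne by simp
  have rel: "r = (\<Sum>s\<in>P. a s *\<^sub>R s) - r'" using rel by (simp add: P_def eq_diff_eq)
  show ?thesis
  proof
    assume d: "exchange_dependence r r' R R' \<beta>"
    \<comment> \<open>The coefficients after eliminating \<open>r\<close> by means of
      \<open>rel\<close>: a dependence among the independent rays of \<open>R'\<close>. That they
      are 0 gives \<open>\<beta> r = \<beta> r'\<close>, hence both are 1, and
      \<open>\<beta> s = - a s\<close> on the common rays.\<close>
    define c where "c s = (if s = r' then \<beta> r' - \<beta> r else \<beta> s + \<beta> r * a s)" for s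
    have "(\<Sum>s\<in>R'. c s *\<^sub>R s) = (\<beta> r' - \<beta> r) *\<^sub>R r' + (\<Sum>s\<in>P. (\<beta> s + \<beta> r * a s) *\<^sub>R s)"
    proof -
      have "(\<Sum>s\<in>P. c s *\<^sub>R s) = (\<Sum>s\<in>P. (\<beta> s + \<beta> r * a s) *\<^sub>R s)"
        using rP by (intro sum.cong) (auto simp: c_def)
      then show ?thesis unfolding R(2) using fin rP by (simp add: c_def)
    qed
    also have "\<dots> = \<beta> r *\<^sub>R ((\<Sum>s\<in>P. a s *\<^sub>R s) - r') + (\<beta> r' *\<^sub>R r' + (\<Sum>s\<in>P. \<beta> s *\<^sub>R s))"
      by (simp add: scaleR_left_diff_distrib scaleR_right_diff_distrib scaleR_add_left sum.distrib scaleR_sum_right)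
    also have "\<dots> = 0" unfolding rel[symmetric] using d sum[of \<beta>] unfolding exchange_dependence_def by simp
    finally have c0: "c s = 0" if "s \<in> R'" for s using fan_independent[OF fan(2), of c] that by blast
    have "\<beta> r' - \<beta> r = 0" using c0[of r'] R(2) by (simp add: c_def)
    then have 1: "\<beta> r = 1" "\<beta> r' = 1" using d unfolding exchange_dependence_def by auto
    have 2: "\<beta> s = - a s" if "s \<in> P" for s
      using c0[of s] that rP R(2) 1 by (auto simp: c_def split: if_splits)
    have 3: "\<beta> s = 0" if "s \<notin> insert r (insert r' P)" for s
      using d that un unfolding exchange_dependence_def by blast
    show "\<beta> = ?\<alpha>"
      unfolding P_def[symmetric] using 1 2 3 by (intro ext) auto
  next
    assume b: "\<beta> = ?\<alpha>"
    have "(\<Sum>s\<in>P. \<beta> s *\<^sub>R s) = - (\<Sum>s\<in>P. a s *\<^sub>R s)"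
      unfolding sum_negf[symmetric] using rP by (intro sum.cong) (auto simp: b P_def)
    moreover have "\<beta> r = 1" "\<beta> r' = 1" by (simp_all add: b)
    ultimately have "(\<Sum>s\<in>R \<union> R'. \<beta> s *\<^sub>R s) = 0" unfolding sum using rel by simp
    moreover have "\<beta> s = 0" if "s \<notin> R \<union> R'" for s using that unfolding un b P_def by auto
    ultimately show "exchange_dependence r r' R R' \<beta>"
      using \<open>\<beta> r = 1\<close> \<open>\<beta> r' = 1\<close> unfolding exchange_dependence_def by simp
  qed
qed

lemma unique_exchange_relation: "unique_exchange_relation_property fan"
  unfolding unique_exchange_relation_property_def
proof (intro allI impI)
  fix r r' assume "exchangeable fan r r'"
  then obtain R0 R0' where e0: "exchange_pair fan r r' R0 R0'" unfolding exchangeable_def by blast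
  from exchange_pair_relation(4)[OF e0] obtain a0
    where a0: "\<And>s. s \<in> R0 - {r} \<Longrightarrow> 0 \<le> a0 s" "r + r' = (\<Sum>s\<in>R0 - {r}. a0 s *\<^sub>R s)" by blast
  define \<alpha> where "\<alpha> = (\<lambda>s. if s = r \<or> s = r' then 1 else if s \<in> R0 - {r} then - a0 s else 0)"
  have "exchange_dependence r r' R R' \<beta> \<longleftrightarrow> \<beta> = \<alpha>" if e: "exchange_pair fan r r' R R'" for R R' \<beta>
  proof -
    from exchange_pair_relation(4)[OF e] obtain a
      where a: "\<And>s. s \<in> R - {r} \<Longrightarrow> 0 \<le> a s" "r + r' = (\<Sum>s\<in>R - {r}. a s *\<^sub>R s)" by blast
    have fan: "R - {r} \<in> fan" "R0 - {r} \<in> fan"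
      using e e0 fan_subset[of R "R - {r}"] fan_subset[of R0 "R0 - {r}"]
      unfolding exchange_pair_def spans_maximal_cone_def by blast+
    \<comment> \<open>The point \<open>r + r'\<close> lies in both cones and has unique nonnegative
      coordinates there, so the coefficients do not depend on the exchange pair.\<close>
    have eq: "(if s \<in> R - {r} then a s else 0) = (if s \<in> R0 - {r} then a0 s else 0)" for s
      by (rule fan_unique[OF fan(1) a(1) fan(2) a0(1)]) (simp_all only: a(2)[symmetric] a0(2)[symmetric])
    have "(\<lambda>s. if s = r \<or> s = r' then 1 else if s \<in> R - {r} then - a s else 0) = \<alpha>"
    proof
      fix s
      show "(if s = r \<or> s = r' then 1 else if s \<in> R - {r} then - a s else 0) = \<alpha> s"
        using eq[of s] by (simp add: \<alpha>_def split: if_splits)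
    qed
    then show ?thesis using exchange_dependence_iff[OF e a(2)] by simp
  qed
  then show "\<exists>\<alpha>. \<forall>R R'. exchange_pair fan r r' R R' \<longrightarrow> (\<forall>\<beta>. exchange_dependence r r' R R' \<beta> \<longleftrightarrow> \<beta> = \<alpha>)"
    by blast
qed

end

theorem proposition2p34:
  fixes Q :: "('v::finite, 'e) pre_digraph"
    and I :: "('v \<times> 'e list \<Rightarrow> 'k::field) set"
    and J :: "(('v + 'v blossom) \<times> ('e + 'v blossom) list \<Rightarrow> 'k) set"
  assumes "verts Q = UNIV"
    and "gentle_quiver Q I"
    and "blossoming_ideal Q I J"
    and "non_kissing_finite Q J"
  shows "unique_exchange_relation_property (non_kissing_fan Q J)"
proof -
  interpret finite_blossoming Q I J
    using assms by unfold_locales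
  show ?thesis by (rule unique_exchange_relation)
qed

end
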